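(* For any odd integer $n\geq 3$ and any $q\in\{3,4,8,16\}$, $$\chi'(\mathrm{PG}(n,q))=\frac{q^n-1}{q-1}.$$
   Context: $\mathrm{PG}(n,q)$ denotes the $n$-dimensional projective space over the finite field $\mathbb{F}_q$: its points and lines are the 1-dimensional and 2-dimensional subspaces, respectively, of the $(n+1)$-dimensional vector space over $\mathbb{F}_q$. Two lines intersect if they have a common point. A line coloring of $\mathrm{PG}(n,q)$ is a mapping from the set of lines of $\mathrm{PG}(n,q)$ to a set of colors such that any two distinct intersecting lines have different colors. The chromatic index $\chi'(\mathrm{PG}(n,q))$ is the least number of colors for which a line coloring of $\mathrm{PG}(n,q)$ exists. *)

theory Defs
  imports "HOL-Analysis.Cartesian_Space"
begin

text \<open>
  For a finite field \<open>'a\<close> with \<open>q\<close> elements and an index type \<open>'n\<close> with \<open>n + 1\<close> elements,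
  \<open>'a ^ 'n\<close> is the \<open>(n + 1)\<close>-dimensional vector space over \<open>'a\<close>, and the following are the
  points and lines of \<open>PG(n, q)\<close>.
\<close>

definition pg_points :: "('a::field ^ 'n) set set" where
  "pg_points = {P. vec.subspace P \<and> vec.dim P = 1}"

definition pg_lines :: "('a::field ^ 'n) set set" where
  "pg_lines = {L. vec.subspace L \<and> vec.dim L = 2}"

definition pg_intersect :: "('a::field ^ 'n) set \<Rightarrow> ('a ^ 'n) set \<Rightarrow> bool" where
  "pg_intersect L M \<longleftrightarrow> (\<exists>P\<in>pg_points. P \<subseteq> L \<and> P \<subseteq> M)"

text \<open>Only the values of \<open>c\<close> on lines matter; \<open>C\<close> is the set of colors.\<close>

definition line_coloring :: "'c set \<Rightarrow> (('a::field ^ 'n) set \<Rightarrow> 'c) \<Rightarrow> bool" where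
  "line_coloring C c \<longleftrightarrow> c \<in> pg_lines \<rightarrow> C \<and>
     (\<forall>L\<in>pg_lines. \<forall>M\<in>pg_lines. L \<noteq> M \<and> pg_intersect L M \<longrightarrow> c L \<noteq> c M)"

text \<open>
  As the names of the colors are irrelevant, \<open>k\<close> colors are taken to be \<open>0, \<dots>, k - 1\<close>. The set of
  admissible \<open>k\<close> is nonempty because there are only finitely many lines. The type argument
  stands for the underlying vector space.
\<close>

definition pg_chromatic_index :: "('a::{field,finite} ^ 'n) itself \<Rightarrow> nat" where
  "pg_chromatic_index _ =
     (LEAST k. \<exists>c :: ('a ^ 'n) set \<Rightarrow> nat. line_coloring {..<k} c)"

end

theory Submission
  imports Defs "HOL-Algebra.Algebraic_Closure_Type"
begin

text \<open>
  Each colour class is a set of pairwise disjoint lines. The lines through one point pairwise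
  intersect and there are \<open>(q\<^sup>n - 1) / (q - 1)\<close> of them, so that many colours are necessary
  (\<open>colours_lower_bound\<close>). The work lies in partitioning the lines into this many classes.

  As \<open>n + 1\<close> is even, the underlying space is a vector space \<open>V\<close> over \<open>K = GF(q\<^sup>2)\<close>. Write
  \<open>V = Q \<oplus> K w\<close> with a \<open>K\<close>-hyperplane \<open>Q\<close>. The one-dimensional \<open>K\<close>-subspaces, called \<open>K\<close>-lines here,
  are lines of the projective space, and they form a spread. One colour is \<open>None\<close>; the others are
  the pairs \<open>(t, i)\<close> of a \<open>K\<close>-line \<open>t\<close> of \<open>Q\<close> and an affine \<open>F\<^sub>q\<close>-line \<open>i\<close> of \<open>K\<close>. This gives
  \<open>1 + q (q + 1) (q\<^sup>n\<^sup>-\<^sup>1 - 1) / (q\<^sup>2 - 1) = (q\<^sup>n - 1) / (q - 1)\<close> colours.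

  A line projects to \<open>Q\<close> along \<open>w\<close> in one of three ways. If the projection lies in a \<open>K\<close>-line \<open>t\<close>, the
  line lives in \<open>t \<oplus> K w\<close>, a copy of \<open>PG(3, q)\<close>, where a vector \<open>x e + y w\<close> with \<open>x \<noteq> 0\<close> has a
  slope \<open>y / x\<close> in \<open>K\<close>. A line that meets \<open>K w\<close> in a point has the points of an affine line as slopes,
  and that line is its colour. A line skew to \<open>K w\<close> has either one single slope, and then it gets
  the colour \<open>None\<close>, or slopes that run through the image \<open>u + v \<mu>\<close> of the norm-one curve
  \<open>\<mu> = {x. x\<^sup>q\<^sup>+\<^sup>1 = 1}\<close>. There is an affine line missing \<open>\<mu>\<close> (\<open>ex_external_line\<close>); its image under
  \<open>x \<mapsto> u + v x\<close> is the colour. It follows that two lines of \<open>t \<oplus> K w\<close> with the same colour are equal or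
  disjoint.

  If the projection is a line \<open>l\<close> of \<open>Q\<close> that is not a \<open>K\<close>-line, call it oblique, then the line is the
  graph over \<open>l\<close> of a map \<open>z \<mapsto> u z + v z\<^sup>q\<close>. Graphs over the same \<open>l\<close> with the same \<open>v\<close> are
  disjoint, so it suffices to give each oblique \<open>l\<close> and each \<open>v\<close> in \<open>K\<close> a colour \<open>\<kappa> l v = (t, i)\<close> with
  \<open>t\<close> disjoint from \<open>l\<close>, injectively in \<open>v\<close>, and such that intersecting oblique lines share no
  colour. Such a \<open>\<kappa>\<close> is called a scheme; it yields the colouring (\<open>class_disjoint\<close>, \<open>class_cover\<close>).

  An oblique line spans a unique \<open>K\<close>-plane, so schemes can be built plane by plane from
  one combinatorial object in a \<open>K\<close>-plane, that is, in \<open>PG(3, q)\<close>: a family of spreads, each of them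
  containing one distinguished \<open>K\<close>-line \<open>t\<close> and otherwise oblique lines, such that each \<open>t\<close> is
  distinguished at most \<open>q (q + 1)\<close> times and each oblique line lies in at least \<open>q\<^sup>2\<close> of the spreads
  (\<open>plane_design\<close>, \<open>scheme_exists\<close>). This is where \<open>q\<close> enters. The plane is identified with
  \<open>GF(q\<^sup>4)\<close>, on which the multiplicative group acts. For \<open>q = 4, 8, 16\<close> the orbits of oblique lines
  under that group are separated by an explicit invariant (\<open>orbit\<close>), and one or two spreads, given
  by affine functions on \<open>K\<close>, meet the orbits uniformly; this is a finite computation in \<open>GF(q)\<close>
  (\<open>design_even\<close>). For \<open>q = 3\<close> four spreads and their translates under a group of order ten
  suffice (\<open>design_three\<close>).
\<close>

section \<open>Subfields of an algebraically closed field\<close>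
lemma card_roots_separable:
  fixes p :: "'b::alg_closed_field poly"
  assumes "p \<noteq> 0" and "\<And>x. poly p x = 0 \<Longrightarrow> poly (pderiv p) x \<noteq> 0"
  shows "card {x. poly p x = 0} = degree p"
  using assms
proof (induction "degree p" arbitrary: p)
  case 0
  then obtain c where "p = [:c:]" by (metis degree_eq_zeroE)
  with 0 show ?case by simp
next
  case (Suc n)
  then obtain a where a: "poly p a = 0" using alg_closed_imp_poly_has_root[of p] by auto
  then obtain r where r: "p = [:-a, 1:] * r" by (metis dvdE poly_eq_0_iff_dvd)
  have r0: "r \<noteq> 0" using Suc.prems r by auto
  have "degree p = degree [:-a, 1:] + degree r"
    unfolding r by (rule degree_mult_eq) (use r0 in auto)
  then have dr: "degree r = n" using Suc.hyps(2) by simp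
  have pd: "poly (pderiv p) x = poly r x + (x - a) * poly (pderiv r) x" for x
    unfolding r pderiv_mult by (simp add: pderiv_pCons del: mult_pCons_left)
  have ra: "poly r a \<noteq> 0" using Suc.prems(2)[OF a] by (simp add: pd)
  have "card {x. poly r x = 0} = degree r"
  proof (rule Suc.hyps(1))
    show "poly (pderiv r) x \<noteq> 0" if "poly r x = 0" for x
      using Suc.prems(2)[of x] that by (simp add: pd) (simp add: r del: mult_pCons_left)
  qed (use dr r0 in auto)
  moreover have "{x. poly p x = 0} = insert a {x. poly r x = 0}" by (auto simp: r)
  ultimately show ?case
    using ra dr Suc.hyps(2) r0 by (simp add: poly_roots_finite)
qed

lemma card_fixed_power:
  assumes "of_nat N = (0::'b::alg_closed_field)" and "N \<ge> 2"
  shows "card {x::'b. x ^ N = x} = N"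
proof -
  define p :: "'b poly" where "p = monom 1 N + monom (- 1) 1"
  have dp: "degree p = N"
    unfolding p_def by (subst degree_add_eq_left) (use assms in \<open>auto simp: degree_monom_eq\<close>)
  have "card {x. poly p x = 0} = degree p"
  proof (rule card_roots_separable)
    show "p \<noteq> 0" using dp assms by auto
    show "poly (pderiv p) x \<noteq> 0" for x
      using assms by (simp add: p_def pderiv_monom pderiv_add pderiv_pCons poly_monom)
  qed
  then show ?thesis by (simp add: dp) (simp add: p_def poly_monom)
qed

lemma card_roots_unity:
  assumes "of_nat N \<noteq> (0::'b::alg_closed_field)"
  shows "card {x::'b. x ^ N = 1} = N"
proof -
  have N: "N > 0" using assms by (cases N) auto
  define p :: "'b poly" where "p = monom 1 N + [:- 1:]"
  have dp: "degree p = N"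
    unfolding p_def by (subst degree_add_eq_left) (use N in \<open>auto simp: degree_monom_eq\<close>)
  have "card {x. poly p x = 0} = degree p"
  proof (rule card_roots_separable)
    show "p \<noteq> 0" using dp N by auto
    show "poly (pderiv p) x \<noteq> 0" if "poly p x = 0" for x
      using assms that N by (auto simp: p_def pderiv_monom pderiv_add pderiv_pCons poly_monom power_0_left)
  qed
  then show ?thesis by (simp add: dp) (simp add: p_def poly_monom)
qed

lemma card_additive_kernel:
  assumes "of_nat N = (0::'b::alg_closed_field)" and "N \<ge> 2" and "a \<noteq> 0" "b \<noteq> (0::'b)"
  shows "card {x::'b. a * x ^ N + b * x = 0} = N"
proof -
  define p :: "'b poly" where "p = monom a N + monom b 1"
  have dp: "degree p = N"
    unfolding p_def by (subst degree_add_eq_left) (use assms in \<open>auto simp: degree_monom_eq\<close>)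
  have "card {x. poly p x = 0} = degree p"
  proof (rule card_roots_separable)
    show "p \<noteq> 0" using dp assms by auto
    show "poly (pderiv p) x \<noteq> 0" for x
      using assms by (simp add: p_def pderiv_monom pderiv_add poly_monom)
  qed
  then show ?thesis by (simp add: dp) (simp add: p_def poly_monom)
qed

text \<open>
  The hypotheses say that \<open>q\<close> is a multiple of the characteristic and that \<open>x \<mapsto> x\<^sup>q\<close> is additive,
  so the fixed points of the powers of this map are fields. \<open>Fq\<close>, \<open>K\<close> and \<open>F\<close> below are the fields
  with \<open>q\<close>, \<open>q\<^sup>2\<close> and \<open>q\<^sup>4\<close> elements, and \<open>\<mu>\<close> is the group of elements of \<open>K\<close> of norm one over \<open>Fq\<close>.
  The argument \<open>ty\<close> only carries the type.
\<close>
locale frobenius_field =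
  fixes q :: nat and ty :: "'b::alg_closed_field itself"
  assumes q3: "q \<ge> 3"
    and q0: "of_nat q = (0::'b)"
    and frob_add: "\<And>x y::'b. (x + y) ^ q = x ^ q + y ^ q"
begin

definition \<sigma> :: "'b \<Rightarrow> 'b" where "\<sigma> x = x ^ q"
definition Fq :: "'b set" where "Fq = {x. \<sigma> x = x}"
definition K :: "'b set" where "K = {x. \<sigma> (\<sigma> x) = x}"
definition F :: "'b set" where "F = {x. \<sigma> (\<sigma> (\<sigma> (\<sigma> x))) = x}"
definition \<mu> :: "'b set" where "\<mu> = {x. x * \<sigma> x = 1}"

lemma sig_add [simp]: "\<sigma> (x + y) = \<sigma> x + \<sigma> y" by (simp add: \<sigma>_def frob_add)
lemma sig_mult [simp]: "\<sigma> (x * y) = \<sigma> x * \<sigma> y" by (simp add: \<sigma>_def power_mult_distrib)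
lemma sig_0 [simp]: "\<sigma> 0 = 0" using q3 by (simp add: \<sigma>_def)
lemma sig_1 [simp]: "\<sigma> 1 = 1" by (simp add: \<sigma>_def)
lemma sig_minus [simp]: "\<sigma> (- x) = - \<sigma> x"
  using sig_add[of x "- x"] by (simp del: sig_add add: minus_unique)
lemma sig_diff [simp]: "\<sigma> (x - y) = \<sigma> x - \<sigma> y" using sig_add[of x "- y"] by simp
lemma sig_power [simp]: "\<sigma> (x ^ k) = \<sigma> x ^ k" by (simp add: \<sigma>_def mult.commute flip: power_mult)
lemma sig_inverse [simp]: "\<sigma> (inverse x) = inverse (\<sigma> x)" by (simp add: \<sigma>_def power_inverse)
lemma sig_divide [simp]: "\<sigma> (x / y) = \<sigma> x / \<sigma> y" by (simp add: \<sigma>_def power_divide)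
lemma sig_eq_0 [simp]: "\<sigma> x = 0 \<longleftrightarrow> x = 0" using q3 by (simp add: \<sigma>_def)
lemma sig_eq_iff [simp]: "\<sigma> x = \<sigma> y \<longleftrightarrow> x = y"
  using sig_eq_0[of "x - y"] by (simp del: sig_eq_0)

lemma Fq_closed [simp]:
  "0 \<in> Fq" "1 \<in> Fq" "x \<in> Fq \<Longrightarrow> y \<in> Fq \<Longrightarrow> x + y \<in> Fq" "x \<in> Fq \<Longrightarrow> y \<in> Fq \<Longrightarrow> x * y \<in> Fq"
  "x \<in> Fq \<Longrightarrow> y \<in> Fq \<Longrightarrow> x - y \<in> Fq" "x \<in> Fq \<Longrightarrow> - x \<in> Fq"  "x \<in> Fq \<Longrightarrow> inverse x \<in> Fq"
  "x \<in> Fq \<Longrightarrow> y \<in> Fq \<Longrightarrow> x / y \<in> Fq" "x \<in> Fq \<Longrightarrow> x ^ k \<in> Fq" by (auto simp: Fq_def)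
lemma K_closed [simp]:
  "0 \<in> K" "1 \<in> K" "x \<in> K \<Longrightarrow> y \<in> K \<Longrightarrow> x + y \<in> K" "x \<in> K \<Longrightarrow> y \<in> K \<Longrightarrow> x * y \<in> K"
  "x \<in> K \<Longrightarrow> y \<in> K \<Longrightarrow> x - y \<in> K" "x \<in> K \<Longrightarrow> - x \<in> K"  "x \<in> K \<Longrightarrow> inverse x \<in> K"
  "x \<in> K \<Longrightarrow> y \<in> K \<Longrightarrow> x / y \<in> K" "x \<in> K \<Longrightarrow> x ^ k \<in> K" "x \<in> K \<Longrightarrow> \<sigma> x \<in> K" by (auto simp: K_def)
lemma F_closed [simp]:
  "0 \<in> F" "1 \<in> F" "x \<in> F \<Longrightarrow> y \<in> F \<Longrightarrow> x + y \<in> F" "x \<in> F \<Longrightarrow> y \<in> F \<Longrightarrow> x * y \<in> F"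
  "x \<in> F \<Longrightarrow> y \<in> F \<Longrightarrow> x - y \<in> F" "x \<in> F \<Longrightarrow> - x \<in> F"  "x \<in> F \<Longrightarrow> inverse x \<in> F"
  "x \<in> F \<Longrightarrow> y \<in> F \<Longrightarrow> x / y \<in> F" "x \<in> F \<Longrightarrow> x ^ k \<in> F" "x \<in> F \<Longrightarrow> \<sigma> x \<in> F" by (auto simp: F_def)

lemma Fq_K [simp]: "x \<in> Fq \<Longrightarrow> x \<in> K" by (simp add: Fq_def K_def)
lemma K_F [simp]: "x \<in> K \<Longrightarrow> x \<in> F" by (simp add: K_def F_def)
lemma sig_Fq: "x \<in> Fq \<Longrightarrow> \<sigma> x = x" by (simp add: Fq_def)
lemma sig_K: "x \<in> K \<Longrightarrow> \<sigma> (\<sigma> x) = x" by (simp add: K_def)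
lemma sig_F: "x \<in> F \<Longrightarrow> \<sigma> (\<sigma> (\<sigma> (\<sigma> x))) = x" by (simp add: F_def)

lemma sig2: "\<sigma> (\<sigma> x) = x ^ q\<^sup>2" by (simp add: \<sigma>_def power2_eq_square flip: power_mult)
lemma sig4: "\<sigma> (\<sigma> (\<sigma> (\<sigma> x))) = x ^ q ^ 4"
  by (simp add: \<sigma>_def power2_eq_square power4_eq_xxxx mult.assoc flip: power_mult)

lemma qpow0: "k > 0 \<Longrightarrow> of_nat (q ^ k) = (0::'b)" using q0 by simp

lemma qpow2: "k > 0 \<Longrightarrow> q ^ k \<ge> 2"
  using q3 self_le_power[of q k] by linarith

lemma card_Fq: "card Fq = q"
  unfolding Fq_def \<sigma>_def using card_fixed_power[OF q0] q3 by simp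
lemma card_K: "card K = q\<^sup>2"
  unfolding K_def sig2 using card_fixed_power[OF qpow0 qpow2] by simp
lemma card_F: "card F = q ^ 4"
  unfolding F_def sig4 using card_fixed_power[OF qpow0 qpow2] by simp

lemma finite_Fq [simp]: "finite Fq" using card_Fq q3 card_gt_0_iff[of Fq] by simp
lemma finite_K [simp]: "finite K" using card_K q3 card_gt_0_iff[of K] by simp
lemma finite_F [simp]: "finite F" using card_F q3 card_gt_0_iff[of F] by simp

lemma card_\<mu>: "card \<mu> = q + 1"
  using card_roots_unity[where 'b = 'b and N = "q + 1"] q0 by (simp add: \<mu>_def \<sigma>_def)
lemma finite_\<mu> [simp]: "finite \<mu>" using card_\<mu> card_gt_0_iff[of \<mu>] by simp

lemma \<mu>_nonzero: "x \<in> \<mu> \<Longrightarrow> x \<noteq> 0" by (auto simp: \<mu>_def)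
lemma sig_\<mu>: "x \<in> \<mu> \<Longrightarrow> \<sigma> x = inverse x" by (simp add: \<mu>_def inverse_unique)
lemma \<mu>_K [simp]: "x \<in> \<mu> \<Longrightarrow> x \<in> K" by (simp add: K_def sig_\<mu>)

lemma \<mu>_quotient: "x \<in> K \<Longrightarrow> x \<noteq> 0 \<Longrightarrow> \<sigma> x / x \<in> \<mu>" by (simp add: \<mu>_def sig_K)
lemma \<mu>_root: assumes "\<eta> \<in> \<mu>" obtains b where "b \<in> K" "b \<noteq> 0" "\<sigma> b / b = \<eta>"
proof -
  obtain b where b: "b ^ (q - 1) = \<eta>" using nth_root_exists[of "q - 1" \<eta>] q3 by auto
  have b0: "b \<noteq> 0" using b \<mu>_nonzero[OF assms] q3 by (auto simp: power_0_left split: if_splits)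
  have s: "\<sigma> b = b * \<eta>" using q3 by (simp add: \<sigma>_def flip: b power_Suc)
  have "\<sigma> (\<sigma> b) = b" using assms by (simp add: s \<mu>_def mult.assoc)
  moreover have "\<sigma> b / b = \<eta>" using b0 s by simp
  ultimately show ?thesis using that b0 by (simp add: K_def)
qed

lemma quotient_eq_Fq:
  assumes "x \<noteq> 0" "y \<noteq> 0" "\<sigma> x / x = \<sigma> y / y" shows "x / y \<in> Fq"
  using assms by (simp add: Fq_def field_simps)

lemma obtain_\<omega>: obtains \<omega> where "\<omega> \<in> K" "\<omega> \<notin> Fq"
proof -
  have "card Fq < card K" using card_Fq card_K q3 by (simp add: power2_eq_square)
  then show thesis using that by (metis card_mono finite_Fq linorder_not_less subsetI)
qed

text \<open>
  Take a point \<open>p\<close> outside \<open>\<mu>\<close> on a secant of \<open>\<mu>\<close>; this needs a third point on a line with \<open>q\<close> points,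
  hence \<open>q \<ge> 3\<close>. Two points of \<open>\<mu>\<close> are seen from \<open>p\<close> in the same direction, so the \<open>q + 1\<close> points of \<open>\<mu>\<close>
  do not exhaust the \<open>q + 1\<close> directions, and the line through \<open>p\<close> in a missing direction avoids \<open>\<mu>\<close>.
\<close>
lemma ex_external_line:
  "\<exists>\<eta>\<in>\<mu>. \<exists>c\<in>K. \<eta> * \<sigma> c + c = 0 \<and> (\<forall>\<xi>\<in>\<mu>. \<sigma> \<xi> - \<eta> * \<xi> \<noteq> c)"
proof -
  obtain \<xi> where \<xi>: "\<xi> \<in> \<mu>" "\<xi> \<noteq> 1"
  proof -
    have "\<not> \<mu> \<subseteq> {1}" using card_mono[of "{1}" \<mu>] card_\<mu> q3 by auto
    then show ?thesis using that by auto
  qed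
  obtain r where r: "r \<in> Fq" "r \<noteq> 0" "r \<noteq> 1"
  proof -
    have "\<not> Fq \<subseteq> {0, 1}" using card_mono[of "{0,1}" Fq] card_Fq q3 by auto
    then show ?thesis using that by auto
  qed
  (* \<open>p\<close> lies on the secant through \<open>1\<close> and \<open>\<xi>\<close>; the direction of a nonzero \<open>d\<close> is \<open>\<sigma> d / d\<close>. *)
  define p where "p = 1 + r * (\<xi> - 1)"
  have pK: "p \<in> K" using r \<xi> by (simp add: p_def)
  have sx: "\<sigma> \<xi> = inverse \<xi>" using \<xi> by (simp add: sig_\<mu>)
  have p\<mu>: "p \<notin> \<mu>"
  proof
    assume "p \<in> \<mu>"
    then have "(1 + r * (\<xi> - 1)) * (1 + r * (inverse \<xi> - 1)) = 1"
      using r by (simp add: \<mu>_def p_def sx sig_Fq)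
    moreover have "(1 + r * (\<xi> - 1)) * (1 + r * (inverse \<xi> - 1)) - 1 = - r * (r - 1) * (\<xi> - 1) ^ 2 * inverse \<xi>"
      using \<mu>_nonzero[OF \<xi>(1)] by (simp add: field_simps power2_eq_square)
    ultimately show False using r \<xi> \<mu>_nonzero[OF \<xi>(1)] by simp
  qed
  define h where "h z = \<sigma> (z - p) / (z - p)" for z
  have hm: "h ` \<mu> \<subseteq> \<mu>" 
  proof
    fix y assume "y \<in> h ` \<mu>"
    then obtain z where "z \<in> \<mu>" "y = h z" by auto
    then show "y \<in> \<mu>" using p\<mu> pK unfolding h_def by (auto intro!: \<mu>_quotient simp del: sig_diff)
  qed
  have "h 1 = h \<xi>"
  proof -
    have *: "1 - p = (- r) * (\<xi> - 1)" "\<xi> - p = (1 - r) * (\<xi> - 1)" by (simp_all add: p_def algebra_simps)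
    show ?thesis unfolding h_def * using r by (simp add: sig_Fq)
  qed
  then have "\<not> inj_on h \<mu>" using \<xi> inj_onD[of h \<mu> 1 \<xi>] by (auto simp: \<mu>_def)
  then have "h ` \<mu> \<noteq> \<mu>" using eq_card_imp_inj_on[of \<mu> h] by auto
  then obtain \<eta> where \<eta>: "\<eta> \<in> \<mu>" "\<eta> \<notin> h ` \<mu>" using hm by auto
  define c where "c = \<sigma> p - \<eta> * p"
  have "\<eta> * \<sigma> c + c = 0" using pK \<eta> by (simp add: c_def sig_K sig_\<mu> algebra_simps \<mu>_nonzero)
  moreover have "\<sigma> z - \<eta> * z \<noteq> c" if "z \<in> \<mu>" for z
  proof
    assume "\<sigma> z - \<eta> * z = c"
    then have "\<sigma> (z - p) = \<eta> * (z - p)" by (simp add: c_def algebra_simps)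
    then have "h z = \<eta>" using that p\<mu> by (auto simp: h_def)
    with \<eta> that show False by auto
  qed
  moreover have "c \<in> K" using pK \<eta> by (simp add: c_def)
  ultimately show ?thesis using \<eta> by blast
qed

text \<open>
  The pair \<open>(\<eta>, c)\<close> encodes the affine \<open>Fq\<close>-line \<open>{x \<in> K. \<sigma> x - \<eta> x = c}\<close> with direction \<open>\<eta>\<close>; the condition on
  \<open>c\<close> says that this line is not empty. So \<open>I\<close> is the set of the \<open>q (q + 1)\<close> affine lines of \<open>K\<close>.
\<close>
definition I :: "('b \<times> 'b) set" where "I = (SIGMA \<eta>:\<mu>. {c. \<eta> * \<sigma> c + c = 0})"

lemma card_I: "card I = (q + 1) * q"
proof -
  have "card {c. \<eta> * \<sigma> c + c = 0} = q" if "\<eta> \<in> \<mu>" for \<eta>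
    unfolding \<sigma>_def using card_additive_kernel[of q \<eta> 1] q0 q3 \<mu>_nonzero[OF that] by simp
  then show ?thesis unfolding I_def
    by (subst card_SigmaI) (use card_\<mu> q3 in \<open>auto intro!: card_ge_0_finite\<close>)
qed
lemma finite_I [simp]: "finite I" using card_I card_gt_0_iff[of I] q3 by simp

lemma K_basis:
  assumes "\<omega> \<in> K" "\<omega> \<notin> Fq" "z \<in> K"
  shows "\<exists>r\<in>Fq. \<exists>s\<in>Fq. z = r + s * \<omega>"
proof -
  have d: "\<sigma> \<omega> - \<omega> \<noteq> 0" using assms by (simp add: Fq_def)
  define s where "s = (\<sigma> z - z) / (\<sigma> \<omega> - \<omega>)"
  define r where "r = z - s * \<omega>"
  have s: "s \<in> Fq" using assms d unfolding Fq_def s_def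
    by (simp add: sig_K) (metis minus_diff_eq minus_divide_divide)
  have "s * (\<sigma> \<omega> - \<omega>) = \<sigma> z - z" using d by (simp add: s_def)
  then have r: "r \<in> Fq" using s by (simp add: r_def Fq_def algebra_simps)
  have "z = r + s * \<omega>" by (simp add: r_def)
  with r s show ?thesis by blast
qed

text \<open>
  Both sides are \<open>Fq\<close>-linear in \<open>z\<close>, so \<open>u\<close> and \<open>v\<close> only have to fit the values at the basis \<open>1, \<omega>\<close>, and
  that linear system has determinant \<open>\<sigma> \<omega> - \<omega> \<noteq> 0\<close>.
\<close>
lemma linear_form:
  assumes add: "\<And>x y. x \<in> K \<Longrightarrow> y \<in> K \<Longrightarrow> g (x + y) = g x + g y"
    and hom: "\<And>r x. r \<in> Fq \<Longrightarrow> x \<in> K \<Longrightarrow> g (r * x) = r * g x"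
    and gK: "\<And>x. x \<in> K \<Longrightarrow> g x \<in> K"
  obtains u v where "u \<in> K" "v \<in> K" "\<And>z. z \<in> K \<Longrightarrow> g z = u * z + v * \<sigma> z"
proof -
  obtain \<omega> where w: "\<omega> \<in> K" "\<omega> \<notin> Fq" by (rule obtain_\<omega>)
  then have d: "\<sigma> \<omega> - \<omega> \<noteq> 0" by (simp add: Fq_def)
  define v where "v = (g \<omega> - \<omega> * g 1) / (\<sigma> \<omega> - \<omega>)"
  define u where "u = g 1 - v"
  have uv: "u \<in> K" "v \<in> K" using w gK by (auto simp: u_def v_def)
  have "v * (\<sigma> \<omega> - \<omega>) = g \<omega> - \<omega> * g 1" using d by (simp add: v_def)
  then have gw: "g \<omega> = u * \<omega> + v * \<sigma> \<omega>" by (simp add: u_def algebra_simps)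
  have "g z = u * z + v * \<sigma> z" if z: "z \<in> K" for z
  proof -
    obtain r s where r: "r \<in> Fq" and s: "s \<in> Fq" and zz: "z = r * 1 + s * \<omega>"
      using K_basis[OF w z] by auto
    have "g z = r * g 1 + s * g \<omega>" using r s w hom[OF r, of 1] by (simp add: zz add hom)
    then show ?thesis using r s unfolding gw
      by (simp add: zz sig_Fq u_def algebra_simps)
  qed
  with uv that show thesis by blast
qed

end

section \<open>Lines of a vector space over the quadratic extension\<close>
text \<open>
  A vector space over the field \<open>K\<close>, which is a subset of a type. Its lines over \<open>Fq\<close> are
  parametrized as images of the two-dimensional space \<open>K\<close> under injective \<open>Fq\<close>-linear maps.
\<close>
locale kmodule = frobenius_field q ty for q :: nat and ty :: "'b::alg_closed_field itself" +
  fixes sc :: "'b \<Rightarrow> 'v::ab_group_add \<Rightarrow> 'v" (infixr "\<star>" 75)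
  assumes sc_add_right: "a \<in> K \<Longrightarrow> a \<star> (x + y) = a \<star> x + a \<star> y"
    and sc_add_left: "a \<in> K \<Longrightarrow> b \<in> K \<Longrightarrow> (a + b) \<star> x = a \<star> x + b \<star> x"
    and sc_mult: "a \<in> K \<Longrightarrow> b \<in> K \<Longrightarrow> a \<star> b \<star> x = (a * b) \<star> x"
    and sc_one [simp]: "1 \<star> x = x"
begin

lemma sc_zero_right [simp]: "a \<in> K \<Longrightarrow> a \<star> 0 = 0"
  using sc_add_right[of a 0 0] by simp
lemma sc_zero_left [simp]: "0 \<star> x = 0"
  using sc_add_left[of 0 0 x] by simp
lemma sc_minus_left: "a \<in> K \<Longrightarrow> (- a) \<star> x = - (a \<star> x)"
  using sc_add_left[of a "- a" x] by (simp add: eq_neg_iff_add_eq_0 add.commute)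
lemma sc_diff_left: "a \<in> K \<Longrightarrow> b \<in> K \<Longrightarrow> (a - b) \<star> x = a \<star> x - b \<star> x"
  using sc_add_left[of a "- b" x] by (simp add: sc_minus_left)
lemma sc_eq_0: assumes "a \<in> K" shows "a \<star> x = 0 \<longleftrightarrow> a = 0 \<or> x = 0"
proof
  assume *: "a \<star> x = 0"
  show "a = 0 \<or> x = 0"
  proof (cases "a = 0")
    case False
    then have "x = inverse a \<star> a \<star> x" using assms by (simp add: sc_mult)
    with * assms show ?thesis by simp
  qed simp
qed (use assms in auto)
lemma sc_cancel: assumes "a \<in> K" "b \<in> K" "x \<noteq> 0" shows "a \<star> x = b \<star> x \<longleftrightarrow> a = b"
  using sc_eq_0[of "a - b" x] assms by (simp add: sc_diff_left)

definition embedding :: "('b \<Rightarrow> 'v) \<Rightarrow> bool" where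
  "embedding \<psi> \<longleftrightarrow> (\<forall>x\<in>K. \<forall>y\<in>K. \<psi> (x + y) = \<psi> x + \<psi> y) \<and> (\<forall>r\<in>Fq. \<forall>x\<in>K. \<psi> (r * x) = r \<star> \<psi> x)
     \<and> (\<forall>x\<in>K. \<psi> x = 0 \<longrightarrow> x = 0)"

definition line :: "'v set \<Rightarrow> bool" where "line L \<longleftrightarrow> (\<exists>\<psi>. embedding \<psi> \<and> L = \<psi> ` K)"

definition meets :: "'v set \<Rightarrow> 'v set \<Rightarrow> bool" where "meets L M \<longleftrightarrow> (\<exists>x\<in>L \<inter> M. x \<noteq> 0)"

definition Kline :: "'v \<Rightarrow> 'v set" where "Kline x = (\<lambda>z. z \<star> x) ` K"

definition Ksubspace :: "'v set \<Rightarrow> bool" where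
  "Ksubspace Q \<longleftrightarrow> 0 \<in> Q \<and> (\<forall>x\<in>Q. \<forall>y\<in>Q. x + y \<in> Q) \<and> (\<forall>a\<in>K. \<forall>x\<in>Q. a \<star> x \<in> Q)"

definition Klines :: "'v set \<Rightarrow> 'v set set" where "Klines Q = Kline ` (Q - {0})"

definition oblique :: "'v set \<Rightarrow> 'v set set" where "oblique Q = {l. line l \<and> l \<subseteq> Q \<and> l \<notin> Klines Q}"

text \<open>
  \<open>\<kappa> l v\<close> is the colour of the lines over the oblique line \<open>l\<close> that are graphs of maps
  \<open>z \<mapsto> u z + v z\<^sup>q\<close>. Injectivity in \<open>v\<close> separates graphs over the same line, the second condition
  separates them from the lines in the subspace over the \<open>K\<close>-line of the colour, and the third
  one separates graphs over different oblique lines.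
\<close>
definition scheme :: "'v set \<Rightarrow> ('v set \<Rightarrow> 'b \<Rightarrow> 'v set \<times> 'b \<times> 'b) \<Rightarrow> bool" where
  "scheme Q \<kappa> \<longleftrightarrow>
     (\<forall>l\<in>oblique Q. inj_on (\<kappa> l) K \<and> \<kappa> l ` K \<subseteq> Klines Q \<times> I) \<and>
     (\<forall>l\<in>oblique Q. \<forall>v\<in>K. \<not> meets l (fst (\<kappa> l v))) \<and>
     (\<forall>l\<in>oblique Q. \<forall>m\<in>oblique Q. \<forall>v\<in>K. \<forall>v'\<in>K. \<kappa> l v = \<kappa> m v' \<and> meets l m \<longrightarrow> l = m)"

lemma embedding_add: "embedding \<psi> \<Longrightarrow> x \<in> K \<Longrightarrow> y \<in> K \<Longrightarrow> \<psi> (x + y) = \<psi> x + \<psi> y"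
  by (auto simp: embedding_def)
lemma embedding_scale: "embedding \<psi> \<Longrightarrow> r \<in> Fq \<Longrightarrow> y \<in> K \<Longrightarrow> \<psi> (r * y) = r \<star> \<psi> y"
  by (auto simp: embedding_def)
lemma embedding_0_iff: "embedding \<psi> \<Longrightarrow> x \<in> K \<Longrightarrow> \<psi> x = 0 \<longleftrightarrow> x = 0"
  using embedding_scale[of \<psi> 0 0] by (auto simp: embedding_def)
lemma embedding_diff: "embedding \<psi> \<Longrightarrow> x \<in> K \<Longrightarrow> y \<in> K \<Longrightarrow> \<psi> (x - y) = \<psi> x - \<psi> y"
  using embedding_add[of \<psi> "x - y" y] by (simp add: eq_diff_eq)
lemma embedding_inj: "embedding \<psi> \<Longrightarrow> inj_on \<psi> K"
  by (rule inj_onI) (metis K_closed(5) embedding_0_iff embedding_diff right_minus_eq)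

lemma embedding_Kline: "x \<noteq> 0 \<Longrightarrow> embedding (\<lambda>z. z \<star> x)"
  by (auto simp: embedding_def sc_add_left sc_mult sc_eq_0)

lemma line_Kline: "x \<noteq> 0 \<Longrightarrow> line (Kline x)"
  unfolding line_def Kline_def using embedding_Kline by blast

lemma line_card: "line L \<Longrightarrow> card L = q\<^sup>2"
  unfolding line_def using card_image[OF embedding_inj] card_K by metis

lemma Ksubspace_closed:
  assumes "Ksubspace Q" shows "0 \<in> Q" "x \<in> Q \<Longrightarrow> y \<in> Q \<Longrightarrow> x + y \<in> Q"
    "a \<in> K \<Longrightarrow> x \<in> Q \<Longrightarrow> a \<star> x \<in> Q" "x \<in> Q \<Longrightarrow> y \<in> Q \<Longrightarrow> x - y \<in> Q"
proof -
  show *: "0 \<in> Q" "x \<in> Q \<Longrightarrow> y \<in> Q \<Longrightarrow> x + y \<in> Q" "a \<in> K \<Longrightarrow> x \<in> Q \<Longrightarrow> a \<star> x \<in> Q" for x y a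
    using assms by (auto simp: Ksubspace_def)
  show "x \<in> Q \<Longrightarrow> y \<in> Q \<Longrightarrow> x - y \<in> Q"
    using *(2)[of x "(-1) \<star> y"] *(3)[of "-1" y] by (simp add: sc_minus_left)
qed

lemma Kline_eq: assumes "y \<in> Kline x" "y \<noteq> 0" shows "Kline y = Kline x"
proof -
  obtain a where a: "a \<in> K" "y = a \<star> x" using assms by (auto simp: Kline_def)
  have a0: "a \<noteq> 0" using assms a by auto
  have "z \<star> y \<in> Kline x" if "z \<in> K" for z using that a by (auto simp: Kline_def sc_mult)
  moreover have "z \<star> x \<in> Kline y" if "z \<in> K" for z
  proof -
    have "z \<star> x = (z / a) \<star> y" using that a a0 by (simp add: sc_mult)
    then show ?thesis using that a by (auto simp: Kline_def)
  qed
  ultimately show ?thesis unfolding Kline_def[of y] Kline_def[of x] by (metis Kline_def image_subsetI subset_antisym)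
qed

lemma Kline_self: "x \<in> Kline x" unfolding Kline_def by (rule image_eqI[of _ _ 1]) auto

lemma Klines_eq: "t \<in> Klines Q \<Longrightarrow> x \<in> t \<Longrightarrow> x \<noteq> 0 \<Longrightarrow> t = Kline x"
  using Kline_eq by (auto simp: Klines_def)

text \<open>
  If the images of the basis \<open>1, \<omega>\<close> were dependent over \<open>K\<close>, the line would be contained in a \<open>K\<close>-line,
  and both have \<open>q\<^sup>2\<close> elements.
\<close>
lemma oblique_indep:
  assumes "embedding \<psi>" "\<psi> ` K \<in> oblique Q" "\<omega> \<in> K" "\<omega> \<notin> Fq"
  shows "\<psi> \<omega> \<notin> Kline (\<psi> 1)"
proof
  assume "\<psi> \<omega> \<in> Kline (\<psi> 1)"
  then obtain a where a: "a \<in> K" "\<psi> \<omega> = a \<star> \<psi> 1" by (auto simp: Kline_def)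
  have e0: "\<psi> 1 \<noteq> 0" using embedding_0_iff[OF assms(1), of 1] by simp
  have "\<psi> ` K \<subseteq> Kline (\<psi> 1)"
  proof
    fix x assume "x \<in> \<psi> ` K"
    then obtain z where z: "z \<in> K" "x = \<psi> z" by auto
    obtain r s where rs: "r \<in> Fq" "s \<in> Fq" "z = r + s * \<omega>" using K_basis[OF assms(3,4) z(1)] by auto
    have "x = r \<star> \<psi> 1 + s \<star> \<psi> \<omega>"
      using rs z assms embedding_add[OF assms(1), of r "s * \<omega>"] embedding_scale[OF assms(1), of r 1]
        embedding_scale[OF assms(1), of s \<omega>] by simp
    then have "x = (r + s * a) \<star> \<psi> 1" using rs a by (simp add: sc_add_left sc_mult)
    then show "x \<in> Kline (\<psi> 1)" using rs a unfolding Kline_def by auto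
  qed
  moreover have "card (\<psi> ` K) = card (Kline (\<psi> 1))"
    using line_card line_Kline[OF e0] assms(2) by (simp add: oblique_def)
  ultimately have "\<psi> ` K = Kline (\<psi> 1)" by (intro card_subset_eq) (auto simp: Kline_def)
  moreover have "\<psi> 1 \<in> Q" using assms(2) by (auto simp: oblique_def)
  ultimately show False using assms(2) e0 by (auto simp: oblique_def Klines_def)
qed

end

section \<open>The colour classes\<close>
locale split_kmodule = kmodule q ty sc for q ty and sc :: "'b::alg_closed_field \<Rightarrow> 'v::ab_group_add \<Rightarrow> 'v" (infixr "\<star>" 75) +
  fixes Q :: "'v set" and w :: 'v and \<kappa> :: "'v set \<Rightarrow> 'b \<Rightarrow> 'v set \<times> 'b \<times> 'b"
  assumes Q: "Ksubspace Q" and w0: "w \<noteq> 0"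
    and split_ex: "\<And>v. \<exists>x\<in>Q. \<exists>y\<in>K. v = x + y \<star> w"
    and split_un: "\<And>y. y \<in> K \<Longrightarrow> y \<star> w \<in> Q \<Longrightarrow> y = 0"
    and scheme: "scheme Q \<kappa>"
begin

lemma split_eq: 
  assumes "x \<in> Q" "x' \<in> Q" "y \<in> K" "y' \<in> K" "x + y \<star> w = x' + y' \<star> w"
  shows "x = x' \<and> y = y'"
proof -
  have "(y - y') \<star> w = x' - x" using assms by (simp add: sc_diff_left algebra_simps)
  then have "y - y' = 0" using split_un[of "y - y'"] Ksubspace_closed(4)[OF Q] assms by simp
  with assms show ?thesis by simp
qed

text \<open>
  The colour of a line skew to \<open>K w\<close> is made from one fixed affine line missing \<open>\<mu>\<close>.
\<close>
definition ex_line :: "'b \<times> 'b" where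
  "ex_line = (SOME (\<eta>, c). \<eta> \<in> \<mu> \<and> c \<in> K \<and> \<eta> * \<sigma> c + c = 0 \<and> (\<forall>\<xi>\<in>\<mu>. \<sigma> \<xi> - \<eta> * \<xi> \<noteq> c))"
abbreviation "\<eta>\<^sub>0 \<equiv> fst ex_line"
abbreviation "c\<^sub>0 \<equiv> snd ex_line"

lemma ex_line: "\<eta>\<^sub>0 \<in> \<mu>" "c\<^sub>0 \<in> K" "\<eta>\<^sub>0 * \<sigma> c\<^sub>0 + c\<^sub>0 = 0" "\<xi> \<in> \<mu> \<Longrightarrow> \<sigma> \<xi> - \<eta>\<^sub>0 * \<xi> \<noteq> c\<^sub>0"
proof -
  have "\<exists>p. case p of (\<eta>, c) \<Rightarrow> \<eta> \<in> \<mu> \<and> c \<in> K \<and> \<eta> * \<sigma> c + c = 0 \<and> (\<forall>\<xi>\<in>\<mu>. \<sigma> \<xi> - \<eta> * \<xi> \<noteq> c)"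
    using ex_external_line by auto
  from someI_ex[OF this]
  have "case ex_line of (\<eta>, c) \<Rightarrow> \<eta> \<in> \<mu> \<and> c \<in> K \<and> \<eta> * \<sigma> c + c = 0 \<and> (\<forall>\<xi>\<in>\<mu>. \<sigma> \<xi> - \<eta> * \<xi> \<noteq> c)"
    unfolding ex_line_def .
  then show "\<eta>\<^sub>0 \<in> \<mu>" "c\<^sub>0 \<in> K" "\<eta>\<^sub>0 * \<sigma> c\<^sub>0 + c\<^sub>0 = 0" "\<xi> \<in> \<mu> \<Longrightarrow> \<sigma> \<xi> - \<eta>\<^sub>0 * \<xi> \<noteq> c\<^sub>0"
    by (auto simp: case_prod_beta)
qed

text \<open>
  In \<open>K e \<oplus> K w\<close>, with slope \<open>y / x\<close> for \<open>x e + y w\<close>: \<open>graph (\<lambda>z. z \<star> e) u v\<close> has the slopes \<open>u + v \<rho>\<close> for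
  \<open>\<rho> \<in> \<mu>\<close>, and \<open>tangent e \<xi> \<gamma> \<delta>\<close> contains the vector \<open>(\<xi> \<delta>) \<star> w\<close> and has the slopes \<open>\<gamma> + t \<delta>\<close> for \<open>t \<in> Fq\<close>.
  Over an oblique line \<open>l\<close> the graphs are taken with respect to a fixed parametrization \<open>par l\<close>.
\<close>
definition graph :: "('b \<Rightarrow> 'v) \<Rightarrow> 'b \<Rightarrow> 'b \<Rightarrow> 'v set" where
  "graph \<psi> u v = (\<lambda>z. \<psi> z + (u * z + v * \<sigma> z) \<star> w) ` K"

definition tangent :: "'v \<Rightarrow> 'b \<Rightarrow> 'b \<Rightarrow> 'b \<Rightarrow> 'v set" where
  "tangent e \<xi> \<gamma> \<delta> = (\<lambda>(r, s). (r * \<xi>) \<star> e + (\<xi> * (r * \<gamma> + s * \<delta>)) \<star> w) ` (Fq \<times> Fq)"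

definition gen :: "'v set \<Rightarrow> 'v" where "gen t = (SOME x. x \<in> Q \<and> x \<noteq> 0 \<and> t = Kline x)"
definition par :: "'v set \<Rightarrow> 'b \<Rightarrow> 'v" where "par l = (SOME \<psi>. embedding \<psi> \<and> l = \<psi> ` K)"

abbreviation kmap :: "'v set \<Rightarrow> 'b \<Rightarrow> 'v" where "kmap t \<equiv> \<lambda>z. z \<star> gen t"

lemma gen: "t \<in> Klines Q \<Longrightarrow> gen t \<in> Q \<and> gen t \<noteq> 0 \<and> t = Kline (gen t)"
  unfolding gen_def by (rule someI_ex) (auto simp: Klines_def)
lemma par: "line l \<Longrightarrow> embedding (par l) \<and> l = par l ` K"
  unfolding par_def line_def by (rule someI_ex[where P = "\<lambda>\<psi>. embedding \<psi> \<and> l = \<psi> ` K"])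

text \<open>
  The code in \<open>I\<close> of the affine line \<open>\<gamma> + Fq \<delta>\<close>, and the code of the image of the external line
  under \<open>x \<mapsto> u + v x\<close>.
\<close>
definition aff_col :: "'b \<Rightarrow> 'b \<Rightarrow> 'b \<times> 'b" where "aff_col \<gamma> \<delta> = (\<sigma> \<delta> / \<delta>, \<sigma> \<gamma> - \<sigma> \<delta> / \<delta> * \<gamma>)"
definition skew_col :: "'b \<Rightarrow> 'b \<Rightarrow> 'b \<times> 'b" where
  "skew_col u v = (\<eta>\<^sub>0 * (\<sigma> v / v), c\<^sub>0 * \<sigma> v + \<sigma> u - \<eta>\<^sub>0 * (\<sigma> v / v) * u)"

definition tangents where
  "tangents t i = {tangent (gen t) \<xi> \<gamma> \<delta> | \<xi> \<gamma> \<delta>. \<xi> \<in> K - {0} \<and> \<gamma> \<in> K \<and> \<delta> \<in> K - {0} \<and> aff_col \<gamma> \<delta> = i}"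
definition skews where
  "skews t i = {graph (kmap t) u v | u v. u \<in> K \<and> v \<in> K - {0} \<and> skew_col u v = i}"
definition lifts where
  "lifts t i = {graph (par l) u v | l u v. l \<in> oblique Q \<and> u \<in> K \<and> v \<in> K \<and> \<kappa> l v = (t, i)}"

definition line_class :: "('v set \<times> 'b \<times> 'b) option \<Rightarrow> 'v set set" where
  "line_class c = (case c of None \<Rightarrow> insert (Kline w) {graph (kmap t) u 0 | t u. t \<in> Klines Q \<and> u \<in> K}
     | Some (t, i) \<Rightarrow> tangents t i \<union> skews t i \<union> lifts t i)"

definition colours :: "('v set \<times> 'b \<times> 'b) option set" where
  "colours = insert None (Some ` (Klines Q \<times> I))"

lemma plane_coord:
  assumes "e \<in> Q" "e \<noteq> 0" "a \<in> K" "b \<in> K" "a' \<in> K" "b' \<in> K" "a \<star> e + b \<star> w = a' \<star> e + b' \<star> w"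
  shows "a = a' \<and> b = b'"
  using split_eq[of "a \<star> e" "a' \<star> e" b b'] assms Ksubspace_closed(3)[OF Q] by (simp add: sc_cancel)

lemma graph_disjoint:
  assumes "embedding \<psi>" "\<psi> ` K \<subseteq> Q" "u \<in> K" "v \<in> K" "u' \<in> K" "meets (graph \<psi> u v) (graph \<psi> u' v)"
  shows "u = u'"
proof -
  obtain x where x: "x \<in> graph \<psi> u v" "x \<in> graph \<psi> u' v" "x \<noteq> 0" using assms(6) by (auto simp: meets_def)
  obtain z where z: "z \<in> K" "x = \<psi> z + (u * z + v * \<sigma> z) \<star> w" using x by (auto simp: graph_def)
  obtain z' where z': "z' \<in> K" "x = \<psi> z' + (u' * z' + v * \<sigma> z') \<star> w" using x by (auto simp: graph_def)
  have *: "\<psi> z = \<psi> z' \<and> u * z + v * \<sigma> z = u' * z' + v * \<sigma> z'"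
    by (rule split_eq) (use assms z z' in auto)
  then have zz: "z = z'" using embedding_inj[OF assms(1)] z z' by (auto dest: inj_onD)
  have "z \<noteq> 0" using x z assms by (auto simp: embedding_0_iff)
  with * zz show ?thesis by simp
qed

lemma graph_proj:
  assumes "x \<in> graph \<psi> u v" "x \<noteq> 0" "embedding \<psi>" "u \<in> K" "v \<in> K"
  obtains z y where "z \<in> K" "z \<noteq> 0" "y \<in> K" "x = \<psi> z + y \<star> w" "\<psi> z \<noteq> 0" "y = u * z + v * \<sigma> z"
proof -
  obtain z where z: "z \<in> K" "x = \<psi> z + (u * z + v * \<sigma> z) \<star> w" using assms by (auto simp: graph_def)
  have "z \<noteq> 0" using assms z by (auto simp: embedding_0_iff)
  with z assms show ?thesis by (intro that[of z "u * z + v * \<sigma> z"]) (auto simp: embedding_0_iff)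
qed

lemma tangent_subset:
  assumes "l \<in> Fq" "m \<in> Fq" "k \<in> Fq"
  shows "tangent e (l * \<xi>) (\<gamma> + m * \<delta>) (k * \<delta>) \<subseteq> tangent e \<xi> \<gamma> \<delta>"
proof
  fix x assume "x \<in> tangent e (l * \<xi>) (\<gamma> + m * \<delta>) (k * \<delta>)"
  then obtain r s where rs: "r \<in> Fq" "s \<in> Fq"
    "x = (r * (l * \<xi>)) \<star> e + ((l * \<xi>) * (r * (\<gamma> + m * \<delta>) + s * (k * \<delta>))) \<star> w" by (auto simp: tangent_def)
  then have "x = ((r * l) * \<xi>) \<star> e + (\<xi> * ((r * l) * \<gamma> + (l * (r * m + s * k)) * \<delta>)) \<star> w"
    by (simp add: algebra_simps)
  then show "x \<in> tangent e \<xi> \<gamma> \<delta>" unfolding tangent_def using rs assms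
    by (intro image_eqI[of _ _ "(r * l, l * (r * m + s * k))"]) auto
qed

lemma tangent_eq:
  assumes "l \<in> Fq" "m \<in> Fq" "k \<in> Fq" "l \<noteq> 0" "k \<noteq> 0"
  shows "tangent e (l * \<xi>) (\<gamma> + m * \<delta>) (k * \<delta>) = tangent e \<xi> \<gamma> \<delta>"
proof (rule subset_antisym[OF tangent_subset])
  have "tangent e \<xi> \<gamma> \<delta> =
      tangent e (inverse l * (l * \<xi>)) ((\<gamma> + m * \<delta>) + (- m / k) * (k * \<delta>)) (inverse k * (k * \<delta>))"
  proof -
    have "inverse l * (l * \<xi>) = \<xi>" "(\<gamma> + m * \<delta>) + (- m / k) * (k * \<delta>) = \<gamma>" "inverse k * (k * \<delta>) = \<delta>"
      using assms by auto
    then show ?thesis by (simp only:)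
  qed
  also have "\<dots> \<subseteq> tangent e (l * \<xi>) (\<gamma> + m * \<delta>) (k * \<delta>)"
    by (rule tangent_subset) (use assms in auto)
  finally show "tangent e \<xi> \<gamma> \<delta> \<subseteq> tangent e (l * \<xi>) (\<gamma> + m * \<delta>) (k * \<delta>)" .
qed (use assms in auto)

text \<open>
  Lines of the same colour have the same affine line of slopes. A common point fixes \<open>\<xi>\<close> up to a
  factor in \<open>Fq\<close>, and then the lines coincide.
\<close>
lemma tangents_disjoint:
  assumes e: "e \<in> Q" "e \<noteq> 0"
    and K: "\<xi> \<in> K" "\<xi> \<noteq> 0" "\<gamma> \<in> K" "\<delta> \<in> K" "\<delta> \<noteq> 0" "\<xi>' \<in> K" "\<xi>' \<noteq> 0" "\<gamma>' \<in> K" "\<delta>' \<in> K" "\<delta>' \<noteq> 0"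
    and col: "aff_col \<gamma> \<delta> = aff_col \<gamma>' \<delta>'" and meet: "meets (tangent e \<xi> \<gamma> \<delta>) (tangent e \<xi>' \<gamma>' \<delta>')"
  shows "tangent e \<xi> \<gamma> \<delta> = tangent e \<xi>' \<gamma>' \<delta>'"
proof -
  define k where "k = \<delta>' / \<delta>"
  have dd: "\<sigma> \<delta>' / \<delta>' = \<sigma> \<delta> / \<delta>" using col by (simp add: aff_col_def)
  then have k: "k \<in> Fq" unfolding k_def by (intro quotient_eq_Fq) (use K in auto)
  have k0: "k \<noteq> 0" and kd: "\<delta>' = k * \<delta>" using K by (auto simp: k_def)
  define m where "m = (\<gamma>' - \<gamma>) / \<delta>"
  have gm: "\<gamma>' = \<gamma> + m * \<delta>" using K by (simp add: m_def)
  have "\<sigma> \<gamma> - \<sigma> \<delta> / \<delta> * \<gamma> = \<sigma> \<gamma>' - \<sigma> \<delta> / \<delta> * \<gamma>'" using col dd by (simp add: aff_col_def)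
  moreover have "\<sigma> \<gamma> - h * \<gamma> = \<sigma> \<gamma>' - h * \<gamma>' \<Longrightarrow> \<sigma> (\<gamma>' - \<gamma>) = h * (\<gamma>' - \<gamma>)" for h
    by (simp add: algebra_simps)
  ultimately have "\<sigma> (\<gamma>' - \<gamma>) = \<sigma> \<delta> / \<delta> * (\<gamma>' - \<gamma>)" by blast
  moreover have "\<sigma> m = \<sigma> (\<gamma>' - \<gamma>) / \<sigma> \<delta>" by (simp add: m_def)
  ultimately have "\<sigma> m = (\<sigma> \<delta> / \<delta> * (\<gamma>' - \<gamma>)) / \<sigma> \<delta>" by (simp only:)
  then have m: "m \<in> Fq" using K by (simp add: Fq_def m_def)
  obtain x where x: "x \<in> tangent e \<xi> \<gamma> \<delta>" "x \<in> tangent e \<xi>' \<gamma>' \<delta>'" "x \<noteq> 0" using meet by (auto simp: meets_def)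
  obtain r s where rs: "r \<in> Fq" "s \<in> Fq" "x = (r * \<xi>) \<star> e + (\<xi> * (r * \<gamma> + s * \<delta>)) \<star> w"
    using x by (auto simp: tangent_def)
  obtain r' s' where rs': "r' \<in> Fq" "s' \<in> Fq" "x = (r' * \<xi>') \<star> e + (\<xi>' * (r' * \<gamma>' + s' * \<delta>')) \<star> w"
    using x by (auto simp: tangent_def)
  have eqs: "r * \<xi> = r' * \<xi>' \<and> \<xi> * (r * \<gamma> + s * \<delta>) = \<xi>' * (r' * \<gamma>' + s' * \<delta>')"
    by (rule plane_coord[OF e]) (use rs rs' K in auto)
  have "\<exists>l\<in>Fq. l \<noteq> 0 \<and> \<xi>' = l * \<xi>"
  proof (cases "r = 0")
    case True
    then have r': "r' = 0" using eqs K by simp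
    have s: "s \<noteq> 0" using x rs True by auto
    have "\<xi> * (s * \<delta>) = \<xi>' * (s' * (k * \<delta>))" using eqs True r' kd by simp
    then have ss: "\<xi> * s = \<xi>' * (s' * k)" using K by (simp add: mult.assoc[symmetric])
    then have "s' \<noteq> 0" using s K by auto
    then have "\<xi>' = (s / (s' * k)) * \<xi>" using ss k0 by (simp add: field_simps)
    then show ?thesis using s k0 \<open>s' \<noteq> 0\<close> rs rs' k by (intro bexI[of _ "s / (s' * k)"]) auto
  next
    case False
    then have "r' \<noteq> 0" using eqs K by auto
    then have "\<xi>' = (r / r') * \<xi>" using eqs by (simp add: field_simps)
    then show ?thesis using False \<open>r' \<noteq> 0\<close> rs rs' by (intro bexI[of _ "r / r'"]) auto
  qed
  then obtain l where "l \<in> Fq" "l \<noteq> 0" "\<xi>' = l * \<xi>" by auto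
  then show ?thesis using tangent_eq[of l m k] m k k0 gm kd by simp
qed

text \<open>
  A common point has a slope \<open>u + v \<rho>\<close> with \<open>\<rho> \<in> \<mu>\<close> on the affine line of the colour. Undoing
  \<open>x \<mapsto> u + v x\<close> puts \<open>\<rho>\<close> on the external line.
\<close>
lemma tangent_skew_disjoint:
  assumes e: "e \<in> Q" "e \<noteq> 0"
    and K: "\<xi> \<in> K" "\<xi> \<noteq> 0" "\<gamma> \<in> K" "\<delta> \<in> K" "\<delta> \<noteq> 0" "u \<in> K" "v \<in> K" "v \<noteq> 0"
    and col: "aff_col \<gamma> \<delta> = skew_col u v"
  shows "\<not> meets (tangent e \<xi> \<gamma> \<delta>) (graph (\<lambda>z. z \<star> e) u v)"
proof
  assume "meets (tangent e \<xi> \<gamma> \<delta>) (graph (\<lambda>z. z \<star> e) u v)"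
  then obtain x where x: "x \<in> tangent e \<xi> \<gamma> \<delta>" "x \<in> graph (\<lambda>z. z \<star> e) u v" "x \<noteq> 0" by (auto simp: meets_def)
  obtain r s where rs: "r \<in> Fq" "s \<in> Fq" "x = (r * \<xi>) \<star> e + (\<xi> * (r * \<gamma> + s * \<delta>)) \<star> w"
    using x by (auto simp: tangent_def)
  obtain z y where z: "z \<in> K" "z \<noteq> 0" "y \<in> K" "x = z \<star> e + y \<star> w" "y = u * z + v * \<sigma> z"
    using graph_proj[OF x(2,3) embedding_Kline[OF e(2)]] K by metis
  have eqs: "r * \<xi> = z \<and> \<xi> * (r * \<gamma> + s * \<delta>) = u * z + v * \<sigma> z"
    by (rule plane_coord[OF e]) (use rs z K in auto)
  then have r0: "r \<noteq> 0" using z by auto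
  define \<rho> where "\<rho> = \<sigma> \<xi> / \<xi>"
  have \<rho>: "\<rho> \<in> \<mu>" using K by (simp add: \<rho>_def \<mu>_quotient)
  define t where "t = s / r"
  have t: "t \<in> Fq" using rs by (simp add: t_def)
  have "r * \<gamma> + s * \<delta> = r * (\<gamma> + t * \<delta>)" using r0 by (simp add: t_def algebra_simps)
  moreover have "\<sigma> z = r * (\<rho> * \<xi>)" using eqs rs K by (auto simp: \<rho>_def sig_Fq)
  ultimately have "\<xi> * r * (\<gamma> + t * \<delta>) = \<xi> * r * (u + v * \<rho>)"
    using eqs by (auto simp: algebra_simps)
  then have 1: "\<gamma> + t * \<delta> = u + v * \<rho>" using r0 K by simp
  define \<eta> where "\<eta> = \<sigma> \<delta> / \<delta>"
  have \<eta>: "\<eta> = \<eta>\<^sub>0 * (\<sigma> v / v)" "\<sigma> \<gamma> - \<eta> * \<gamma> = c\<^sub>0 * \<sigma> v + \<sigma> u - \<eta> * u"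
    using col unfolding aff_col_def skew_col_def \<eta>_def prod.inject by metis+
  have "\<sigma> (\<gamma> + t * \<delta>) - \<eta> * (\<gamma> + t * \<delta>) = \<sigma> \<gamma> - \<eta> * \<gamma> + t * (\<sigma> \<delta> - \<eta> * \<delta>)"
    using t by (simp add: sig_Fq algebra_simps)
  also have "\<dots> = c\<^sub>0 * \<sigma> v + \<sigma> u - \<eta> * u" using K by (simp add: \<eta>(2)) (simp add: \<eta>_def)
  finally have "\<sigma> v * \<sigma> \<rho> - \<eta> * (v * \<rho>) = c\<^sub>0 * \<sigma> v" unfolding 1 by (simp add: algebra_simps)
  then have "\<sigma> v * (\<sigma> \<rho> - \<eta>\<^sub>0 * \<rho>) = \<sigma> v * c\<^sub>0" using K by (simp add: \<eta>(1) algebra_simps)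
  then show False using ex_line(4)[OF \<rho>] K by simp
qed

text \<open>
  Equal colours make the external lines correspond, in particular \<open>v' / v \<in> Fq\<close>. A common point
  with parameter \<open>\<rho> \<in> \<mu>\<close> gives \<open>u - u' = (v' - v) \<rho>\<close>, and comparing the second components of the
  colours places \<open>\<rho>\<close> on the external line unless \<open>v' = v\<close>.
\<close>
lemma skews_disjoint:
  assumes e: "e \<in> Q" "e \<noteq> 0"
    and K: "u \<in> K" "v \<in> K" "v \<noteq> 0" "u' \<in> K" "v' \<in> K" "v' \<noteq> 0"
    and col: "skew_col u v = skew_col u' v'" and meet: "meets (graph (\<lambda>z. z \<star> e) u v) (graph (\<lambda>z. z \<star> e) u' v')"
  shows "u = u' \<and> v = v'"
proof -
  have emb: "embedding (\<lambda>z. z \<star> e)" using e by (rule_tac embedding_Kline)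
  obtain x where x: "x \<in> graph (\<lambda>z. z \<star> e) u v" "x \<in> graph (\<lambda>z. z \<star> e) u' v'" "x \<noteq> 0" using meet by (auto simp: meets_def)
  obtain z y where z: "z \<in> K" "z \<noteq> 0" "y \<in> K" "x = z \<star> e + y \<star> w" "y = u * z + v * \<sigma> z"
    using graph_proj[OF x(1,3) emb] K by metis
  obtain z' y' where z': "z' \<in> K" "z' \<noteq> 0" "y' \<in> K" "x = z' \<star> e + y' \<star> w" "y' = u' * z' + v' * \<sigma> z'"
    using graph_proj[OF x(2,3) emb] K by metis
  have "z = z' \<and> y = y'" by (rule plane_coord[OF e]) (use z z' in auto)
  then have eq: "u * z + v * \<sigma> z = u' * z + v' * \<sigma> z" using z(5) z'(5) by metis
  define \<rho> where "\<rho> = \<sigma> z / z"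
  have \<rho>: "\<rho> \<in> \<mu>" using z by (simp add: \<rho>_def \<mu>_quotient)
  have 1: "u - u' = (v' - v) * \<rho>" using eq z by (simp add: \<rho>_def field_simps)
  define \<eta> where "\<eta> = \<eta>\<^sub>0 * (\<sigma> v / v)"
  have "\<eta>\<^sub>0 * (\<sigma> v / v) = \<eta>\<^sub>0 * (\<sigma> v' / v')" using col unfolding skew_col_def prod.inject by metis
  then have \<eta>': "\<sigma> v' / v' = \<sigma> v / v" using \<mu>_nonzero[OF ex_line(1)] by (metis mult_left_cancel)
  define k where "k = v' / v"
  have k: "k \<in> Fq" unfolding k_def by (rule quotient_eq_Fq) (use K \<eta>' in auto)
  have kv: "v' = k * v" using K by (simp add: k_def)
  have "c\<^sub>0 * \<sigma> v + \<sigma> u - \<eta> * u = c\<^sub>0 * \<sigma> v' + \<sigma> u' - \<eta> * u'"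
    using col \<eta>' by (simp add: skew_col_def \<eta>_def)
  then have "\<sigma> (u - u') - \<eta> * (u - u') = c\<^sub>0 * (k - 1) * \<sigma> v" using k by (simp add: kv sig_Fq algebra_simps)
  moreover have d: "u - u' = (k - 1) * v * \<rho>" using 1 by (simp add: kv algebra_simps)
  moreover have "\<sigma> ((k - 1) * v * \<rho>) = (k - 1) * \<sigma> v * \<sigma> \<rho>" using k by (simp add: sig_Fq)
  moreover have "\<eta> * ((k - 1) * v * \<rho>) = \<eta>\<^sub>0 * \<sigma> v * (k - 1) * \<rho>" using K by (simp add: \<eta>_def)
  ultimately have "(k - 1) * \<sigma> v * \<sigma> \<rho> - \<eta>\<^sub>0 * \<sigma> v * (k - 1) * \<rho> = c\<^sub>0 * (k - 1) * \<sigma> v" by metis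
  then have "(k - 1) * \<sigma> v * (\<sigma> \<rho> - \<eta>\<^sub>0 * \<rho>) = (k - 1) * \<sigma> v * c\<^sub>0" by (simp add: algebra_simps)
  then have "k = 1" using ex_line(4)[OF \<rho>] K by auto
  with 1 kv show ?thesis by simp
qed

lemma scheme_eq:
  assumes "l \<in> oblique Q" "m \<in> oblique Q" "v \<in> K" "v' \<in> K" "\<kappa> l v = \<kappa> m v'" "meets l m" shows "l = m"
  using scheme assms unfolding scheme_def by blast

text \<open>
  The class of \<open>None\<close> consists of \<open>K\<close>-lines. In a class \<open>(t, i)\<close> the lines inside \<open>t \<oplus> K w\<close> are disjoint by their
  slopes. A common point of one of these and of a graph over an oblique line projects into
  \<open>t\<close> and into that oblique line, and a common point of two graphs projects to a common point of
  the oblique lines; the conditions on a scheme exclude both.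
\<close>
lemma class_disjoint:
  assumes c: "c \<in> colours" and L: "L \<in> line_class c" "M \<in> line_class c" and meet: "meets L M"
  shows "L = M"
proof (cases c)
  case None
  have W: "x = 0" if "x \<in> Kline w" "x \<in> graph (kmap t) u 0" "t \<in> Klines Q" "u \<in> K" for x t u
  proof (rule ccontr)
    note A = that
    assume "x \<noteq> 0"
    have e: "gen t \<in> Q" "gen t \<noteq> 0" using gen A by auto
    obtain z y where z: "z \<in> K" "z \<noteq> 0" "y \<in> K" "x = z \<star> gen t + y \<star> w"
      using graph_proj[OF A(2) \<open>x \<noteq> 0\<close> embedding_Kline[OF e(2)]] A by (metis K_closed(1))
    obtain b where "b \<in> K" "x = b \<star> w" using A by (auto simp: Kline_def)
    then have "z = 0 \<and> y = b" by (intro plane_coord[OF e]) (use z in auto)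
    with z show False by simp
  qed
  have G: "graph (kmap t) u 0 = graph (kmap t') u' 0"
    if "x \<in> graph (kmap t) u 0" "x \<in> graph (kmap t') u' 0" "x \<noteq> 0" "t \<in> Klines Q" "t' \<in> Klines Q" "u \<in> K" "u' \<in> K"
    for x t u t' u'
  proof -
    note A = that
    have e: "gen t \<in> Q" "gen t \<noteq> 0" "t = Kline (gen t)" "gen t' \<in> Q" "gen t' \<noteq> 0" "t' = Kline (gen t')"
      using gen A by auto
    obtain z y where z: "z \<in> K" "y \<in> K" "x = z \<star> gen t + y \<star> w" "z \<star> gen t \<noteq> 0"
      using graph_proj[OF A(1) \<open>x \<noteq> 0\<close> embedding_Kline[OF e(2)]] A by (metis K_closed(1))
    obtain z' y' where z': "z' \<in> K" "y' \<in> K" "x = z' \<star> gen t' + y' \<star> w"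
      using graph_proj[OF A(2) \<open>x \<noteq> 0\<close> embedding_Kline[OF e(5)]] A by (metis K_closed(1))
    have "z \<star> gen t = z' \<star> gen t' \<and> y = y'"
      by (rule split_eq) (use z z' e Ksubspace_closed(3)[OF Q] in auto)
    moreover have "z \<star> gen t \<in> Kline (gen t)" "z' \<star> gen t' \<in> Kline (gen t')" using z z' unfolding Kline_def by auto
    ultimately have "z \<star> gen t \<in> t" "z \<star> gen t \<in> t'" using e by metis+
    then have tt: "t = t'" using Klines_eq A z by metis
    have "meets (graph (kmap t) u 0) (graph (kmap t) u' 0)" using A tt by (auto simp: meets_def)
    then have "u = u'" by (intro graph_disjoint) (use e A tt embedding_Kline Ksubspace_closed(3)[OF Q] in auto)
    with tt show ?thesis by simp
  qed
  obtain x where x: "x \<in> L" "x \<in> M" "x \<noteq> 0" using meet by (auto simp: meets_def)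
  have cases: "A = Kline w \<or> (\<exists>t u. A = graph (kmap t) u 0 \<and> t \<in> Klines Q \<and> u \<in> K)" if "A \<in> line_class c" for A
    using that unfolding None line_class_def by auto
  from cases[OF L(1)] cases[OF L(2)] show ?thesis using x W G by metis
next
  case (Some p)
  obtain t i where p: "p = (t, i)" by (cases p)
  have t: "t \<in> Klines Q" using c Some p by (auto simp: colours_def)
  have e: "gen t \<in> Q" "gen t \<noteq> 0" "t = Kline (gen t)" using gen[OF t] by auto
  have emb: "embedding (kmap t)" using embedding_Kline[OF e(2)] .
  have lift: "\<exists>l u v. A = graph (par l) u v \<and> l \<in> oblique Q \<and> u \<in> K \<and> v \<in> K \<and> \<kappa> l v = (t, i) \<and> embedding (par l) \<and> l = par l ` K"
    if "A \<in> lifts t i" for A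
    using that par unfolding lifts_def oblique_def by blast
  have proj: "z \<star> gen t \<in> t" if "z \<in> K" for z using that e(3) by (auto simp: Kline_def)
  have mixed: False if A: "A \<in> tangents t i \<union> skews t i" and B: "B \<in> lifts t i" and "meets A B" for A B
  proof -
    obtain x where x: "x \<in> A" "x \<in> B" "x \<noteq> 0" using \<open>meets A B\<close> by (auto simp: meets_def)
    obtain l u v where l: "B = graph (par l) u v" "l \<in> oblique Q" "u \<in> K" "v \<in> K" "\<kappa> l v = (t, i)"
      "embedding (par l)" "l = par l ` K" using lift[OF B] by blast
    obtain z y where z: "z \<in> K" "y \<in> K" "x = par l z + y \<star> w" "par l z \<noteq> 0"
      using graph_proj[of x "par l" u v] x l by metis
    have "\<exists>a\<in>K. \<exists>b\<in>K. x = a \<star> gen t + b \<star> w"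
    proof (cases "A \<in> tangents t i")
      case True
      then obtain \<xi> \<gamma> \<delta> where K: "\<xi> \<in> K" "\<gamma> \<in> K" "\<delta> \<in> K" "A = tangent (gen t) \<xi> \<gamma> \<delta>" by (auto simp: tangents_def)
      then obtain r s where "r \<in> Fq" "s \<in> Fq" "x = (r * \<xi>) \<star> gen t + (\<xi> * (r * \<gamma> + s * \<delta>)) \<star> w"
        using x by (auto simp: tangent_def)
      with K show ?thesis by (intro bexI[of _ "r * \<xi>"] bexI[of _ "\<xi> * (r * \<gamma> + s * \<delta>)"]) auto
    next
      case False
      then obtain u v where K: "u \<in> K" "v \<in> K" "A = graph (kmap t) u v" using A by (auto simp: skews_def)
      then obtain z where "z \<in> K" "x = z \<star> gen t + (u * z + v * \<sigma> z) \<star> w"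
        using x by (auto simp: graph_def)
      with K show ?thesis by (intro bexI[of _ z] bexI[of _ "u * z + v * \<sigma> z"]) auto
    qed
    then obtain a b where ab: "a \<in> K" "b \<in> K" "x = a \<star> gen t + b \<star> w" by blast
    have pQ: "par l z \<in> Q" using l z unfolding oblique_def by blast
    have "par l z = a \<star> gen t \<and> y = b"
      by (rule split_eq) (use ab z pQ e Ksubspace_closed(3)[OF Q] in auto)
    moreover have "par l z \<in> l" using l(7) z(1) by (metis imageI)
    ultimately have "par l z \<in> t \<inter> l" using proj[OF ab(1)] by simp
    then have "meets l (fst (\<kappa> l v))" using l(5) z by (auto simp: meets_def)
    then show False using scheme l unfolding scheme_def by blast
  qed
  have TT: "A = B" if "A \<in> tangents t i" "B \<in> tangents t i" "meets A B" for A B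
  proof -
    obtain \<xi> \<gamma> \<delta> where "\<xi> \<in> K" "\<xi> \<noteq> 0" "\<gamma> \<in> K" "\<delta> \<in> K" "\<delta> \<noteq> 0" "aff_col \<gamma> \<delta> = i"
      "A = tangent (gen t) \<xi> \<gamma> \<delta>" using \<open>A \<in> tangents t i\<close> unfolding tangents_def by blast
    moreover obtain \<xi>' \<gamma>' \<delta>' where "\<xi>' \<in> K" "\<xi>' \<noteq> 0" "\<gamma>' \<in> K" "\<delta>' \<in> K" "\<delta>' \<noteq> 0" "aff_col \<gamma>' \<delta>' = i"
      "B = tangent (gen t) \<xi>' \<gamma>' \<delta>'" using \<open>B \<in> tangents t i\<close> unfolding tangents_def by blast
    ultimately show ?thesis using tangents_disjoint[OF e(1,2), of \<xi> \<gamma> \<delta> \<xi>' \<gamma>' \<delta>'] \<open>meets A B\<close> by simp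
  qed
  have TS: False if "A \<in> tangents t i" "B \<in> skews t i" "meets A B" for A B
    using that tangent_skew_disjoint[OF e(1,2)] by (auto simp: tangents_def skews_def)
  have SS: "A = B" if "A \<in> skews t i" "B \<in> skews t i" "meets A B" for A B
  proof -
    obtain u v where "u \<in> K" "v \<in> K" "v \<noteq> 0" "skew_col u v = i" "A = graph (kmap t) u v"
      using \<open>A \<in> skews t i\<close> unfolding skews_def by blast
    moreover obtain u' v' where "u' \<in> K" "v' \<in> K" "v' \<noteq> 0" "skew_col u' v' = i" "B = graph (kmap t) u' v'"
      using \<open>B \<in> skews t i\<close> unfolding skews_def by blast
    ultimately show ?thesis using skews_disjoint[OF e(1,2), of u v u' v'] \<open>meets A B\<close> by simp
  qed
  have LL: "A = B" if A: "A \<in> lifts t i" and B: "B \<in> lifts t i" and "meets A B" for A B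
  proof -
    obtain x where x: "x \<in> A" "x \<in> B" "x \<noteq> 0" using \<open>meets A B\<close> by (auto simp: meets_def)
    obtain l u v where l: "A = graph (par l) u v" "l \<in> oblique Q" "u \<in> K" "v \<in> K" "\<kappa> l v = (t, i)"
      "embedding (par l)" "l = par l ` K" using lift[OF A] by blast
    obtain m u' v' where m: "B = graph (par m) u' v'" "m \<in> oblique Q" "u' \<in> K" "v' \<in> K" "\<kappa> m v' = (t, i)"
      "embedding (par m)" "m = par m ` K" using lift[OF B] by blast
    obtain z y where z: "z \<in> K" "y \<in> K" "x = par l z + y \<star> w" "par l z \<noteq> 0"
      using graph_proj[of x "par l" u v] x l by metis
    obtain z' y' where z': "z' \<in> K" "y' \<in> K" "x = par m z' + y' \<star> w" "par m z' \<noteq> 0"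
      using graph_proj[of x "par m" u' v'] x m by metis
    have pQ: "par l z \<in> Q" "par m z' \<in> Q" using l m z z' unfolding oblique_def by blast+
    have "par l z = par m z' \<and> y = y'" by (rule split_eq) (use z z' pQ in auto)
    moreover have "par l z \<in> l" "par m z' \<in> m" using l(7) m(7) z(1) z'(1) by (metis imageI)+
    ultimately have "par l z \<in> l" "par l z \<in> m" by simp_all
    then have "meets l m" using z by (auto simp: meets_def)
    then have lm: "l = m" using scheme_eq[of l m v v'] l(2,4,5) m(2,4,5) by simp
    have "inj_on (\<kappa> l) K" using scheme l(2) unfolding scheme_def by blast
    then have "v = v'" using l(4,5) m(4,5) lm by (intro inj_onD[of "\<kappa> l" K v v']) simp_all
    moreover from this have "u = u'" using graph_disjoint[of "par l" u v u'] l m lm \<open>meets A B\<close> unfolding oblique_def by auto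
    ultimately show ?thesis using l m lm by simp
  qed
  have sym: "meets M L" using meet by (auto simp: meets_def)
  have cases: "A \<in> tangents t i \<or> A \<in> skews t i \<or> A \<in> lifts t i" if "A \<in> line_class c" for A
    using that unfolding Some p line_class_def by simp
  show ?thesis
  proof (cases "L \<in> lifts t i")
    case True
    then have "M \<in> lifts t i" using cases[OF L(2)] mixed sym by blast
    with True meet show ?thesis using LL by blast
  next
    case False
    then have "M \<notin> lifts t i" using cases[OF L(1)] mixed meet by blast
    with False show ?thesis using cases[OF L(1)] cases[OF L(2)] TT TS SS meet sym by metis
  qed
qed

text \<open>
  The cases are the three possible ranks of the projection to \<open>Q\<close> along \<open>w\<close>, restricted to the line:
  rank zero gives \<open>K w\<close>, rank one a line meeting \<open>K w\<close> in a point, rank two a graph.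
\<close>
lemma class_cover:
  assumes "line L" shows "\<exists>c\<in>colours. L \<in> line_class c"
proof -
  obtain \<psi> where \<psi>: "embedding \<psi>" "L = \<psi> ` K" using assms by (auto simp: line_def)
  have "\<exists>p. fst p \<in> Q \<and> snd p \<in> K \<and> v = fst p + snd p \<star> w" for v
  proof -
    obtain x y where "x \<in> Q" "y \<in> K" "v = x + y \<star> w" using split_ex[of v] by blast
    then show ?thesis by (intro exI[of _ "(x, y)"]) simp
  qed
  then obtain P where P: "\<And>v. fst (P v) \<in> Q \<and> snd (P v) \<in> K \<and> v = fst (P v) + snd (P v) \<star> w" by metis
  define p where "p z = fst (P (\<psi> z))" for z
  define g where "g z = snd (P (\<psi> z))" for z
  have pg: "p z \<in> Q" "g z \<in> K" "\<psi> z = p z + g z \<star> w" for z using P by (auto simp: p_def g_def)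
  have add: "p (x + y) = p x + p y \<and> g (x + y) = g x + g y" if "x \<in> K" "y \<in> K" for x y
  proof (rule split_eq)
    have "p (x + y) + g (x + y) \<star> w = (p x + g x \<star> w) + (p y + g y \<star> w)"
      using embedding_add[OF \<psi>(1) that] pg(3) by metis
    then show "p (x + y) + g (x + y) \<star> w = p x + p y + (g x + g y) \<star> w"
      by (simp add: sc_add_left pg algebra_simps)
  qed (use pg Ksubspace_closed[OF Q] in auto)
  have hom: "p (r * x) = r \<star> p x \<and> g (r * x) = r * g x" if "r \<in> Fq" "x \<in> K" for r x
  proof (rule split_eq)
    have "p (r * x) + g (r * x) \<star> w = r \<star> (p x + g x \<star> w)"
      using embedding_scale[OF \<psi>(1) that] pg(3) by metis
    then show "p (r * x) + g (r * x) \<star> w = r \<star> p x + (r * g x) \<star> w"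
      using that by (simp add: sc_add_right sc_mult pg)
  qed (use pg that Ksubspace_closed[OF Q] in auto)
  have inj0: "x = 0" if "x \<in> K" "p x = 0" "g x = 0" for x
    using that pg(3)[of x] embedding_0_iff[OF \<psi>(1), of x] by simp
  consider (W) "\<forall>z\<in>K. p z = 0" | (T) z0 z1 where "z0 \<in> K" "z1 \<in> K" "z0 \<noteq> 0" "p z0 = 0" "p z1 \<noteq> 0"
    | (S) "\<forall>z\<in>K. p z = 0 \<longrightarrow> z = 0" by blast
  then show ?thesis
  proof cases
    case W
    have "inj_on g K"
    proof (rule inj_onI)
      fix x y assume xy: "x \<in> K" "y \<in> K" "g x = g y"
      have "g (x - y) = 0" using add[of "x - y" y] xy by simp
      then show "x = y" using inj0[of "x - y"] W xy by simp
    qed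
    then have "g ` K = K" by (intro endo_inj_surj) (use pg in auto)
    moreover have "L = (\<lambda>y. y \<star> w) ` g ` K" using W pg(3) unfolding \<psi> by (auto simp: image_iff)
    ultimately have "L = Kline w" by (simp add: Kline_def)
    then show ?thesis by (intro bexI[of _ None]) (auto simp: line_class_def colours_def)
  next
    case T
    define t where "t = Kline (p z1)"
    have t: "t \<in> Klines Q" using T pg by (auto simp: t_def Klines_def)
    have e: "gen t \<in> Q" "gen t \<noteq> 0" "t = Kline (gen t)" using gen[OF t] by auto
    have "p z1 \<in> Kline (gen t)" using Kline_self e(3) t_def by metis
    then obtain \<xi> where \<xi>: "\<xi> \<in> K" "p z1 = \<xi> \<star> gen t" by (auto simp: Kline_def)
    have \<xi>0: "\<xi> \<noteq> 0" using \<xi> T by auto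
    have g0: "g z0 \<noteq> 0" using inj0[of z0] T by auto
    have z1: "z1 \<noteq> 0" using T(5) hom[of 0 0] by auto
    have "z0 / z1 \<notin> Fq"
    proof
      assume "z0 / z1 \<in> Fq"
      then have "p ((z0 / z1) * z1) = (z0 / z1) \<star> p z1" using hom T by blast
      then show False using T z1 by (simp add: sc_eq_0)
    qed
    then have base: "\<exists>r\<in>Fq. \<exists>s\<in>Fq. z = r * z1 + s * z0" if "z \<in> K" for z
      using K_basis[of "z0 / z1" "z / z1"] that T z1 by (auto simp: field_simps)
    define \<gamma> where "\<gamma> = g z1 / \<xi>"
    define \<delta> where "\<delta> = g z0 / \<xi>"
    have img: "\<psi> (r * z1 + s * z0) = (r * \<xi>) \<star> gen t + (\<xi> * (r * \<gamma> + s * \<delta>)) \<star> w" if "r \<in> Fq" "s \<in> Fq" for r s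
    proof -
      have "p (r * z1 + s * z0) = (r * \<xi>) \<star> gen t" using that T \<xi> add[of "r * z1" "s * z0"] by (simp add: hom sc_mult)
      moreover have "g (r * z1 + s * z0) = \<xi> * (r * \<gamma> + s * \<delta>)"
        using that T \<xi>0 add[of "r * z1" "s * z0"] by (simp add: hom \<gamma>_def \<delta>_def field_simps)
      ultimately show ?thesis using pg(3) by metis
    qed
    have "L = tangent (gen t) \<xi> \<gamma> \<delta>"
    proof (intro subset_antisym subsetI)
      fix x assume "x \<in> L"
      then obtain z where "z \<in> K" "x = \<psi> z" using \<psi> by auto
      moreover obtain r s where rs: "r \<in> Fq" "s \<in> Fq" "z = r * z1 + s * z0" using base[of z] \<open>z \<in> K\<close> by auto
      ultimately show "x \<in> tangent (gen t) \<xi> \<gamma> \<delta>" unfolding tangent_def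
        using img[OF rs(1,2)] by (intro image_eqI[of _ _ "(r, s)"]) auto
    next
      fix x assume "x \<in> tangent (gen t) \<xi> \<gamma> \<delta>"
      then obtain r s where rs: "r \<in> Fq" "s \<in> Fq" "x = (r * \<xi>) \<star> gen t + (\<xi> * (r * \<gamma> + s * \<delta>)) \<star> w"
        by (auto simp: tangent_def)
      then have "x = \<psi> (r * z1 + s * z0)" using img by simp
      moreover have "r * z1 + s * z0 \<in> K" using rs T by simp
      ultimately show "x \<in> L" unfolding \<psi> by blast
    qed
    moreover have K: "\<gamma> \<in> K" "\<delta> \<in> K" "\<delta> \<noteq> 0" using pg \<xi> \<xi>0 g0 by (auto simp: \<gamma>_def \<delta>_def)
    ultimately have "L \<in> tangents t (aff_col \<gamma> \<delta>)" using \<xi> \<xi>0 unfolding tangents_def by blast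
    moreover have "aff_col \<gamma> \<delta> \<in> I"
      using K \<mu>_quotient[of \<delta>] by (simp add: I_def aff_col_def sig_K field_simps)
    ultimately show ?thesis using t by (intro bexI[of _ "Some (t, aff_col \<gamma> \<delta>)"]) (auto simp: line_class_def colours_def)
  next
    case S
    have embp: "embedding p" unfolding embedding_def using add hom S by auto
    define l where "l = p ` K"
    have l: "line l" "l \<subseteq> Q" using embp pg by (auto simp: line_def l_def)
    (* Reparametrize by the parametrization of \<open>l\<close> that the classes use; \<open>h\<close> below is the change
       of parameter. *)
    define \<phi> where "\<phi> = (if l \<in> Klines Q then kmap l else par l)"
    have \<phi>: "embedding \<phi>" "l = \<phi> ` K"
      using par[OF l(1)] gen[of l] embedding_Kline[of "gen l"] by (auto simp: \<phi>_def Kline_def)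
    have "\<forall>z\<in>K. \<exists>y\<in>K. p y = \<phi> z" using \<phi>(2) unfolding l_def by (metis imageE imageI)
    then obtain h where h: "\<And>z. z \<in> K \<Longrightarrow> h z \<in> K \<and> p (h z) = \<phi> z" by metis
    have pinj: "inj_on p K" by (rule embedding_inj[OF embp])
    have h_add: "h (x + y) = h x + h y" if "x \<in> K" "y \<in> K" for x y
      by (rule inj_onD[OF pinj]) (use that h add embedding_add[OF \<phi>(1)] in auto)
    have h_hom: "h (r * x) = r * h x" if "r \<in> Fq" "x \<in> K" for r x
      by (rule inj_onD[OF pinj]) (use that h hom embedding_scale[OF \<phi>(1)] in auto)
    obtain u v where uv: "u \<in> K" "v \<in> K" "\<And>z. z \<in> K \<Longrightarrow> g (h z) = u * z + v * \<sigma> z"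
      by (rule linear_form[of "\<lambda>z. g (h z)"]) (use h h_add h_hom add hom pg in auto)
    have hsurj: "\<exists>z\<in>K. y = h z" if "y \<in> K" for y
    proof -
      have "p y \<in> \<phi> ` K" using that \<phi>(2) unfolding l_def by blast
      then obtain z where z: "z \<in> K" "p y = \<phi> z" by auto
      then have "y = h z" by (intro inj_onD[OF pinj]) (use h that in auto)
      with z show ?thesis by auto
    qed
    have "\<psi> (h z) = \<phi> z + (u * z + v * \<sigma> z) \<star> w" if "z \<in> K" for z
      using that pg(3)[of "h z"] uv h by simp
    then have L: "L = graph \<phi> u v" 
    proof -
      assume *: "\<And>z. z \<in> K \<Longrightarrow> \<psi> (h z) = \<phi> z + (u * z + v * \<sigma> z) \<star> w"
      have "h ` K = K" using h hsurj by blast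
      then have "\<psi> ` K = (\<lambda>z. \<psi> (h z)) ` K" by (metis image_image)
      also have "\<dots> = graph \<phi> u v" unfolding graph_def using * by (rule image_cong[OF refl])
      finally show ?thesis using \<psi> by simp
    qed
    show ?thesis
    proof (cases "l \<in> Klines Q")
      case l_K: True
      then have L: "L = graph (kmap l) u v" using L by (simp add: \<phi>_def)
      show ?thesis
      proof (cases "v = 0")
        case True
        then show ?thesis using L l_K uv by (intro bexI[of _ None]) (auto simp: line_class_def colours_def)
      next
        case False
        have "skew_col u v \<in> I"
        proof -
          have v: "\<sigma> v / v \<in> \<mu>" using uv False by (simp add: \<mu>_quotient)
          have *: "\<eta>\<^sub>0 * \<sigma> \<eta>\<^sub>0 = 1" "\<eta>\<^sub>0 * \<sigma> c\<^sub>0 = - c\<^sub>0" "\<sigma> (\<sigma> v) = v" "\<sigma> (\<sigma> u) = u"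
            using ex_line uv by (auto simp: \<mu>_def sig_K eq_neg_iff_add_eq_0)
          have "\<eta>\<^sub>0 * (\<sigma> v / v) \<in> \<mu>" using *(1) False by (simp add: \<mu>_def *(3))
          moreover have "\<eta>\<^sub>0 * (\<sigma> v / v) * \<sigma> (c\<^sub>0 * \<sigma> v + \<sigma> u - \<eta>\<^sub>0 * (\<sigma> v / v) * u)
            = (\<eta>\<^sub>0 * \<sigma> c\<^sub>0) * \<sigma> v + \<eta>\<^sub>0 * (\<sigma> v / v) * u - (\<eta>\<^sub>0 * \<sigma> \<eta>\<^sub>0) * \<sigma> u"
            using False by (simp add: *(3,4) field_simps)
          ultimately show ?thesis by (simp add: I_def skew_col_def * del: sig_diff sig_add sig_mult)
        qed
        moreover have "L \<in> skews l (skew_col u v)" using L uv False unfolding skews_def by blast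
        ultimately show ?thesis using l_K
          by (intro bexI[of _ "Some (l, skew_col u v)"]) (auto simp: line_class_def colours_def)
      qed
    next
      case False
      then have lo: "l \<in> oblique Q" using l by (simp add: oblique_def)
      obtain t i where ti: "\<kappa> l v = (t, i)" by (cases "\<kappa> l v")
      have "(t, i) \<in> Klines Q \<times> I" using scheme lo uv ti unfolding scheme_def by (metis image_subset_iff)
      moreover have "L \<in> lifts t i" using L False lo uv ti unfolding lifts_def \<phi>_def by auto
      ultimately show ?thesis by (intro bexI[of _ "Some (t, i)"]) (auto simp: line_class_def colours_def)
    qed
  qed
qed

end

section \<open>From designs in a plane to schemes\<close>
context frobenius_field
begin

sublocale sf: kmodule q ty "(*)"
  by unfold_locales (auto simp: algebra_simps)

text \<open>
  All \<open>K\<close>-planes look like \<open>F\<close>, the field with \<open>q\<^sup>4\<close> elements. Each \<open>g\<close> stands for a set of disjoint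
  lines, the \<open>K\<close>-line \<open>\<tau> g\<close> together with the members of \<open>S g\<close>. The two bounds are those that turn each
  \<open>g\<close> into a colour: there are \<open>q (q + 1)\<close> colours \<open>(t, i)\<close> for a \<open>K\<close>-line \<open>t\<close>, and an oblique line needs a
  colour for each of the \<open>q\<^sup>2\<close> values of \<open>v\<close>.
\<close>
definition plane_design :: "'g set \<Rightarrow> ('g \<Rightarrow> 'b set) \<Rightarrow> ('g \<Rightarrow> 'b set set) \<Rightarrow> bool" where
  "plane_design \<Gamma> \<tau> S \<longleftrightarrow> finite \<Gamma> \<and> (\<forall>g\<in>\<Gamma>. \<tau> g \<in> sf.Klines F) \<and>
     (\<forall>t. card {g \<in> \<Gamma>. \<tau> g = t} \<le> (q + 1) * q) \<and>
     (\<forall>g\<in>\<Gamma>. (\<forall>m\<in>S g. \<not> sf.meets m (\<tau> g)) \<and> (\<forall>m\<in>S g. \<forall>m'\<in>S g. sf.meets m m' \<longrightarrow> m = m')) \<and>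
     (\<forall>m\<in>sf.oblique F. q\<^sup>2 \<le> card {g \<in> \<Gamma>. m \<in> S g})"

lemma obtain_\<beta>: obtains \<beta> where "\<beta> \<in> F" "\<beta> \<notin> K"
proof -
  have "q\<^sup>2 < q ^ 4" using q3 by (intro power_strict_increasing) auto
  then have "card K < card F" using card_K card_F by simp
  then show thesis using that by (metis card_mono finite_K linorder_not_less subsetI)
qed

text \<open>
  The coordinates of \<open>z\<close> with respect to the basis \<open>1, \<beta>\<close> of \<open>F\<close> over \<open>K\<close>, obtained by applying the
  nontrivial automorphism \<open>\<sigma>\<^sup>2\<close> of \<open>F\<close> over \<open>K\<close> to \<open>z = x + y \<beta>\<close>.
\<close>
lemma F_coord:
  assumes "\<beta> \<in> F" "\<beta> \<notin> K" "z \<in> F"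
  shows "(\<sigma> (\<sigma> z) - z) / (\<sigma> (\<sigma> \<beta>) - \<beta>) \<in> K"
    and "z - (\<sigma> (\<sigma> z) - z) / (\<sigma> (\<sigma> \<beta>) - \<beta>) * \<beta> \<in> K"
proof -
  have d: "\<sigma> (\<sigma> \<beta>) - \<beta> \<noteq> 0" using assms by (simp add: K_def)
  define y where "y = (\<sigma> (\<sigma> z) - z) / (\<sigma> (\<sigma> \<beta>) - \<beta>)"
  have y: "y \<in> K" unfolding y_def K_def using assms by (simp add: sig_F) (metis minus_diff_eq minus_divide_divide)
  have "y * (\<sigma> (\<sigma> \<beta>) - \<beta>) = \<sigma> (\<sigma> z) - z" using d by (simp add: y_def)
  then have "z - y * \<beta> \<in> K" using y by (simp add: K_def algebra_simps)
  with y show "(\<sigma> (\<sigma> z) - z) / (\<sigma> (\<sigma> \<beta>) - \<beta>) \<in> K" 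
    "z - (\<sigma> (\<sigma> z) - z) / (\<sigma> (\<sigma> \<beta>) - \<beta>) * \<beta> \<in> K" by (simp_all add: y_def)
qed

end

context kmodule
begin

definition plane_map :: "('b \<Rightarrow> 'v) \<Rightarrow> bool" where
  "plane_map \<phi> \<longleftrightarrow> (\<forall>x\<in>F. \<forall>y\<in>F. \<phi> (x + y) = \<phi> x + \<phi> y) \<and> (\<forall>a\<in>K. \<forall>x\<in>F. \<phi> (a * x) = a \<star> \<phi> x) \<and>
     (\<forall>x\<in>F. \<phi> x = 0 \<longrightarrow> x = 0)"

lemma plane_map_add: "plane_map \<phi> \<Longrightarrow> x \<in> F \<Longrightarrow> y \<in> F \<Longrightarrow> \<phi> (x + y) = \<phi> x + \<phi> y"
  by (auto simp: plane_map_def)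
lemma plane_map_scale: "plane_map \<phi> \<Longrightarrow> a \<in> K \<Longrightarrow> y \<in> F \<Longrightarrow> \<phi> (a * y) = a \<star> \<phi> y"
  by (auto simp: plane_map_def)
lemma plane_map_0_iff: "plane_map \<phi> \<Longrightarrow> x \<in> F \<Longrightarrow> \<phi> x = 0 \<longleftrightarrow> x = 0"
  using plane_map_scale[of \<phi> 0 0] by (auto simp: plane_map_def)
lemma plane_map_diff: "plane_map \<phi> \<Longrightarrow> x \<in> F \<Longrightarrow> y \<in> F \<Longrightarrow> \<phi> (x - y) = \<phi> x - \<phi> y"
  using plane_map_add[of \<phi> "x - y" y] by (simp add: eq_diff_eq)
lemma plane_map_inj: "plane_map \<phi> \<Longrightarrow> inj_on \<phi> F"
  by (rule inj_onI) (metis F_closed(5) plane_map_0_iff plane_map_diff right_minus_eq)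

lemma plane_map_exists:
  assumes Q: "Ksubspace Q" and l: "l \<in> oblique Q"
  shows "\<exists>\<phi>. plane_map \<phi> \<and> \<phi> ` F \<subseteq> Q \<and> l \<subseteq> \<phi> ` F"
proof -
  obtain \<psi> where \<psi>: "embedding \<psi>" "l = \<psi> ` K" and lQ: "l \<subseteq> Q" "l \<notin> Klines Q"
    using l by (auto simp: oblique_def line_def)
  obtain \<omega> where w: "\<omega> \<in> K" "\<omega> \<notin> Fq" by (rule obtain_\<omega>)
  obtain \<beta> where b: "\<beta> \<in> F" "\<beta> \<notin> K" by (rule obtain_\<beta>)
  define e where "e = \<psi> 1"
  define f where "f = \<psi> \<omega>"
  have ef: "e \<in> Q" "f \<in> Q" using lQ w by (auto simp: e_def f_def \<psi>)
  have e0: "e \<noteq> 0" using embedding_0_iff[OF \<psi>(1), of 1] by (simp add: e_def)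
  have \<psi>z: "\<psi> (r + s * \<omega>) = r \<star> e + s \<star> f" if "r \<in> Fq" "s \<in> Fq" for r s
    using that w embedding_add[OF \<psi>(1), of r "s * \<omega>"] embedding_scale[OF \<psi>(1), of r 1] embedding_scale[OF \<psi>(1), of s \<omega>]
    by (simp add: e_def f_def)
  have fe: "f \<notin> Kline e" using oblique_indep[OF \<psi>(1) _ w] l \<psi>(2) by (simp add: e_def f_def)
  have indep: "x = 0 \<and> y = 0" if "x \<in> K" "y \<in> K" "x \<star> e + y \<star> f = 0" for x y
  proof -
    have "y = 0"
    proof (rule ccontr)
      assume y: "y \<noteq> 0"
      have "y \<star> f = (- x) \<star> e" using that by (simp add: sc_minus_left eq_neg_iff_add_eq_0 add.commute)
      then have "inverse y \<star> y \<star> f = inverse y \<star> (- x) \<star> e" by simp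
      then have "f = (inverse y * (- x)) \<star> e" using that y by (simp add: sc_mult)
      moreover have "inverse y * (- x) \<in> K" using that by simp
      ultimately show False using fe unfolding Kline_def by blast
    qed
    with that e0 show ?thesis by (simp add: sc_eq_0)
  qed
  define py where "py z = (\<sigma> (\<sigma> z) - z) / (\<sigma> (\<sigma> \<beta>) - \<beta>)" for z
  define px where "px z = z - py z * \<beta>" for z
  have pxy: "px z \<in> K" "py z \<in> K" if "z \<in> F" for z using F_coord[OF b that] by (auto simp: px_def py_def)
  have py_add: "py (x + y) = py x + py y" for x y by (simp add: py_def add_divide_distrib[symmetric] algebra_simps)
  have px_add: "px (x + y) = px x + px y" for x y by (simp add: px_def py_add algebra_simps)
  have py_hom: "py (a * z) = a * py z" if "a \<in> K" for a z using that by (simp add: py_def sig_K algebra_simps)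
  have px_hom: "px (a * z) = a * px z" if "a \<in> K" for a z using that by (simp add: px_def py_hom algebra_simps)
  define \<phi> where "\<phi> z = px z \<star> e + py z \<star> f" for z
  have "plane_map \<phi>" unfolding plane_map_def
  proof (intro conjI ballI impI)
    fix x y assume "x \<in> F" "y \<in> F"
    then show "\<phi> (x + y) = \<phi> x + \<phi> y" by (simp add: \<phi>_def px_add py_add sc_add_left pxy)
  next
    fix a x assume "a \<in> K" "x \<in> F"
    then show "\<phi> (a * x) = a \<star> \<phi> x" by (simp add: \<phi>_def px_hom py_hom sc_add_right sc_mult pxy)
  next
    fix x assume x: "x \<in> F" "\<phi> x = 0"
    then have "px x = 0 \<and> py x = 0" by (intro indep) (auto simp: \<phi>_def pxy)
    then show "x = 0" by (auto simp: px_def)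
  qed
  moreover have "\<phi> ` F \<subseteq> Q" using ef pxy Ksubspace_closed[OF Q] by (auto simp: \<phi>_def)
  moreover have "l \<subseteq> \<phi> ` F"
  proof
    fix x assume "x \<in> l"
    then obtain z where z: "z \<in> K" "x = \<psi> z" using \<psi> by auto
    obtain r s where rs: "r \<in> Fq" "s \<in> Fq" "z = r + s * \<omega>" using K_basis[OF w z(1)] by auto
    have d: "\<sigma> (\<sigma> \<beta>) - \<beta> \<noteq> 0" using b by (simp add: K_def)
    have "py (r + s * \<beta>) = s" using rs d by (simp add: py_def sig_Fq right_diff_distrib[symmetric])
    then have "x = \<phi> (r + s * \<beta>)" using \<psi>z[OF rs(1,2)] z rs by (simp add: \<phi>_def px_def)
    then show "x \<in> \<phi> ` F" using rs b by simp
  qed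
  ultimately show ?thesis by blast
qed

lemma plane_unique:
  assumes "plane_map \<phi>" "plane_map \<phi>'" and x: "x \<noteq> 0" "x \<in> \<phi> ` F" "x \<in> \<phi>' ` F" and y: "y \<in> \<phi> ` F" "y \<in> \<phi>' ` F" "y \<notin> Kline x"
  shows "\<phi> ` F = \<phi>' ` F"
proof -
  define P where "P = (\<lambda>(a, b). a \<star> x + b \<star> y) ` (K \<times> K)"
  have inj: "inj_on (\<lambda>(a, b). a \<star> x + b \<star> y) (K \<times> K)"
  proof (rule inj_onI, clarify)
    fix a b a' b' assume K: "a \<in> K" "b \<in> K" "a' \<in> K" "b' \<in> K" and eq: "a \<star> x + b \<star> y = a' \<star> x + b' \<star> y"
    then have *: "(b - b') \<star> y = (a' - a) \<star> x" by (simp add: sc_diff_left algebra_simps)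
    have "b = b'"
    proof (rule ccontr)
      assume "b \<noteq> b'"
      then have "y = inverse (b - b') \<star> (b - b') \<star> y" using K by (simp add: sc_mult del: sig_diff)
      also have "\<dots> = (inverse (b - b') * (a' - a)) \<star> x" unfolding * using K by (simp add: sc_mult)
      finally show False using y K unfolding Kline_def by auto
    qed
    with * K x show "a = a' \<and> b = b'" by (simp add: sc_eq_0)
  qed
  have cP: "card P = q ^ 4" unfolding P_def card_image[OF inj] by (simp add: card_cartesian_product card_K flip: power_add)
  have "P = \<theta> ` F" if \<theta>: "plane_map \<theta>" "x \<in> \<theta> ` F" "y \<in> \<theta> ` F" for \<theta>
  proof (rule card_subset_eq)
    obtain x' y' where x'y': "x' \<in> F" "y' \<in> F" "x = \<theta> x'" "y = \<theta> y'" using \<theta> by auto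
    have "a \<star> x + b \<star> y = \<theta> (a * x' + b * y')" if "a \<in> K" "b \<in> K" for a b
      using that x'y' by (simp add: plane_map_add[OF \<theta>(1)] plane_map_scale[OF \<theta>(1)])
    then show "P \<subseteq> \<theta> ` F" using x'y' unfolding P_def by auto
    show "card P = card (\<theta> ` F)" using cP card_image[OF plane_map_inj[OF \<theta>(1)]] card_F by simp
  qed simp
  from this[of \<phi>] this[of \<phi>'] assms show ?thesis by metis
qed

lemma oblique_pullback:
  assumes \<phi>: "plane_map \<phi>" and Q: "\<phi> ` F \<subseteq> Q" and l: "l \<in> oblique Q" "l \<subseteq> \<phi> ` F"
  shows "{z \<in> F. \<phi> z \<in> l} \<in> sf.oblique F" and "\<phi> ` {z \<in> F. \<phi> z \<in> l} = l"
proof -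
  define m where "m = {z \<in> F. \<phi> z \<in> l}"
  show im: "\<phi> ` {z \<in> F. \<phi> z \<in> l} = l" using l by auto
  obtain \<psi> where \<psi>: "embedding \<psi>" "l = \<psi> ` K" using l by (auto simp: oblique_def line_def)
  have "\<forall>z\<in>K. \<exists>y\<in>F. \<phi> y = \<psi> z" using l(2) unfolding \<psi>(2) by force
  then obtain h where h: "\<And>z. z \<in> K \<Longrightarrow> h z \<in> F \<and> \<phi> (h z) = \<psi> z" by metis
  note inj = plane_map_inj[OF \<phi>]
  have "sf.embedding h" unfolding sf.embedding_def
  proof (intro conjI ballI impI)
    fix x y assume "x \<in> K" "y \<in> K"
    then show "h (x + y) = h x + h y"
      by (intro inj_onD[OF inj]) (use h in \<open>auto simp: plane_map_add[OF \<phi>] embedding_add[OF \<psi>(1)]\<close>)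
  next
    fix r x assume "r \<in> Fq" "x \<in> K"
    then show "h (r * x) = r * h x"
      by (intro inj_onD[OF inj]) (use h in \<open>auto simp: plane_map_scale[OF \<phi>] embedding_scale[OF \<psi>(1)]\<close>)
  next
    fix x assume "x \<in> K" "h x = 0"
    then show "x = 0" using h[of x] plane_map_0_iff[OF \<phi>, of 0] embedding_0_iff[OF \<psi>(1)] by auto
  qed
  moreover have "m = h ` K"
  proof (intro subset_antisym subsetI)
    fix z assume "z \<in> m"
    then obtain y where y: "y \<in> K" "\<phi> z = \<psi> y" "z \<in> F" using \<psi> by (auto simp: m_def)
    then have "z = h y" by (intro inj_onD[OF inj]) (use h in auto)
    with y show "z \<in> h ` K" by simp
  qed (use h \<psi> in \<open>auto simp: m_def\<close>)
  ultimately have lin: "sf.line m" unfolding sf.line_def by blast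
  have "m \<notin> sf.Klines F"
  proof
    assume "m \<in> sf.Klines F"
    then obtain z where z: "z \<in> F" "z \<noteq> 0" "m = sf.Kline z" by (auto simp: sf.Klines_def)
    have "l = \<phi> ` sf.Kline z" using im z unfolding m_def by simp
    also have "\<dots> = Kline (\<phi> z)" unfolding Kline_def sf.Kline_def image_image
      using plane_map_scale[OF \<phi>] z by (intro image_cong) auto
    finally have "l \<in> Klines Q" using z Q plane_map_0_iff[OF \<phi>] unfolding Klines_def by blast
    then show False using l by (simp add: oblique_def)
  qed
  with lin show "{z \<in> F. \<phi> z \<in> l} \<in> sf.oblique F" by (auto simp: sf.oblique_def m_def)
qed

text \<open>
  An oblique line \<open>l\<close> lies in a unique plane \<open>\<phi> ` F\<close>. Transport the design to each plane and
  number the \<open>g\<close> with the same \<open>\<tau> g\<close> injectively by the elements of \<open>I\<close>; so each \<open>g\<close> becomes a colour.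
  Distribute \<open>q\<^sup>2\<close> of the \<open>g\<close> with \<open>l\<close> in \<open>S g\<close> to the values of \<open>v\<close>. If intersecting lines \<open>l\<close>, \<open>m\<close> share a
  colour \<open>(t, i)\<close>, then their planes share \<open>t\<close> and a point outside \<open>t\<close>, hence they coincide; so both
  lines come from the same \<open>g\<close>, and the lines in \<open>S g\<close> are disjoint.
\<close>
lemma scheme_exists:
  assumes D: "plane_design \<Gamma> \<tau> S" and Q: "Ksubspace Q"
  shows "\<exists>\<kappa>. scheme Q \<kappa>"
proof -
  have fin: "finite \<Gamma>" and \<tau>: "\<And>g. g \<in> \<Gamma> \<Longrightarrow> \<tau> g \<in> sf.Klines F"
    and fib: "\<And>t. card {g \<in> \<Gamma>. \<tau> g = t} \<le> (q + 1) * q"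
    and Sdis: "\<And>g m. g \<in> \<Gamma> \<Longrightarrow> m \<in> S g \<Longrightarrow> \<not> sf.meets m (\<tau> g)"
    and Seq: "\<And>g m m'. g \<in> \<Gamma> \<Longrightarrow> m \<in> S g \<Longrightarrow> m' \<in> S g \<Longrightarrow> sf.meets m m' \<Longrightarrow> m = m'"
    and cov: "\<And>m. m \<in> sf.oblique F \<Longrightarrow> q\<^sup>2 \<le> card {g \<in> \<Gamma>. m \<in> S g}"
    using D unfolding plane_design_def by auto
  define good where "good l \<pi> \<longleftrightarrow> (\<exists>\<phi>. plane_map \<phi> \<and> \<phi> ` F = \<pi>) \<and> \<pi> \<subseteq> Q \<and> l \<subseteq> \<pi>" for l \<pi>
  define pl where "pl l = (SOME \<pi>. good l \<pi>)" for l
  have pl: "good l (pl l)" if "l \<in> oblique Q" for l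
    unfolding pl_def
  proof (rule someI_ex)
    from plane_map_exists[OF Q that] obtain \<phi> where "plane_map \<phi>" "\<phi> ` F \<subseteq> Q" "l \<subseteq> \<phi> ` F" by blast
    then have "good l (\<phi> ` F)" unfolding good_def by auto
    then show "\<exists>\<pi>. good l \<pi>" ..
  qed
  define pm where "pm \<pi> = (SOME \<phi>. plane_map \<phi> \<and> \<phi> ` F = \<pi>)" for \<pi>
  have pm: "plane_map (pm \<pi>) \<and> pm \<pi> ` F = \<pi>" if "\<exists>\<phi>. plane_map \<phi> \<and> \<phi> ` F = \<pi>" for \<pi>
    unfolding pm_def using that by (rule someI_ex[where P = "\<lambda>\<phi>. plane_map \<phi> \<and> \<phi> ` F = \<pi>"])
  (* The numbering of the fibre of \<open>\<tau>\<close> over \<open>t\<close> by affine lines. *)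
  define en where "en t = (SOME f. f ` {g \<in> \<Gamma>. \<tau> g = t} \<subseteq> I \<and> inj_on f {g \<in> \<Gamma>. \<tau> g = t})" for t
  have en: "en t ` {g \<in> \<Gamma>. \<tau> g = t} \<subseteq> I \<and> inj_on (en t) {g \<in> \<Gamma>. \<tau> g = t}" for t
    unfolding en_def by (rule someI_ex[where P = "\<lambda>f. f ` _ \<subseteq> _ \<and> inj_on f _"], rule card_le_inj) (use fin fib[of t] card_I in auto)
  (* The parametrization depends on \<open>l\<close> only through its plane \<open>pl l\<close>, so lines in the same plane
     are pulled back by the same map. *)
  define ph where "ph l = pm (pl l)" for l
  define pb where "pb l = {z \<in> F. ph l z \<in> l}" for l
  have ph: "plane_map (ph l)" "ph l ` F \<subseteq> Q" "l \<subseteq> ph l ` F" "ph l ` F = pl l" if "l \<in> oblique Q" for l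
    using pl[OF that] pm[of "pl l"] unfolding ph_def good_def by auto
  have pb: "pb l \<in> sf.oblique F" "ph l ` pb l = l" if "l \<in> oblique Q" for l
    unfolding pb_def using oblique_pullback[OF ph(1-2)] that ph by auto
  (* The distribution of the sets \<open>S g\<close> containing \<open>l\<close> to the values of \<open>v\<close>. *)
  define as where "as l = (SOME f. f ` K \<subseteq> {g \<in> \<Gamma>. pb l \<in> S g} \<and> inj_on f K)" for l
  have as: "as l ` K \<subseteq> {g \<in> \<Gamma>. pb l \<in> S g} \<and> inj_on (as l) K" if "l \<in> oblique Q" for l
    unfolding as_def by (rule someI_ex[where P = "\<lambda>f. f ` _ \<subseteq> _ \<and> inj_on f _"], rule card_le_inj) (use fin cov[OF pb(1)[OF that]] card_K in auto)
  have asd: "as l v \<in> \<Gamma>" "pb l \<in> S (as l v)" if "l \<in> oblique Q" "v \<in> K" for l v using as[OF that(1)] that(2) by auto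
  define \<kappa> where "\<kappa> l v = (ph l ` \<tau> (as l v), en (\<tau> (as l v)) (as l v))" for l v
  have \<tau>F: "\<tau> g \<subseteq> F" if "g \<in> \<Gamma>" for g using \<tau>[OF that] by (auto simp: sf.Klines_def sf.Kline_def)
  have en_eq: "g = g'" if "g \<in> \<Gamma>" "g' \<in> \<Gamma>" "\<tau> g = \<tau> g'" "en (\<tau> g) g = en (\<tau> g') g'" for g g'
    using en[of "\<tau> g"] that by (auto dest: inj_onD)
  have \<tau>_eq: "\<tau> g = \<tau> g'" if "g \<in> \<Gamma>" "g' \<in> \<Gamma>" "plane_map \<phi>" "\<phi> ` \<tau> g = \<phi> ` \<tau> g'" for g g' \<phi>
    using inj_on_image_eq_iff[OF plane_map_inj[OF that(3)] \<tau>F[OF that(1)] \<tau>F[OF that(2)]] that(4) by simp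
  have K_image: "\<exists>x. x \<in> Q \<and> x \<noteq> 0 \<and> ph l ` \<tau> g = Kline x" if lg: "l \<in> oblique Q" "g \<in> \<Gamma>" for l g
  proof -
    obtain z where z: "z \<in> F" "z \<noteq> 0" "\<tau> g = sf.Kline z" using \<tau>[OF lg(2)] by (auto simp: sf.Klines_def)
    have "ph l ` \<tau> g = Kline (ph l z)" unfolding z Kline_def sf.Kline_def image_image
      using plane_map_scale[OF ph(1)[OF lg(1)]] z by (intro image_cong) auto
    moreover have "ph l z \<in> Q" using z(1) ph(2)[OF lg(1)] by blast
    moreover have "ph l z \<noteq> 0" using plane_map_0_iff[OF ph(1)[OF lg(1)] z(1)] z(2) by simp
    ultimately show ?thesis by blast
  qed
  have dis: "\<not> meets l (fst (\<kappa> l v))" if lv: "l \<in> oblique Q" "v \<in> K" for l v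
  proof
    assume "meets l (fst (\<kappa> l v))"
    then obtain x where x: "x \<in> l" "x \<in> ph l ` \<tau> (as l v)" "x \<noteq> 0" by (auto simp: meets_def \<kappa>_def)
    then obtain z where z: "z \<in> \<tau> (as l v)" "x = ph l z" by auto
    have zF: "z \<in> F" using \<tau>F[OF asd(1)[OF lv]] z(1) by blast
    then have "z \<in> pb l" "z \<noteq> 0" using x z plane_map_0_iff[OF ph(1)[OF lv(1)], of 0] by (auto simp: pb_def)
    then have "sf.meets (pb l) (\<tau> (as l v))" using z by (auto simp: sf.meets_def)
    then show False using Sdis[OF asd[OF lv]] by simp
  qed
  have "scheme Q \<kappa>" unfolding scheme_def
  proof (intro conjI ballI impI)
    fix l assume l: "l \<in> oblique Q"
    show "inj_on (\<kappa> l) K"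
    proof (rule inj_onI)
      fix v v' assume v: "v \<in> K" "v' \<in> K" "\<kappa> l v = \<kappa> l v'"
      have "\<tau> (as l v) = \<tau> (as l v')" by (rule \<tau>_eq[of _ _ "ph l"]) (use v asd l ph in \<open>auto simp: \<kappa>_def\<close>)
      then have "as l v = as l v'" by (intro en_eq) (use v asd l in \<open>auto simp: \<kappa>_def\<close>)
      then show "v = v'" using as[OF l] v by (auto dest: inj_onD)
    qed
    show "\<kappa> l ` K \<subseteq> Klines Q \<times> I"
    proof
      fix p assume "p \<in> \<kappa> l ` K"
      then obtain v where v: "v \<in> K" "p = \<kappa> l v" by auto
      have "ph l ` \<tau> (as l v) \<in> Klines Q" using K_image[OF l asd(1)[OF l v(1)]] by (auto simp: Klines_def)
      moreover have "en (\<tau> (as l v)) (as l v) \<in> I" using en asd(1)[OF l v(1)] by auto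
      ultimately show "p \<in> Klines Q \<times> I" by (simp add: v \<kappa>_def)
    qed
  next
    fix l v assume "l \<in> oblique Q" "v \<in> K"
    then show "\<not> meets l (fst (\<kappa> l v))" by (rule dis)
  next
    fix l m v v' assume lm: "l \<in> oblique Q" "m \<in> oblique Q" "v \<in> K" "v' \<in> K" and eq: "\<kappa> l v = \<kappa> m v' \<and> meets l m"
    define g where "g = as l v"
    define g' where "g' = as m v'"
    have g: "g \<in> \<Gamma>" "g' \<in> \<Gamma>" "pb l \<in> S g" "pb m \<in> S g'" using asd lm by (auto simp: g_def g'_def)
    have tt: "ph l ` \<tau> g = ph m ` \<tau> g'" "en (\<tau> g) g = en (\<tau> g') g'" using eq by (auto simp: \<kappa>_def g_def g'_def)
    obtain x where x: "x \<noteq> 0" "ph l ` \<tau> g = Kline x" using K_image[OF lm(1) g(1)] by auto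
    obtain y where y: "y \<in> l" "y \<in> m" "y \<noteq> 0" using eq by (auto simp: meets_def)
    have "y \<notin> Kline x" using dis[OF lm(1,3)] y(1,3) x(2) unfolding \<kappa>_def meets_def g_def by auto
    moreover have "x \<in> ph l ` \<tau> g" "x \<in> ph m ` \<tau> g'" using Kline_self[of x] tt(1) x(2) by simp_all
    then have "x \<in> ph l ` F" "x \<in> ph m ` F" using image_mono[OF \<tau>F] g(1,2) by (metis subsetD)+
    moreover have "y \<in> ph l ` F" "y \<in> ph m ` F" using ph(3)[OF lm(1)] ph(3)[OF lm(2)] y by (metis subsetD)+
    ultimately have "ph l ` F = ph m ` F" by (intro plane_unique[of "ph l" "ph m" x y]) (use ph lm x in auto)
    then have "pl l = pl m" using ph(4) lm by simp
    then have pp: "ph l = ph m" by (simp add: ph_def)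
    have "\<tau> g = \<tau> g'" by (rule \<tau>_eq[of _ _ "ph l"]) (use g tt pp ph lm in auto)
    then have gg: "g = g'" by (intro en_eq) (use g tt in auto)
    obtain z where z: "z \<in> F" "y = ph l z" using ph(3)[OF lm(1)] y by auto
    have "z \<noteq> 0" using z y plane_map_0_iff[OF ph(1)[OF lm(1)], of 0] by auto
    moreover have "z \<in> pb l" "z \<in> pb m" using z y pp by (auto simp: pb_def)
    ultimately have "sf.meets (pb l) (pb m)" by (auto simp: sf.meets_def)
    moreover have "pb m \<in> S g" using g(4) unfolding gg[symmetric] .
    ultimately have "pb l = pb m" using Seq[OF g(1) g(3)] by blast
    then show "l = m" using pb(2)[OF lm(1)] pb(2)[OF lm(2)] pp by metis
  qed
  then show ?thesis by blast
qed

end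

section \<open>Designs in characteristic two\<close>
context frobenius_field
begin

definition pt :: "'b \<Rightarrow> 'b set" where "pt \<gamma> = (\<lambda>r. r * \<gamma>) ` Fq"

lemma pt_scale: assumes "r \<in> Fq" "r \<noteq> 0" shows "pt (r * \<gamma>) = pt \<gamma>"
proof (intro subset_antisym subsetI)
  fix x assume "x \<in> pt \<gamma>"
  then obtain s where "s \<in> Fq" "x = s * \<gamma>" by (auto simp: pt_def)
  then show "x \<in> pt (r * \<gamma>)" unfolding pt_def using assms by (intro image_eqI[of _ _ "s / r"]) auto
qed (use assms in \<open>auto simp: pt_def mult.assoc[symmetric]\<close>)

lemma pt_eq: assumes "pt \<gamma> = pt \<gamma>'" "\<gamma>' \<noteq> 0" obtains r where "r \<in> Fq" "r \<noteq> 0" "\<gamma>' = r * \<gamma>"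
proof -
  have "\<gamma>' \<in> pt \<gamma>'" unfolding pt_def by (rule image_eqI[of _ _ 1]) auto
  with assms(1) have "\<gamma>' \<in> pt \<gamma>" by simp
  then obtain r where "r \<in> Fq" "\<gamma>' = r * \<gamma>" by (auto simp: pt_def)
  with assms(2) that show ?thesis by auto
qed

text \<open>
  The points of the \<open>K\<close>-line of \<open>\<gamma>\<close> are spanned by the vectors \<open>a \<gamma>\<close> with \<open>a \<in> K\<close>, and \<open>a\<close> matters only up to \<open>Fq\<close>, that is, through \<open>\<sigma> a / a \<in> \<mu>\<close>.
\<close>
lemma card_points_Kline:
  "finite (pt ` {\<gamma> \<in> F - {0}. sf.Kline \<gamma> = t})" "card (pt ` {\<gamma> \<in> F - {0}. sf.Kline \<gamma> = t}) \<le> q + 1"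
proof -
  show "finite (pt ` {\<gamma> \<in> F - {0}. sf.Kline \<gamma> = t})" by simp
  show "card (pt ` {\<gamma> \<in> F - {0}. sf.Kline \<gamma> = t}) \<le> q + 1"
  proof (cases "\<exists>\<gamma>\<in>F - {0}. sf.Kline \<gamma> = t")
    case True
    then obtain \<gamma> where \<gamma>: "\<gamma> \<in> F" "\<gamma> \<noteq> 0" "sf.Kline \<gamma> = t" by auto
    have "\<forall>\<eta>\<in>\<mu>. \<exists>b. b \<in> K \<and> b \<noteq> 0 \<and> \<sigma> b / b = \<eta>" using \<mu>_root by metis
    then obtain rt where rt: "\<And>\<eta>. \<eta> \<in> \<mu> \<Longrightarrow> rt \<eta> \<in> K \<and> rt \<eta> \<noteq> 0 \<and> \<sigma> (rt \<eta>) / rt \<eta> = \<eta>" by metis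
    have "pt ` {\<gamma> \<in> F - {0}. sf.Kline \<gamma> = t} \<subseteq> (\<lambda>\<eta>. pt (rt \<eta> * \<gamma>)) ` \<mu>"
    proof
      fix p assume "p \<in> pt ` {\<gamma> \<in> F - {0}. sf.Kline \<gamma> = t}"
      then obtain \<gamma>' where \<gamma>': "\<gamma>' \<noteq> 0" "sf.Kline \<gamma>' = t" "p = pt \<gamma>'" by auto
      have "\<gamma>' \<in> sf.Kline \<gamma>" using sf.Kline_self[of \<gamma>'] \<gamma>' \<gamma> by simp
      then obtain a where a: "a \<in> K" "\<gamma>' = a * \<gamma>" by (auto simp: sf.Kline_def)
      have a0: "a \<noteq> 0" using a \<gamma>' by auto
      define \<eta> where "\<eta> = \<sigma> a / a"
      have \<eta>: "\<eta> \<in> \<mu>" using a a0 by (simp add: \<eta>_def \<mu>_quotient)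
      have "a / rt \<eta> \<in> Fq" by (rule quotient_eq_Fq) (use rt[OF \<eta>] a0 in \<open>auto simp: \<eta>_def\<close>)
      then have "pt ((a / rt \<eta>) * (rt \<eta> * \<gamma>)) = pt (rt \<eta> * \<gamma>)" using a0 rt[OF \<eta>] by (intro pt_scale) auto
      then have "p = pt (rt \<eta> * \<gamma>)" using rt[OF \<eta>] a \<gamma>' by simp
      with \<eta> show "p \<in> (\<lambda>\<eta>. pt (rt \<eta> * \<gamma>)) ` \<mu>" by blast
    qed
    then have "card (pt ` {\<gamma> \<in> F - {0}. sf.Kline \<gamma> = t}) \<le> card \<mu>" by (meson card_image_le card_mono finite_\<mu> finite_imageI le_trans)
    then show ?thesis by (simp add: card_\<mu>)
  next
    case False
    then have *: "{\<gamma> \<in> F - {0}. sf.Kline \<gamma> = t} = {}" by auto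
    show ?thesis unfolding * by simp
  qed
qed

end

lemma char_two:
  fixes x y :: "'a::comm_ring_1"
  assumes "(1::'a) + 1 = 0"
  shows "x + x = 0" and "x + (x + y) = y" and "- x = x" and "x - y = x + y"
proof -
  have *: "z + z = 0" for z :: 'a
  proof -
    have "z + z = z * (1 + 1)" by (simp only: distrib_left mult_1_right)
    then show ?thesis by (simp only: assms mult_zero_right)
  qed
  show "x + x = 0" by (rule *)
  show "x + (x + y) = y" by (simp add: * flip: add.assoc)
  show m: "- x = x" for x :: 'a using *[of x] by (metis minus_unique)
  show "x - y = x + y" using m[of y] by (metis diff_conv_add_uminus)
qed

text \<open>
  \<open>f j\<close> describes the spread of \<open>F\<close> that consists of \<open>K\<close> and of the lines \<open>ell u (f j u)\<close> defined below, for
  \<open>u \<in> K\<close>; \<open>f_spread\<close> says that these lines are disjoint. In \<open>uniform\<close> the element \<open>\<rho>\<close> is the invariant of the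
  orbit of \<open>ell u (f j u)\<close> under multiplication by \<open>F - {0}\<close>, so that each orbit is required to contain at least
  \<open>q\<^sup>2\<close> of the \<open>q\<^sup>3\<close> lines for \<open>j < q\<close>.
\<close>
locale char2_design = frobenius_field q ty for q :: nat and ty :: "'b::alg_closed_field itself" +
  fixes \<beta> :: 'b and f :: "nat \<Rightarrow> 'b \<Rightarrow> 'b"
  assumes two: "(1::'b) + 1 = 0" and \<beta>: "\<sigma> (\<sigma> \<beta>) = \<beta> + 1"
    and fK: "j < q \<Longrightarrow> u \<in> K \<Longrightarrow> f j u \<in> K" and f0: "j < q \<Longrightarrow> u \<in> K \<Longrightarrow> f j u \<noteq> 0"
    and f_spread: "j < q \<Longrightarrow> u \<in> K \<Longrightarrow> u' \<in> K \<Longrightarrow> u \<noteq> u' \<Longrightarrow>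
      (u - u') * \<sigma> (u - u') \<noteq> (f j u - f j u') * \<sigma> (f j u - f j u')"
    and uniform: "\<rho> \<in> Fq \<Longrightarrow> q\<^sup>2 \<le> card {(j, u). j < q \<and> u \<in> K \<and>
      (u\<^sup>2 + u + \<beta>\<^sup>2 + \<beta>) * \<sigma> (u\<^sup>2 + u + \<beta>\<^sup>2 + \<beta>) + (f j u * \<sigma> (f j u))\<^sup>2 + (f j u * \<sigma> (f j u)) * (u + \<sigma> u)
        = \<rho> * (f j u * \<sigma> (f j u))}"
begin

lemmas char2 = char_two[OF two]
lemmas add_self = char2(1)
lemmas add_self_left = char2(2)

lemma \<beta>_F: "\<beta> \<in> F" by (simp add: F_def \<beta> add_self add.assoc)
lemma \<beta>_K: "\<beta> \<notin> K" by (simp add: K_def \<beta>)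

text \<open>
  The graph of \<open>x \<mapsto> u x + v x\<^sup>q\<close> with respect to the decomposition \<open>F = \<beta> K \<oplus> K\<close>; its intersection with \<open>K\<close>
  is zero.
\<close>
definition ell :: "'b \<Rightarrow> 'b \<Rightarrow> 'b set" where "ell u v = (\<lambda>x. \<beta> * x + u * x + v * \<sigma> x) ` K"

lemma ell_coord:
  assumes "u \<in> K" "v \<in> K" "u' \<in> K" "v' \<in> K" "x \<in> K" "x' \<in> K" "\<beta> * x + u * x + v * \<sigma> x = \<beta> * x' + u' * x' + v' * \<sigma> x'"
  shows "x = x'"
proof (rule ccontr)
  assume "x \<noteq> x'"
  moreover have "\<beta> * (x - x') = u' * x' + v' * \<sigma> x' - (u * x + v * \<sigma> x)" using assms(7) by (simp add: algebra_simps)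
  ultimately have "\<beta> = (u' * x' + v' * \<sigma> x' - (u * x + v * \<sigma> x)) / (x - x')" by (simp add: field_simps)
  also have "\<dots> \<in> K" using assms by simp
  finally show False using \<beta>_K by simp
qed

text \<open>
  A common point with parameter \<open>x\<close> satisfies \<open>(u - u') x = (v' - v) x\<^sup>q\<close>; take norms from \<open>K\<close> to \<open>Fq\<close>.
\<close>
lemma ell_disjoint:
  assumes "u \<in> K" "v \<in> K" "u' \<in> K" "v' \<in> K" "y \<in> ell u v" "y \<in> ell u' v'" "y \<noteq> 0"
  shows "(u - u') * \<sigma> (u - u') = (v - v') * \<sigma> (v - v')"
proof -
  obtain x where x: "x \<in> K" "y = \<beta> * x + u * x + v * \<sigma> x" using assms by (auto simp: ell_def)
  obtain x' where x': "x' \<in> K" "y = \<beta> * x' + u' * x' + v' * \<sigma> x'" using assms by (auto simp: ell_def)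
  have "x = x'" by (rule ell_coord[of u v u' v']) (use assms x x' in auto)
  with x x' have "(u - u') * x = (v' - v) * \<sigma> x" by (simp add: algebra_simps)
  then have "((u - u') * x) * \<sigma> ((u - u') * x) = ((v' - v) * \<sigma> x) * \<sigma> ((v' - v) * \<sigma> x)" by simp
  then have "(x * \<sigma> x) * ((u - u') * \<sigma> (u - u')) = (x * \<sigma> x) * ((v - v') * \<sigma> (v - v'))"
    using x by (simp add: sig_K algebra_simps)
  moreover have "x \<noteq> 0" using x assms by auto
  ultimately show ?thesis by (metis mult_cancel_left no_zero_divisors sig_eq_0)
qed

lemma ell_scale: assumes "r \<in> Fq" "r \<noteq> 0" shows "(\<lambda>y. r * y) ` ell u v = ell u v"
proof -
  have *: "(\<lambda>y. r * y) ` ell u v \<subseteq> ell u v" if "r \<in> Fq" for r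
  proof
    fix y assume "y \<in> (\<lambda>y. r * y) ` ell u v"
    then obtain x where x: "x \<in> K" "y = r * (\<beta> * x + u * x + v * \<sigma> x)" by (auto simp: ell_def)
    then have "y = \<beta> * (r * x) + u * (r * x) + v * \<sigma> (r * x)" using that by (simp add: sig_Fq algebra_simps)
    then show "y \<in> ell u v" unfolding ell_def using x(1) that by (intro image_eqI[of _ _ "r * x"]) auto
  qed
  have "ell u v \<subseteq> (\<lambda>y. r * y) ` ell u v"
  proof
    fix y assume "y \<in> ell u v"
    then have "inverse r * y \<in> ell u v" using *[of "inverse r"] assms by auto
    moreover have "y = r * (inverse r * y)" using assms by simp
    ultimately show "y \<in> (\<lambda>y. r * y) ` ell u v" by blast
  qed
  with *[OF assms(1)] show ?thesis by blast
qed

abbreviation scaled :: "'b \<Rightarrow> 'b \<Rightarrow> 'b \<Rightarrow> 'b set" where "scaled \<gamma> u v \<equiv> (\<lambda>y. \<gamma> * y) ` ell u v"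

lemma scaled_scale: assumes "r \<in> Fq" "r \<noteq> 0" shows "scaled (r * \<gamma>) u v = scaled \<gamma> u v"
proof -
  have "scaled (r * \<gamma>) u v = (\<lambda>y. \<gamma> * y) ` (\<lambda>y. r * y) ` ell u v" by (simp add: image_image mult_ac)
  then show ?thesis using ell_scale[OF assms] by simp
qed

lemma card_ell: assumes "u \<in> K" "v \<in> K" shows "card (ell u v) = q\<^sup>2"
  unfolding ell_def by (subst card_image) (use assms ell_coord[of u v u v] card_K in \<open>auto intro!: inj_onI\<close>)

text \<open>
  An element of \<open>K\<close> with \<open>\<sigma> j0 = j0 + 1\<close>; it shifts the invariant of an orbit into \<open>Fq\<close>.
\<close>
definition j0 :: 'b where "j0 = \<beta> + \<sigma> \<beta> + 1"
lemma j0: "\<sigma> j0 = j0 + 1" "j0 \<in> K" by (simp_all add: j0_def K_def \<beta> ac_simps char2)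

lemma norm_m:
  assumes "u \<in> K" "v \<in> K"
  defines "w \<equiv> \<beta> + u" and "n \<equiv> v * \<sigma> v"
  defines "m0 \<equiv> w * \<sigma> w + n"
  shows "m0 * \<sigma> (\<sigma> m0) = (u\<^sup>2 + u + \<beta>\<^sup>2 + \<beta>) * \<sigma> (u\<^sup>2 + u + \<beta>\<^sup>2 + \<beta>) + n\<^sup>2 + n * (u + \<sigma> u) + n * j0"
proof -
  have s: "\<sigma> (\<sigma> w) = w + 1" using assms by (simp add: w_def \<beta> sig_K)
  have s3: "\<sigma> (\<sigma> (\<sigma> w)) = \<sigma> w + 1" using s by simp
  have n: "\<sigma> (\<sigma> n) = n" using assms by (simp add: n_def sig_K)
  have 1: "u\<^sup>2 + u + \<beta>\<^sup>2 + \<beta> = w * (w + 1)" unfolding w_def power2_eq_square by (simp add: algebra_simps char2)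
  have 2: "u + \<sigma> u + j0 = w + \<sigma> w + 1" unfolding w_def j0_def by (simp add: algebra_simps)
  have "m0 * \<sigma> (\<sigma> m0) = (w * \<sigma> w + n) * ((w + 1) * (\<sigma> w + 1) + n)" unfolding m0_def by (simp add: s s3 n)
  also have "\<dots> = (w * (w + 1)) * (\<sigma> w * (\<sigma> w + 1)) + n\<^sup>2 + n * (w + \<sigma> w + 1) + (n * w * \<sigma> w + n * w * \<sigma> w)"
    by (simp add: algebra_simps power2_eq_square)
  also have "\<dots> = (w * (w + 1)) * \<sigma> (w * (w + 1)) + n\<^sup>2 + n * (u + \<sigma> u + j0)" by (simp add: add_self 2)
  finally show ?thesis unfolding 1 by (simp only: distrib_left add.assoc)
qed

text \<open>
  A line is the set of roots of a polynomial \<open>A x\<^bsup>q*q\<^esup> + B x\<^sup>q + C x\<close>; these are the coefficients for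
  \<open>ell u v\<close>, from which its orbit will be read off.
\<close>
lemma ell_root:
  assumes "u \<in> K" "v \<in> K" "y \<in> ell u v"
  defines "m0 \<equiv> (\<beta> + u) * \<sigma> (\<beta> + u) + v * \<sigma> v"
  shows "m0 * \<sigma> (\<sigma> y) + v * \<sigma> y + \<sigma> m0 * y = 0"
proof -
  define w where "w = \<beta> + u"
  have s: "\<sigma> (\<sigma> w) = w + 1" using assms by (simp add: w_def \<beta> sig_K)
  obtain x where x: "x \<in> K" "y = w * x + v * \<sigma> x" using assms by (auto simp: ell_def w_def algebra_simps)
  have m: "m0 = w * \<sigma> w + v * \<sigma> v" by (simp add: m0_def w_def)
  show ?thesis unfolding m x(2)
    by (simp add: s sig_K[OF x(1)] sig_K[OF assms(2)] algebra_simps char2)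
qed

lemma obtain_sqrt: obtains \<delta> where "\<delta>\<^sup>2 = (x::'b)" using nth_root_exists[of 2 x] by auto

text \<open>
  For a line spanned by \<open>a\<close> and \<open>b\<close> the polynomial has the coefficients \<open>M = a b\<^sup>q + a\<^sup>q b\<close>, \<open>N = a b\<^bsup>q*q\<^esup> + a\<^bsup>q*q\<^esup> b\<close>
  and \<open>M\<^sup>q\<close>. Multiplying the line by \<open>\<gamma>\<close> multiplies \<open>M\<close> by \<open>\<gamma> \<sigma> \<gamma>\<close> and \<open>N\<close> by \<open>\<gamma> \<sigma> (\<sigma> \<gamma>)\<close>, and a change of
  basis multiplies both by the same element of \<open>Fq\<close>. So
  the quotient of \<open>L = M \<sigma> (\<sigma> M)\<close> by \<open>k = N \<sigma> N\<close> is constant on orbits. The relation \<open>L + \<sigma> L = k\<close> shows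
  that \<open>\<rho> = L / k + j0\<close> lies in \<open>Fq\<close>. Conversely, if \<open>ell u v\<close> has the same \<open>\<rho>\<close>, which by \<open>norm_m\<close> is the displayed
  equation, then a \<open>\<gamma>\<close> with the required effect on both \<open>M\<close> and \<open>N\<close> exists: a solution \<open>g\<close> of the
  condition on \<open>M\<close> is unique up to a factor in \<open>\<mu>\<close>, and \<open>\<delta>\<^sup>2\<close> runs through all of \<open>\<mu>\<close> as \<open>\<delta>\<close> does, because \<open>q + 1\<close>
  is odd.
\<close>
lemma orbit:
  assumes m: "m \<in> sf.oblique F"
  shows "\<exists>\<rho>\<in>Fq. \<forall>u\<in>K. \<forall>v\<in>K. v \<noteq> 0 \<and> (u\<^sup>2 + u + \<beta>\<^sup>2 + \<beta>) * \<sigma> (u\<^sup>2 + u + \<beta>\<^sup>2 + \<beta>) + (v * \<sigma> v)\<^sup>2 + (v * \<sigma> v) * (u + \<sigma> u)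
        = \<rho> * (v * \<sigma> v) \<longrightarrow> (\<exists>\<gamma>\<in>F. \<gamma> \<noteq> 0 \<and> m = scaled \<gamma> u v)"
proof -
  obtain \<psi> where \<psi>: "sf.embedding \<psi>" "m = \<psi> ` K" and mF: "m \<subseteq> F"
    using m by (auto simp: sf.oblique_def sf.line_def)
  obtain \<omega> where w: "\<omega> \<in> K" "\<omega> \<notin> Fq" by (rule obtain_\<omega>)
  define a where "a = \<psi> 1"
  define b where "b = \<psi> \<omega>"
  have ab: "a \<in> F" "b \<in> F" using mF w by (auto simp: a_def b_def \<psi>)
  have a0: "a \<noteq> 0" using sf.embedding_0_iff[OF \<psi>(1), of 1] by (simp add: a_def)
  have "b \<notin> sf.Kline a" using sf.oblique_indep[OF \<psi>(1) _ w] m \<psi>(2) by (simp add: a_def b_def)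
  then have ba: "b / a \<notin> K" using a0 by (auto simp: sf.Kline_def image_iff)
  define M where "M = a * \<sigma> b + \<sigma> a * b"
  define N where "N = a * \<sigma> (\<sigma> b) + \<sigma> (\<sigma> a) * b"
  have MF: "M \<in> F" "N \<in> F" using ab by (auto simp: M_def N_def)
  have M0: "M \<noteq> 0"
  proof
    assume "M = 0"
    then have "a * \<sigma> b = \<sigma> a * b" unfolding M_def by (metis add_self add_right_cancel)
    then have "\<sigma> (b / a) = b / a" using a0 by (simp add: field_simps)
    then show False using ba by (simp add: K_def)
  qed
  have N0: "N \<noteq> 0"
  proof
    assume "N = 0"
    then have "a * \<sigma> (\<sigma> b) = \<sigma> (\<sigma> a) * b" unfolding N_def by (metis add_self add_right_cancel)
    then have "\<sigma> (\<sigma> (b / a)) = b / a" using a0 by (simp add: field_simps)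
    then show False using ba by (simp add: K_def)
  qed
  define R where "R = {x. M * \<sigma> (\<sigma> x) + N * \<sigma> x + \<sigma> M * x = 0}"
  have R: "finite R" "card R \<le> q\<^sup>2"
  proof -
    define p where "p = monom M (q\<^sup>2) + monom N q + monom (\<sigma> M) 1"
    have R_eq: "R = {x. poly p x = 0}" unfolding R_def p_def sig2 by (simp add: poly_monom \<sigma>_def)
    have "q < q\<^sup>2" using q3 by (simp add: power2_eq_square)
    with q3 have qq: "q < q\<^sup>2" "1 < q\<^sup>2" by linarith+
    then have "coeff p (q\<^sup>2) = M" by (simp add: p_def)
    then have p0: "p \<noteq> 0" using M0 by auto
    have "degree p \<le> q\<^sup>2" unfolding p_def using qq
      by (intro degree_add_le) (auto intro: order_trans[OF degree_monom_le])
    with p0 show "finite R" "card R \<le> q\<^sup>2" unfolding R_eq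
      using poly_roots_finite[OF p0] card_poly_roots_bound[OF p0] by auto
  qed
  have "m \<subseteq> R"
  proof
    fix x assume "x \<in> m"
    then obtain z where z: "z \<in> K" "x = \<psi> z" using \<psi> by auto
    obtain r s where rs: "r \<in> Fq" "s \<in> Fq" "z = r + s * \<omega>" using K_basis[OF w z(1)] by auto
    have x: "x = r * a + s * b"
      using rs z w sf.embedding_add[OF \<psi>(1), of r "s * \<omega>"] sf.embedding_scale[OF \<psi>(1), of r 1]
        sf.embedding_scale[OF \<psi>(1), of s \<omega>] by (simp add: a_def b_def)
    show "x \<in> R" unfolding R_def mem_Collect_eq x M_def N_def using rs
      by (simp add: sig_Fq algebra_simps char2)
  qed
  then have mR: "m = R" using R sf.line_card[of m] m by (intro card_seteq) (auto simp: sf.oblique_def)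
  define k where "k = N * \<sigma> N"
  define L where "L = M * \<sigma> (\<sigma> M)"
  have Lk: "L + \<sigma> L = k"
    using ab unfolding L_def k_def M_def N_def by (simp add: sig_F algebra_simps char2)
  have LK: "L \<in> K" using MF by (simp add: L_def K_def sig_F)
  have "\<sigma> (\<sigma> N) = N" using ab by (simp add: N_def sig_F algebra_simps)
  then have kF: "k \<in> Fq" by (simp add: k_def Fq_def)
  have k0: "k \<noteq> 0" using N0 by (simp add: k_def)
  define \<rho> where "\<rho> = (L + k * j0) / k"
  have sL: "\<sigma> L = L + k" using Lk by (metis add_self_left)
  have \<rho>: "\<rho> \<in> Fq" using kF sL by (simp add: \<rho>_def Fq_def j0 algebra_simps char2)
  have L: "L = k * (\<rho> + j0)" using k0 by (simp add: \<rho>_def field_simps char2)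
  show ?thesis
  proof (intro bexI[OF _ \<rho>] ballI impI, elim conjE)
    fix u v assume uv: "u \<in> K" "v \<in> K" "v \<noteq> 0"
      and eq: "(u\<^sup>2 + u + \<beta>\<^sup>2 + \<beta>) * \<sigma> (u\<^sup>2 + u + \<beta>\<^sup>2 + \<beta>) + (v * \<sigma> v)\<^sup>2 + (v * \<sigma> v) * (u + \<sigma> u) = \<rho> * (v * \<sigma> v)"
    define n where "n = v * \<sigma> v"
    have n: "n \<in> Fq" "n \<noteq> 0" using uv by (auto simp: n_def Fq_def sig_K)
    define m0 where "m0 = (\<beta> + u) * \<sigma> (\<beta> + u) + v * \<sigma> v"
    have "m0 * \<sigma> (\<sigma> m0) = n * (\<rho> + j0)"
      unfolding m0_def norm_m[OF uv(1,2)] eq by (simp add: n_def algebra_simps)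
    define c where "c = k / n"
    have c: "c \<in> Fq" "c \<noteq> 0" using kF k0 n by (auto simp: c_def)
    have Lm: "L = c * (m0 * \<sigma> (\<sigma> m0))" unfolding \<open>m0 * \<sigma> (\<sigma> m0) = _\<close> L using n by (simp add: c_def)
    have m00: "m0 \<noteq> 0" using Lm M0 by (auto simp: L_def)
    have m0F: "m0 \<in> F" using uv \<beta>_F unfolding m0_def by (intro F_closed) auto
    obtain g where g: "g * \<sigma> g = M / m0"
      using nth_root_exists[of "q + 1" "M / m0"] by (auto simp: \<sigma>_def)
    have g0: "g \<noteq> 0" using g M0 m00 by auto
    have "(g * \<sigma> g) * \<sigma> (\<sigma> (g * \<sigma> g)) = c"
      unfolding g using Lm m00 by (simp add: L_def field_simps)
    then have gc: "g * \<sigma> g * \<sigma> (\<sigma> g) * \<sigma> (\<sigma> (\<sigma> g)) = c" by (simp add: mult.assoc)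
    then have "\<sigma> (g * \<sigma> g * \<sigma> (\<sigma> g) * \<sigma> (\<sigma> (\<sigma> g))) = g * \<sigma> g * \<sigma> (\<sigma> g) * \<sigma> (\<sigma> (\<sigma> g))" using c by (simp add: sig_Fq)
    then have "(\<sigma> g * \<sigma> (\<sigma> g) * \<sigma> (\<sigma> (\<sigma> g))) * \<sigma> (\<sigma> (\<sigma> (\<sigma> g))) = (\<sigma> g * \<sigma> (\<sigma> g) * \<sigma> (\<sigma> (\<sigma> g))) * g"
      by (simp add: mult_ac)
    then have gF: "g \<in> F" using g0 by (simp add: F_def)
    (* The factor by which \<open>g\<close> misses the condition on \<open>N\<close>; it has norm one. *)
    define \<epsilon> where "\<epsilon> = N / (g * \<sigma> (\<sigma> g) * v)"
    have "(g * \<sigma> (\<sigma> g) * v) * \<sigma> (g * \<sigma> (\<sigma> g) * v) = c * n" using gc by (simp add: n_def mult_ac)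
    then have "\<epsilon> * \<sigma> \<epsilon> = k / (c * n)" by (simp add: \<epsilon>_def k_def del: sig_mult)
    then have \<epsilon>: "\<epsilon> * \<sigma> \<epsilon> = 1" using n k0 by (simp add: c_def)
    obtain \<delta> where \<delta>: "\<delta>\<^sup>2 = \<epsilon>" by (rule obtain_sqrt)
    have "(\<delta> * \<sigma> \<delta> + 1) * (\<delta> * \<sigma> \<delta> + 1) = 0"
      using \<epsilon> unfolding \<delta>[symmetric] by (simp add: algebra_simps power2_eq_square char2)
    then have "\<delta> * \<sigma> \<delta> = 1" by (metis add_self add_right_cancel mult_eq_0_iff)
    then have \<delta>\<mu>: "\<delta> \<in> \<mu>" by (simp add: \<mu>_def)
    then have \<delta>K: "\<delta> \<in> K" "\<delta> \<noteq> 0" using \<mu>_nonzero by auto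
    define \<gamma> where "\<gamma> = g * \<delta>"
    have \<gamma>: "\<gamma> \<in> F" "\<gamma> \<noteq> 0" using gF g0 \<delta>K by (auto simp: \<gamma>_def)
    have "\<gamma> * \<sigma> \<gamma> = (g * \<sigma> g) * (\<delta> * \<sigma> \<delta>)" by (simp add: \<gamma>_def mult_ac)
    then have 1: "M = m0 * (\<gamma> * \<sigma> \<gamma>)" using g m00 \<delta>\<mu> by (simp add: \<mu>_def)
    have "\<gamma> * \<sigma> (\<sigma> \<gamma>) = (g * \<sigma> (\<sigma> g)) * \<delta>\<^sup>2" using \<delta>K by (simp add: \<gamma>_def sig_K power2_eq_square mult_ac)
    then have 2: "N = v * (\<gamma> * \<sigma> (\<sigma> \<gamma>))" using uv g0 by (simp add: \<delta> \<epsilon>_def)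
    have "scaled \<gamma> u v \<subseteq> R"
    proof
      fix x assume "x \<in> scaled \<gamma> u v"
      then obtain y where y: "y \<in> ell u v" "x = \<gamma> * y" by auto
      have "M * \<sigma> (\<sigma> x) + N * \<sigma> x + \<sigma> M * x = \<gamma> * \<sigma> \<gamma> * \<sigma> (\<sigma> \<gamma>) * (m0 * \<sigma> (\<sigma> y) + v * \<sigma> y + \<sigma> m0 * y)"
        unfolding 1 2 y(2) by (simp add: algebra_simps)
      also have "\<dots> = 0" using ell_root[OF uv(1,2) y(1)] unfolding m0_def by simp
      finally show "x \<in> R" by (simp add: R_def)
    qed
    moreover have "card (scaled \<gamma> u v) = q\<^sup>2"
      by (subst card_image) (use \<gamma> card_ell[OF uv(1,2)] in \<open>auto intro!: inj_onI\<close>)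
    ultimately have "scaled \<gamma> u v = R" using R by (intro card_seteq) auto
    then show "\<exists>\<gamma>\<in>F. \<gamma> \<noteq> 0 \<and> m = scaled \<gamma> u v" using \<gamma> mR by auto
  qed
qed

text \<open>
  Take all multiples \<open>\<gamma> ell u (f j u)\<close> of the \<open>q\<close> spreads, with \<open>\<gamma>\<close> up to \<open>Fq\<close>. The \<open>K\<close>-line of such a multiple is
  \<open>\<gamma> K\<close>, hence each one occurs for \<open>q + 1\<close> points \<open>\<gamma>\<close> and \<open>q\<close> values of \<open>j\<close>. An oblique line \<open>m\<close> is a multiple
  of each of the at least \<open>q\<^sup>2\<close> lines \<open>ell u (f j u)\<close> in its orbit; different \<open>(j, u)\<close> give different spreads,
  because \<open>m\<close> has only one preimage in a spread.
\<close>
lemma plane_design_exists: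
  "\<exists>\<Gamma> \<tau> S. plane_design (\<Gamma> :: ('b set \<times> nat) set) \<tau> S"
proof -
  define \<Gamma> where "\<Gamma> = pt ` (F - {0}) \<times> {..<q}"
  define rep where "rep p = (SOME \<gamma>. \<gamma> \<in> F - {0} \<and> pt \<gamma> = p)" for p
  define \<tau> where "\<tau> g = sf.Kline (rep (fst g))" for g :: "'b set \<times> nat"
  define S where "S g = {scaled (rep (fst g)) u (f (snd g) u) | u. u \<in> K}" for g :: "'b set \<times> nat"
  have rep: "rep p \<in> F" "rep p \<noteq> 0" "pt (rep p) = p" if "p \<in> pt ` (F - {0})" for p
  proof -
    have "rep p \<in> F - {0} \<and> pt (rep p) = p" unfolding rep_def by (rule someI_ex) (use that in auto)
    then show "rep p \<in> F" "rep p \<noteq> 0" "pt (rep p) = p" by auto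
  qed
  have rep_pt: "\<exists>r\<in>Fq. r \<noteq> 0 \<and> \<gamma> = r * rep (pt \<gamma>)" if "\<gamma> \<in> F" "\<gamma> \<noteq> 0" for \<gamma>
    using pt_eq[of "rep (pt \<gamma>)" \<gamma>] rep[of "pt \<gamma>"] that by blast
  have "plane_design \<Gamma> \<tau> S" unfolding plane_design_def
  proof (intro conjI ballI allI impI)
    show "finite \<Gamma>" by (simp add: \<Gamma>_def)
  next
    fix g assume "g \<in> \<Gamma>"
    then show "\<tau> g \<in> sf.Klines F" using rep by (auto simp: \<Gamma>_def \<tau>_def sf.Klines_def)
  next
    fix t
    have "{g \<in> \<Gamma>. \<tau> g = t} \<subseteq> pt ` {\<gamma> \<in> F - {0}. sf.Kline \<gamma> = t} \<times> {..<q}"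
    proof
      fix g assume "g \<in> {g \<in> \<Gamma>. \<tau> g = t}"
      moreover obtain p j where gp: "g = (p, j)" by (cases g)
      ultimately have g: "g = (p, j)" "p \<in> pt ` (F - {0})" "j < q" "sf.Kline (rep p) = t"
        by (auto simp: \<Gamma>_def \<tau>_def)
      then show "g \<in> pt ` {\<gamma> \<in> F - {0}. sf.Kline \<gamma> = t} \<times> {..<q}"
        using rep[OF g(2)] by (auto intro!: image_eqI[of _ _ "rep p"])
    qed
    then have "card {g \<in> \<Gamma>. \<tau> g = t} \<le> card (pt ` {\<gamma> \<in> F - {0}. sf.Kline \<gamma> = t} \<times> {..<q})"
      by (intro card_mono) auto
    also have "\<dots> \<le> (q + 1) * q" using card_points_Kline(2)[of t] by (simp add: card_cartesian_product del: mult_Suc)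
    finally show "card {g \<in> \<Gamma>. \<tau> g = t} \<le> (q + 1) * q" .
  next
    fix g m assume g: "g \<in> \<Gamma>" "m \<in> S g"
    show "\<not> sf.meets m (\<tau> g)"
    proof
      assume "sf.meets m (\<tau> g)"
      then obtain x where x: "x \<in> m" "x \<in> sf.Kline (rep (fst g))" "x \<noteq> 0" by (auto simp: sf.meets_def \<tau>_def)
      define \<gamma> where "\<gamma> = rep (fst g)"
      have \<gamma>: "\<gamma> \<noteq> 0" using rep g by (auto simp: \<Gamma>_def \<gamma>_def)
      obtain u where u: "u \<in> K" "m = scaled \<gamma> u (f (snd g) u)" using g by (auto simp: S_def \<gamma>_def)
      have fu: "f (snd g) u \<in> K" using fK u g by (auto simp: \<Gamma>_def)
      obtain z where z: "z \<in> K" "x = \<gamma> * (\<beta> * z + u * z + f (snd g) u * \<sigma> z)" using x u by (auto simp: ell_def)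
      obtain a where a: "a \<in> K" "x = a * \<gamma>" using x by (auto simp: sf.Kline_def \<gamma>_def)
      have "\<gamma> * (\<beta> * z + u * z + f (snd g) u * \<sigma> z) = \<gamma> * a" using z(2) a(2) by (simp only: mult.commute)
      then have "\<beta> * z + u * z + f (snd g) u * \<sigma> z = a" using \<gamma> by (metis mult_left_cancel)
      then have "\<beta> * z = a - u * z - f (snd g) u * \<sigma> z" by (simp add: algebra_simps)
      moreover have "z \<noteq> 0" using z x by auto
      ultimately have "\<beta> = (a - u * z - f (snd g) u * \<sigma> z) / z" by (simp add: field_simps)
      also have "\<dots> \<in> K" using a u z fu by simp
      finally show False using \<beta>_K by simp
    qed
  next
    fix g m m' assume g: "g \<in> \<Gamma>" "m \<in> S g" "m' \<in> S g" "sf.meets m m'"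
    define \<gamma> where "\<gamma> = rep (fst g)"
    have \<gamma>: "\<gamma> \<noteq> 0" using rep g by (auto simp: \<Gamma>_def \<gamma>_def)
    have j: "snd g < q" using g by (auto simp: \<Gamma>_def)
    obtain u where u: "u \<in> K" "m = scaled \<gamma> u (f (snd g) u)" using g by (auto simp: S_def \<gamma>_def)
    obtain u' where u': "u' \<in> K" "m' = scaled \<gamma> u' (f (snd g) u')" using g by (auto simp: S_def \<gamma>_def)
    obtain y where y: "y \<in> ell u (f (snd g) u)" "y \<in> ell u' (f (snd g) u')" "y \<noteq> 0"
      using g(4) u u' \<gamma> by (auto simp: sf.meets_def)
    have "u = u'" using ell_disjoint[OF u(1) fK[OF j u(1)] u'(1) fK[OF j u'(1)] y] f_spread[OF j u(1) u'(1)] by blast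
    with u u' show "m = m'" by simp
  next
    fix m assume m: "m \<in> sf.oblique F"
    obtain \<rho> where \<rho>: "\<rho> \<in> Fq" and orb: "\<And>u v. u \<in> K \<Longrightarrow> v \<in> K \<Longrightarrow> v \<noteq> 0 \<Longrightarrow>
       (u\<^sup>2 + u + \<beta>\<^sup>2 + \<beta>) * \<sigma> (u\<^sup>2 + u + \<beta>\<^sup>2 + \<beta>) + (v * \<sigma> v)\<^sup>2 + (v * \<sigma> v) * (u + \<sigma> u) = \<rho> * (v * \<sigma> v) \<Longrightarrow>
       \<exists>\<gamma>\<in>F. \<gamma> \<noteq> 0 \<and> m = scaled \<gamma> u v"
      using orbit[OF m] by blast
    define Sol where "Sol = {(j, u). j < q \<and> u \<in> K \<and>
      (u\<^sup>2 + u + \<beta>\<^sup>2 + \<beta>) * \<sigma> (u\<^sup>2 + u + \<beta>\<^sup>2 + \<beta>) + (f j u * \<sigma> (f j u))\<^sup>2 + (f j u * \<sigma> (f j u)) * (u + \<sigma> u)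
        = \<rho> * (f j u * \<sigma> (f j u))}"
    define G where "G p = (SOME \<gamma>. \<gamma> \<in> F \<and> \<gamma> \<noteq> 0 \<and> m = scaled \<gamma> (snd p) (f (fst p) (snd p)))" for p
    have G: "G p \<in> F" "G p \<noteq> 0" "m = scaled (G p) (snd p) (f (fst p) (snd p))" if "p \<in> Sol" for p
    proof -
      have "\<exists>\<gamma>. \<gamma> \<in> F \<and> \<gamma> \<noteq> 0 \<and> m = scaled \<gamma> (snd p) (f (fst p) (snd p))"
        using orb[of "snd p" "f (fst p) (snd p)"] that fK f0 unfolding Sol_def by auto
      from someI_ex[OF this] show "G p \<in> F" "G p \<noteq> 0" "m = scaled (G p) (snd p) (f (fst p) (snd p))"
        unfolding G_def by auto
    qed
    define H where "H p = (pt (G p), fst p)" for p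
    have Gr: "m = scaled (rep (pt (G p))) (snd p) (f (fst p) (snd p))" if "p \<in> Sol" for p
      using rep_pt[OF G(1,2)[OF that]] G(3)[OF that] scaled_scale by metis
    have "inj_on H Sol"
    proof (rule inj_onI)
      fix p p' assume p: "p \<in> Sol" "p' \<in> Sol" "H p = H p'"
      define \<gamma> where "\<gamma> = rep (pt (G p))"
      have \<gamma>0: "\<gamma> \<noteq> 0" using rep G(1,2)[OF p(1)] by (auto simp: \<gamma>_def)
      have j: "fst p = fst p'" "fst p < q" "snd p \<in> K" "snd p' \<in> K" using p by (auto simp: H_def Sol_def)
      have "m = scaled \<gamma> (snd p) (f (fst p) (snd p))" "m = scaled \<gamma> (snd p') (f (fst p) (snd p'))"
        using Gr[OF p(1)] Gr[OF p(2)] p(3) by (auto simp: \<gamma>_def H_def)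
      then have *: "scaled \<gamma> (snd p) (f (fst p) (snd p)) = scaled \<gamma> (snd p') (f (fst p) (snd p'))" by simp
      define y where "y = \<beta> * 1 + snd p * 1 + f (fst p) (snd p) * \<sigma> 1"
      have y1: "y \<in> ell (snd p) (f (fst p) (snd p))" unfolding ell_def y_def by (rule image_eqI[OF refl]) simp
      have "inj (\<lambda>y. \<gamma> * y)" using \<gamma>0 by (auto intro!: injI)
      then have "ell (snd p) (f (fst p) (snd p)) = ell (snd p') (f (fst p) (snd p'))" using * inj_image_eq_iff by blast
      then have y2: "y \<in> ell (snd p') (f (fst p) (snd p'))" using y1 by simp
      have "y \<noteq> 0"
      proof
        assume "y = 0"
        then have "\<beta> = - (snd p + f (fst p) (snd p))" by (simp add: y_def algebra_simps eq_neg_iff_add_eq_0)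
        also have "\<dots> \<in> K" using j fK by simp
        finally show False using \<beta>_K by simp
      qed
      then have "snd p = snd p'"
        using ell_disjoint[OF j(3) fK[OF j(2,3)] j(4) fK[OF j(2,4)] y1 y2] f_spread[OF j(2-4)] by blast
      then show "p = p'" using j by (simp add: prod_eq_iff)
    qed
    moreover have "H ` Sol \<subseteq> {g \<in> \<Gamma>. m \<in> S g}"
    proof
      fix g assume "g \<in> H ` Sol"
      then obtain p where p: "p \<in> Sol" "g = H p" by auto
      have "g \<in> \<Gamma>" using G(1,2)[OF p(1)] p by (auto simp: \<Gamma>_def H_def Sol_def)
      moreover have "m \<in> S g" using Gr[OF p(1)] p by (auto simp: S_def H_def Sol_def)
      ultimately show "g \<in> {g \<in> \<Gamma>. m \<in> S g}" by simp
    qed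
    moreover have "finite \<Gamma>" by (simp add: \<Gamma>_def)
    ultimately have "card Sol \<le> card {g \<in> \<Gamma>. m \<in> S g}" by (intro card_inj_on_le) auto
    then show "q\<^sup>2 \<le> card {g \<in> \<Gamma>. m \<in> S g}" using uniform[OF \<rho>] by (simp add: Sol_def)
  qed
  then show ?thesis by blast
qed

end

section \<open>Arithmetic in binary fields\<close>
text \<open>
  Elements of \<open>GF(2\<^sup>e)\<close> as lists of \<open>e\<close> bits, the coefficients of the powers of an element \<open>a\<close> with lowest degree
  first; \<open>red\<close> is the list for \<open>a\<^sup>e\<close>. Multiplication by \<open>a\<close> is \<open>gx\<close>. The list argument \<open>i\<close> of \<open>gfrob\<close>, \<open>gtrace\<close> and
  \<open>gpows\<close> is a unary counter, which makes symbolic evaluation cheap: with \<open>k = length i\<close> they compute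
  the power of \<open>y\<close> with exponent \<open>2\<^sup>k\<close>, the sum of \<open>k\<close> conjugates of \<open>y\<close>, and the power with exponent \<open>2\<^sup>k\<^sup>+\<^sup>1 - 1\<close>. Hence
  \<open>ginv\<close> is the power with exponent \<open>2\<^sup>e - 2\<close>.
\<close>
definition gadd :: "bool list \<Rightarrow> bool list \<Rightarrow> bool list" where "gadd xs ys = map2 (\<noteq>) xs ys"
definition gzero :: "bool list \<Rightarrow> bool list" where "gzero red = map (\<lambda>_. False) red"
definition gone :: "bool list \<Rightarrow> bool list" where "gone red = True # map (\<lambda>_. False) (tl red)"
definition gx :: "bool list \<Rightarrow> bool list \<Rightarrow> bool list" where
  "gx red ys = (if last ys then gadd (False # butlast ys) red else False # butlast ys)"
fun gmul :: "bool list \<Rightarrow> bool list \<Rightarrow> bool list \<Rightarrow> bool list" where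
  "gmul red [] ys = gzero red"
| "gmul red (x # xs) ys = (if x then gadd ys (gx red (gmul red xs ys)) else gx red (gmul red xs ys))"
fun gfrob :: "bool list \<Rightarrow> bool list \<Rightarrow> bool list \<Rightarrow> bool list" where
  "gfrob red [] y = y" | "gfrob red (_ # i) y = gfrob red i (gmul red y y)"
fun gtrace :: "bool list \<Rightarrow> bool list \<Rightarrow> bool list \<Rightarrow> bool list" where
  "gtrace red [] y = gzero red" | "gtrace red (_ # i) y = gadd y (gtrace red i (gmul red y y))"
fun gpows :: "bool list \<Rightarrow> bool list \<Rightarrow> bool list \<Rightarrow> bool list" where
  "gpows red [] y = y" | "gpows red (_ # i) y = gmul red y (gpows red i (gmul red y y))"
definition ginv :: "bool list \<Rightarrow> bool list \<Rightarrow> bool list" where "ginv red y = gpows red (tl (tl red)) (gmul red y y)"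

text \<open>
  A pair \<open>(x, y)\<close> stands for \<open>x + y \<omega>\<close> in \<open>GF(q\<^sup>2)\<close>, where \<open>\<omega>\<^sup>2 + \<omega> = k\<close>; so \<open>y\<close> is also the trace of the pair.
  The auxiliary \<open>kcomb\<close> names intermediate results that would otherwise be evaluated repeatedly.
\<close>
type_synonym kel = "bool list \<times> bool list"
fun kadd :: "kel \<Rightarrow> kel \<Rightarrow> kel" where "kadd (x, y) (x', y') = (gadd x x', gadd y y')"
definition kcomb :: "bool list \<Rightarrow> bool list \<Rightarrow> bool list \<Rightarrow> bool list \<Rightarrow> bool list \<Rightarrow> kel" where
  "kcomb red k m0 m1 p = (gadd m0 (gmul red k p), gadd m1 p)"
fun kmul :: "bool list \<Rightarrow> bool list \<Rightarrow> kel \<Rightarrow> kel \<Rightarrow> kel" where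
  "kmul red k (x, y) (x', y') =
     kcomb red k (gmul red x x') (gadd (gmul red x y') (gmul red y x')) (gmul red y y')"
fun knorm :: "bool list \<Rightarrow> bool list \<Rightarrow> kel \<Rightarrow> bool list" where
  "knorm red k (x, y) = gadd (gadd (gmul red x x) (gmul red x y)) (gmul red k (gmul red y y))"
fun ksc :: "bool list \<Rightarrow> bool list \<Rightarrow> kel \<Rightarrow> kel" where "ksc red s (x, y) = (gmul red s x, gmul red s y)"

text \<open>
  The parameters \<open>(c, b, v)\<close> give the function \<open>u \<mapsto> v + b Tr(c u)\<close>. \<open>kval\<close> is the invariant of \<open>ell u (f u)\<close> for this
  function, computed as \<open>A / n + n + Tr u\<close> with the norms \<open>n\<close> of \<open>f u\<close> and \<open>A\<close> of \<open>u\<^sup>2 + u + \<beta>\<^sup>2 + \<beta>\<close>, where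
  \<open>\<beta>\<^sup>2 + \<beta> = k \<omega>\<close>. The result \<open>[]\<close> signals that \<open>n\<close> is not invertible.
\<close>
fun kfun :: "bool list \<Rightarrow> bool list \<Rightarrow> kel \<times> kel \<times> kel \<Rightarrow> kel \<Rightarrow> kel" where
  "kfun red k (c, b, v) u = kadd v (ksc red (snd (kmul red k c u)) b)"
definition kquot :: "bool list \<Rightarrow> bool list \<Rightarrow> bool list \<Rightarrow> bool list \<Rightarrow> bool list \<Rightarrow> bool list" where
  "kquot red n i s t = (if gmul red n i = gone red then gadd (gadd (gmul red s i) n) t else [])"
definition kquot' :: "bool list \<Rightarrow> bool list \<Rightarrow> bool list \<Rightarrow> bool list \<Rightarrow> bool list" where
  "kquot' red n s t = kquot red n (ginv red n) s t"
definition kval :: "bool list \<Rightarrow> bool list \<Rightarrow> kel \<times> kel \<times> kel \<Rightarrow> kel \<Rightarrow> bool list" where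
  "kval red k p u = kquot' red (knorm red k (kfun red k p u))
     (knorm red k (kadd (kadd (kmul red k u u) u) (gzero red, k))) (snd u)"

definition gels :: "bool list \<Rightarrow> bool list list" where "gels red = List.n_lists (length red) [False, True]"
definition kels :: "bool list \<Rightarrow> kel list" where "kels red = List.product (gels red) (gels red)"

fun kvals :: "bool list \<Rightarrow> bool list \<Rightarrow> kel \<times> kel \<times> kel \<Rightarrow> bool list list" where
  "kvals red k (c, b, v) = map (kval red k (c, b, v)) (kels red)"
lemma kvals: "kvals red k p = map (kval red k p) (kels red)" by (cases p) simp

text \<open>
  \<open>k\<close> has trace one, so \<open>\<omega>\<close> is not in \<open>GF(q)\<close>; \<open>a\<close> is in \<open>GF(q)\<close>; and \<open>red\<close> comes from an irreducible polynomial.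
\<close>
definition field_check :: "bool list \<Rightarrow> bool list \<Rightarrow> bool" where
  "field_check red k \<longleftrightarrow> gtrace red red k = gone red \<and> gfrob red red (gx red (gone red)) = gx red (gone red) \<and>
     list_all (\<lambda>x. x = gzero red \<or> gmul red x (ginv red x) = gone red) (gels red)"

text \<open>
  As \<open>u \<mapsto> v + b Tr(c u)\<close> is affine, the disjointness of its lines is a condition on the differences \<open>d\<close> of
  two arguments: the norm of \<open>d\<close> is not the norm of \<open>b Tr(c d)\<close>.
\<close>
definition gsquare :: "bool list \<Rightarrow> bool list \<Rightarrow> bool list" where "gsquare red t = gmul red t t"

fun spread_check :: "bool list \<Rightarrow> bool list \<Rightarrow> kel \<times> kel \<times> kel \<Rightarrow> bool" where
  "spread_check red k (c, b, v) =
     list_all (\<lambda>d. d = (gzero red, gzero red) \<or> knorm red k d \<noteq> gmul red (knorm red k b) (gsquare red (snd (kmul red k c d)))) (kels red)"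

definition counts_check :: "bool list list \<Rightarrow> bool list list \<Rightarrow> nat \<Rightarrow> bool" where
  "counts_check es R m = (list_all (\<lambda>x. x \<noteq> []) R \<and> list_all (\<lambda>\<rho>. m \<le> length (filter (\<lambda>x. x = \<rho>) R)) es)"

text \<open>
  The sums on the right are the field elements coded by \<open>red\<close> and \<open>k\<close>, which \<open>dec\<close> denotes below.
\<close>
locale binary_code = frobenius_field q ty for q :: nat and ty :: "'b::alg_closed_field itself" +
  fixes red k :: "bool list" and a \<omega> \<beta> :: 'b
  assumes two: "(1::'b) + 1 = 0" and qe: "q = 2 ^ length red" and len_k: "length k = length red"
    and root: "a ^ length red = foldr (\<lambda>x s. of_bool x + a * s) red 0"
    and \<omega>2: "\<omega>\<^sup>2 + \<omega> = foldr (\<lambda>x s. of_bool x + a * s) k 0"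
    and \<beta>2: "\<beta>\<^sup>2 + \<beta> = foldr (\<lambda>x s. of_bool x + a * s) k 0 * \<omega>"
    and check: "field_check red k"
begin

lemmas char2 = char_two[OF two]
lemmas add_self = char2(1)
lemmas add_self_left = char2(2)

abbreviation e :: nat where "e \<equiv> length red"

lemma e2: "e \<ge> 2"
proof (rule ccontr)
  assume "\<not> e \<ge> 2"
  then have "e = 0 \<or> e = 1" by linarith
  then have "q = 1 \<or> q = 2" using qe by (elim disjE) (simp_all only: power_0 power_one_right simp_thms)
  then show False using q3 by linarith
qed

definition dec :: "bool list \<Rightarrow> 'b" where "dec xs = foldr (\<lambda>x s. of_bool x + a * s) xs 0"

lemma dec_simps [simp]: "dec [] = 0" "dec (x # xs) = of_bool x + a * dec xs" by (simp_all add: dec_def)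

lemma dec_append: "dec (xs @ ys) = dec xs + a ^ length xs * dec ys"
  by (induction xs) (simp_all add: algebra_simps)

lemma dec_gadd: "length xs = length ys \<Longrightarrow> dec (gadd xs ys) = dec xs + dec ys"
proof (induction xs ys rule: list_induct2)
  case (Cons x xs y ys)
  have "of_bool (x \<noteq> y) = (of_bool x + of_bool y :: 'b)" using add_self[of 1] by (cases x; cases y) auto
  with Cons show ?case by (simp add: gadd_def algebra_simps)
qed (simp add: gadd_def)

lemma len_gadd [simp]: "length (gadd xs ys) = min (length xs) (length ys)" by (simp add: gadd_def)
lemma len_gzero [simp]: "length (gzero red) = e" by (simp add: gzero_def)
lemma len_gone [simp]: "length (gone red) = e" using e2 by (simp add: gone_def)
lemma dec_False: "dec (map (\<lambda>_. False) xs) = 0" by (induction xs) auto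
lemma dec_gzero [simp]: "dec (gzero red) = 0" by (simp add: gzero_def dec_False)
lemma dec_gone [simp]: "dec (gone red) = 1" by (simp add: gone_def dec_False)

lemma len_gx [simp]: "length ys = e \<Longrightarrow> length (gx red ys) = e" using e2 by (simp add: gx_def)
lemma dec_gx: assumes "length ys = e" shows "dec (gx red ys) = a * dec ys"
proof -
  have ne: "ys \<noteq> []" using assms e2 by auto
  have l: "length (butlast ys) = e - 1" using assms by simp
  have "dec ys = dec (butlast ys) + a ^ (e - 1) * of_bool (last ys)"
    using dec_append[of "butlast ys" "[last ys]"] ne assms by simp
  then have "a * dec ys = a * dec (butlast ys) + a ^ e * of_bool (last ys)"
    using e2 ne assms by (auto simp: algebra_simps power_eq_if[of a e])
  moreover have "a ^ e = dec red" using root by (simp add: dec_def)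
  ultimately show ?thesis using assms e2 by (simp add: gx_def dec_gadd)
qed

lemma len_gmul [simp]: "length ys = e \<Longrightarrow> length (gmul red xs ys) = e"
  by (induction xs) auto
lemma dec_gmul: "length ys = e \<Longrightarrow> dec (gmul red xs ys) = dec xs * dec ys"
  by (induction xs) (auto simp: dec_gadd dec_gx algebra_simps)

lemma sq_add: "(x + y)\<^sup>2 = x\<^sup>2 + (y::'b)\<^sup>2" by (simp add: power2_eq_square algebra_simps char2)

lemma gfrob: "length y = e \<Longrightarrow> length (gfrob red i y) = e \<and> dec (gfrob red i y) = dec y ^ (2 ^ length i)"
  by (induction i arbitrary: y) (auto simp: dec_gmul power_mult power2_eq_square)

lemma gtrace: "length y = e \<Longrightarrow> length (gtrace red i y) = e \<and> dec (gtrace red i y) = (\<Sum>j<length i. dec y ^ (2 ^ j))"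
proof (induction i arbitrary: y)
  case (Cons x i)
  have "dec (gmul red y y) ^ 2 ^ j = dec y ^ 2 ^ Suc j" for j
    using Cons.prems by (simp add: dec_gmul power_mult power2_eq_square)
  then show ?case using Cons by (simp add: dec_gadd sum.lessThan_Suc_shift del: sum.lessThan_Suc)
qed simp

lemma gpows_len [simp]: "length y = e \<Longrightarrow> length (gpows red i y) = e"
  by (induction i arbitrary: y) auto
lemma ginv_len [simp]: "length y = e \<Longrightarrow> length (ginv red y) = e" by (simp add: ginv_def)

lemma sig_two: "\<sigma> x = x ^ (2 ^ e)" by (simp add: \<sigma>_def flip: qe)

lemma \<sigma>_a: "\<sigma> a = a"
  using gfrob[of "gx red (gone red)" red] check by (simp add: field_check_def dec_gx sig_two)

lemma dec_Fq [simp]: "dec xs \<in> Fq"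
  by (induction xs) (auto simp: Fq_def \<sigma>_a)

lemma gels: "set (gels red) = {x. length x = e}"
  by (auto simp: gels_def set_n_lists)

text \<open>
  The sum of two lists is either zero or invertible for the coded multiplication, and in the second case it
  decodes to a unit.
\<close>
lemma dec_inj: assumes "length x = e" "length y = e" "dec x = dec y" shows "x = y"
proof -
  have l: "length (gadd x y) = e" using assms by simp
  have "dec (gadd x y) = 0" using assms by (simp add: dec_gadd add_self)
  moreover have "gadd x y = gzero red \<or> gmul red (gadd x y) (ginv red (gadd x y)) = gone red"
    using check l gels by (simp add: field_check_def list_all_iff)
  ultimately have "gadd x y = gzero red"
    using dec_gmul[of "ginv red (gadd x y)" "gadd x y"] l by auto
  then have "gadd x y ! i = gzero red ! i" for i by simp
  moreover have "gadd x y ! i = (x ! i \<noteq> y ! i)" "gzero red ! i = False" if "i < e" for i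
    using that assms(1,2) by (simp_all add: gadd_def gzero_def)
  ultimately have "x ! i = y ! i" if "i < e" for i using that by metis
  then show ?thesis using assms by (intro nth_equalityI) auto
qed

lemma dec_image: "dec ` {x. length x = e} = Fq"
proof (rule card_subset_eq)
  have "inj_on dec {x. length x = e}" by (auto intro!: inj_onI dec_inj)
  moreover have "card {x :: bool list. length x = e} = 2 ^ e"
    using card_lists_length_eq[of "UNIV :: bool set" e] by simp
  ultimately show "card (dec ` {x. length x = e}) = card Fq" by (simp add: card_image card_Fq flip: qe)
qed auto

lemma artin_schreier: assumes "x\<^sup>2 + x = (y::'b)" shows "x ^ (2 ^ i) = x + (\<Sum>j<i. y ^ (2 ^ j))"
proof (induction i)
  case (Suc i)
  have sq_sum: "(\<Sum>j<i. z j)\<^sup>2 = (\<Sum>j<i. (z j)\<^sup>2)" for z :: "nat \<Rightarrow> 'b" and i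
    by (induction i) (simp_all add: sq_add)
  have "x ^ (2 ^ Suc i) = (x ^ (2 ^ i))\<^sup>2" by (simp add: power_mult mult.commute flip: power_mult)
  also have "\<dots> = x\<^sup>2 + (\<Sum>j<i. y ^ (2 ^ Suc j))"
    unfolding Suc by (simp add: sq_add sq_sum power_mult mult.commute flip: power_mult)
  also have "x\<^sup>2 = x + y" using assms by (metis add_self_left add.commute)
  finally show ?case by (simp add: sum.lessThan_Suc_shift add.assoc del: sum.lessThan_Suc)
qed simp

lemma trace_k: "(\<Sum>j<e. dec k ^ (2 ^ j)) = 1"
  using gtrace[of k red] check len_k by (simp add: field_check_def)

text \<open>
  Solutions of \<open>x\<^sup>2 + x = y\<close> are moved by the Frobenius map by the trace of \<open>y\<close>. This is applied to \<open>k\<close> over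
  \<open>Fq\<close> here and to \<open>k \<omega>\<close> over \<open>K\<close> next.
\<close>
lemma \<sigma>_\<omega>: "\<sigma> \<omega> = \<omega> + 1"
  using artin_schreier[OF \<omega>2, of e] trace_k by (simp add: sig_two dec_def)

lemma \<sigma>_\<beta>: "\<sigma> (\<sigma> \<beta>) = \<beta> + 1"
proof -
  define S where "S = (\<Sum>j<e. (dec k * \<omega>) ^ (2 ^ j))"
  have pow_add: "(x + y) ^ (2 ^ j) = x ^ (2 ^ j) + (y::'b) ^ (2 ^ j)" for x y j
    by (induction j) (simp_all add: power_mult sq_add mult.commute[of 2])
  have \<sigma>_sum: "\<sigma> (\<Sum>j<i. z j) = (\<Sum>j<i. \<sigma> (z j))" for z :: "nat \<Rightarrow> 'b" and i by (induction i) simp_all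
  have "\<sigma> \<beta> = \<beta> + S" using artin_schreier[OF \<beta>2, of e] by (simp add: sig_two S_def dec_def)
  moreover have "\<sigma> S = S + 1"
  proof -
    have "\<sigma> S = (\<Sum>j<e. (dec k * \<omega> + dec k) ^ (2 ^ j))"
      unfolding S_def \<sigma>_sum using sig_Fq[OF dec_Fq[of k]] by (simp add: \<sigma>_\<omega> distrib_left)
    also have "\<dots> = S + 1" unfolding S_def pow_add sum.distrib by (simp add: trace_k)
    finally show ?thesis .
  qed
  ultimately show ?thesis by (simp add: algebra_simps char2)
qed

lemma \<omega>_K: "\<omega> \<in> K" "\<omega> \<notin> Fq" by (simp_all add: K_def Fq_def \<sigma>_\<omega> add.assoc add_self)

definition kdec :: "kel \<Rightarrow> 'b" where "kdec p = dec (fst p) + dec (snd p) * \<omega>"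
definition valid :: "kel \<Rightarrow> bool" where "valid p \<longleftrightarrow> length (fst p) = e \<and> length (snd p) = e"

lemma kdec_K [simp]: "kdec p \<in> K" by (simp add: kdec_def \<omega>_K)
lemma sig_kdec: "\<sigma> (kdec p) = kdec p + dec (snd p)" by (simp add: kdec_def sig_Fq \<sigma>_\<omega> algebra_simps)

lemma kels: "set (kels red) = {p. valid p}" by (auto simp: kels_def gels valid_def)

lemma kdec_inj: assumes "valid p" "valid p'" "kdec p = kdec p'" shows "p = p'"
proof -
  have "dec (snd p) = dec (snd p')" using assms(3) sig_kdec[of p] sig_kdec[of p'] by simp
  moreover from this have "dec (fst p) = dec (fst p')" using assms(3) by (simp add: kdec_def)
  ultimately show ?thesis using dec_inj assms by (simp add: valid_def prod_eq_iff)
qed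

lemma kdec_surj: assumes "u \<in> K" obtains p where "valid p" "kdec p = u"
proof -
  obtain r s where "r \<in> Fq" "s \<in> Fq" "u = r + s * \<omega>" using K_basis[OF \<omega>_K assms] by auto
  moreover obtain x where "length x = e" "dec x = r" using dec_image \<open>r \<in> Fq\<close> by (metis (mono_tags) imageE mem_Collect_eq)
  moreover obtain y where "length y = e" "dec y = s" using dec_image \<open>s \<in> Fq\<close> by (metis (mono_tags) imageE mem_Collect_eq)
  ultimately show ?thesis using that[of "(x, y)"] by (simp add: valid_def kdec_def)
qed

lemma kadd: "valid p \<Longrightarrow> valid p' \<Longrightarrow> valid (kadd p p') \<and> kdec (kadd p p') = kdec p + kdec p'"
  by (cases p; cases p') (simp add: valid_def kdec_def dec_gadd algebra_simps)
lemma ksc: "valid p \<Longrightarrow> length s = e \<Longrightarrow> valid (ksc red s p) \<and> kdec (ksc red s p) = dec s * kdec p"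
  by (cases p) (simp add: valid_def kdec_def dec_gmul algebra_simps)
lemma \<omega>\<omega>: "\<omega> * \<omega> = \<omega> + dec k"
  using \<omega>2 by (simp add: power2_eq_square flip: dec_def) (metis add_self_left add.commute)
lemma kmul: "valid p \<Longrightarrow> valid p' \<Longrightarrow> valid (kmul red k p p') \<and> kdec (kmul red k p p') = kdec p * kdec p'"
proof (cases p; cases p')
  fix x y x' y' assume p: "valid p" "valid p'" "p = (x, y)" "p' = (x', y')"
  have "kdec p * kdec p' = dec x * dec x' + (dec x * dec y' + dec y * dec x') * \<omega> + dec y * dec y' * (\<omega> * \<omega>)"
    using p by (simp add: kdec_def algebra_simps)
  then show "valid (kmul red k p p') \<and> kdec (kmul red k p p') = kdec p * kdec p'" using p len_k
    unfolding \<omega>\<omega> by (simp add: valid_def kdec_def dec_gadd dec_gmul kcomb_def algebra_simps)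
qed
lemma knorm: "valid p \<Longrightarrow> length (knorm red k p) = e \<and> dec (knorm red k p) = kdec p * \<sigma> (kdec p)"
proof (cases p)
  fix x y assume p: "valid p" "p = (x, y)"
  have "kdec p * \<sigma> (kdec p) = (dec x + dec y * \<omega>) * (dec x + dec y * \<omega> + dec y)" unfolding sig_kdec using p by (simp add: kdec_def)
  also have "\<dots> = dec x * dec x + dec x * dec y + dec y * dec y * (\<omega> * \<omega> + \<omega>) + (dec x * dec y * \<omega> + dec x * dec y * \<omega>)"
    by (simp add: algebra_simps)
  also have "\<dots> = dec x * dec x + dec x * dec y + dec y * dec y * dec k" unfolding \<omega>\<omega> by (simp add: algebra_simps char2)
  finally show "length (knorm red k p) = e \<and> dec (knorm red k p) = kdec p * \<sigma> (kdec p)"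
    using p len_k by (simp add: valid_def dec_gadd dec_gmul algebra_simps)
qed

definition dfun :: "kel \<times> kel \<times> kel \<Rightarrow> 'b \<Rightarrow> 'b" where
  "dfun p u = (case p of (c, b, v) \<Rightarrow> kdec v + kdec b * (kdec c * u + \<sigma> (kdec c * u)))"

definition valid3 :: "kel \<times> kel \<times> kel \<Rightarrow> bool" where "valid3 p = (case p of (c, b, v) \<Rightarrow> valid c \<and> valid b \<and> valid v)"

lemma trace_kdec: "kdec p + \<sigma> (kdec p) = dec (snd p)" unfolding sig_kdec by (simp add: char2)

lemma kfun: assumes "valid3 p" "valid u" shows "valid (kfun red k p u) \<and> kdec (kfun red k p u) = dfun p (kdec u)"
proof -
  obtain c b v where p: "p = (c, b, v)" by (cases p)
  have val: "valid c" "valid b" "valid v" using assms p by (auto simp: valid3_def)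
  have cu: "valid (kmul red k c u)" "kdec (kmul red k c u) = kdec c * kdec u" using kmul val assms by auto
  have "length (snd (kmul red k c u)) = e" using cu(1) by (simp add: valid_def)
  then have s: "valid (ksc red (snd (kmul red k c u)) b)"
     "kdec (ksc red (snd (kmul red k c u)) b) = dec (snd (kmul red k c u)) * kdec b" using ksc val by auto
  then show ?thesis using kadd[OF val(3) s(1)] trace_kdec[of "kmul red k c u"] cu(2)
    by (simp add: p dfun_def mult.commute)
qed

lemma dfun_K: "u \<in> K \<Longrightarrow> dfun p u \<in> K" by (cases p) (simp add: dfun_def)

lemma dfun_spread:
  assumes "valid3 p" "spread_check red k p" "u \<in> K" "u' \<in> K" "u \<noteq> u'"
  shows "(u - u') * \<sigma> (u - u') \<noteq> (dfun p u - dfun p u') * \<sigma> (dfun p u - dfun p u')"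
proof
  assume eq: "(u - u') * \<sigma> (u - u') = (dfun p u - dfun p u') * \<sigma> (dfun p u - dfun p u')"
  obtain c b v where p: "p = (c, b, v)" by (cases p)
  have val: "valid c" "valid b" "valid v" using assms p by (auto simp: valid3_def)
  obtain d where d: "valid d" "kdec d = u - u'" using kdec_surj[of "u - u'"] assms by auto
  have cd: "valid (kmul red k c d)" "kdec (kmul red k c d) = kdec c * (u - u')" using kmul[OF val(1) d(1)] d(2) by auto
  define t where "t = snd (kmul red k c d)"
  have t: "length t = e" using cd by (simp add: t_def valid_def)
  have "dfun p u - dfun p u' = kdec b * (kdec (kmul red k c d) + \<sigma> (kdec (kmul red k c d)))"
    unfolding cd(2) p dfun_def by (simp add: algebra_simps)
  also have "\<dots> = kdec b * dec t" by (simp add: trace_kdec t_def)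
  finally have diff: "dfun p u - dfun p u' = kdec b * dec t" .
  have "kdec d * \<sigma> (kdec d) = (kdec b * dec t) * \<sigma> (kdec b * dec t)" using eq unfolding diff d(2) .
  then have "kdec d * \<sigma> (kdec d) = (kdec b * \<sigma> (kdec b)) * (dec t * dec t)" by (simp add: sig_Fq mult_ac)
  then have "dec (knorm red k d) = dec (gmul red (knorm red k b) (gmul red t t))"
    using knorm[OF d(1)] knorm[OF val(2)] t by (simp add: dec_gmul)
  then have "knorm red k d = gmul red (knorm red k b) (gmul red t t)"
    by (intro dec_inj) (use knorm[OF d(1)] t in auto)
  moreover have "d \<noteq> (gzero red, gzero red)" using d assms(5) by (auto simp: kdec_def)
  moreover have "d \<in> set (kels red)" using d kels by simp
  ultimately show False using assms(2) unfolding p by (auto simp: list_all_iff gsquare_def t_def)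
qed

text \<open>
  The numerator of the invariant: \<open>ell u v\<close> has the invariant \<open>\<rho>\<close> if \<open>Aval u v = \<rho> v \<sigma> v\<close>.
\<close>
definition Aval :: "'b \<Rightarrow> 'b \<Rightarrow> 'b" where
  "Aval u v = (u\<^sup>2 + u + \<beta>\<^sup>2 + \<beta>) * \<sigma> (u\<^sup>2 + u + \<beta>\<^sup>2 + \<beta>) + (v * \<sigma> v)\<^sup>2 + (v * \<sigma> v) * (u + \<sigma> u)"

lemma kval:
  assumes "valid3 p" "valid u" "kval red k p u \<noteq> []"
  shows "dfun p (kdec u) \<noteq> 0" and "Aval (kdec u) (dfun p (kdec u)) = dec (kval red k p u) * (dfun p (kdec u) * \<sigma> (dfun p (kdec u)))"
proof -
  define f where "f = kfun red k p u"
  have f: "valid f" "kdec f = dfun p (kdec u)" using kfun[OF assms(1,2)] by (auto simp: f_def)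
  define n where "n = knorm red k f"
  have n: "length n = e" "dec n = kdec f * \<sigma> (kdec f)" using knorm[OF f(1)] by (auto simp: n_def)
  define i where "i = ginv red n"
  have i: "length i = e" using n by (simp add: i_def)
  have g1: "gmul red n i = gone red" using assms(3) unfolding kval_def kquot'_def kquot_def by (auto simp: n_def f_def i_def split: if_splits)
  then have ni: "dec n * dec i = 1" using dec_gmul[OF i, of n] by simp
  then show "dfun p (kdec u) \<noteq> 0" using n f by auto
  define s where "s = kadd (kadd (kmul red k u u) u) (gzero red, k)"
  have s: "valid s" "kdec s = kdec u * kdec u + kdec u + dec k * \<omega>"
    using kmul[OF assms(2,2)] kadd[of "kmul red k u u" u] kadd[of "kadd (kmul red k u u) u" "(gzero red, k)"] assms(2) len_k
    by (auto simp: s_def valid_def kdec_def)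
  have s': "kdec s = (kdec u)\<^sup>2 + kdec u + \<beta>\<^sup>2 + \<beta>" unfolding s(2) using \<beta>2 by (simp add: power2_eq_square add.assoc flip: dec_def)
  have "kval red k p u = gadd (gadd (gmul red (knorm red k s) i) n) (snd u)"
    using g1 unfolding kval_def kquot'_def kquot_def by (simp add: n_def f_def i_def s_def)
  then have "dec (kval red k p u) = kdec s * \<sigma> (kdec s) * dec i + dec n + dec (snd u)"
    using knorm[OF s(1)] n i assms(2) by (simp add: dec_gadd dec_gmul valid_def)
  then have "dec (kval red k p u) * dec n = kdec s * \<sigma> (kdec s) * (dec n * dec i) + dec n * dec n + dec n * dec (snd u)"
    by (simp add: algebra_simps)
  then show "Aval (kdec u) (dfun p (kdec u)) = dec (kval red k p u) * (dfun p (kdec u) * \<sigma> (dfun p (kdec u)))"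
    unfolding Aval_def s'[symmetric] ni trace_kdec f(2)[symmetric] n(2)[symmetric] by (simp add: power2_eq_square)
qed

text \<open>
  Each parameter triple is used for \<open>m\<close> consecutive indices \<open>j\<close>, so a count of \<open>length ps * q\<close> for one run
  through the triples amounts to \<open>m * length ps * q = q\<^sup>2\<close> altogether.
\<close>
lemma code_design:
  assumes pars: "length ps * m = q" "\<And>p. p \<in> set ps \<Longrightarrow> valid3 p \<and> spread_check red k p"
    and counts: "counts_check (gels red) (concat (map (kvals red k) ps)) (length ps * q)"
  shows "\<exists>\<Gamma> \<tau> S. plane_design (\<Gamma> :: ('b set \<times> nat) set) \<tau> S"
proof -
  define f where "f j = dfun (ps ! (j div m))" for j
  have m: "m > 0" using pars(1) q3 by (cases m) auto
  have mm: "m * (length ps * q) = q\<^sup>2"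
  proof -
    have "m * (length ps * q) = (length ps * m) * q" by (simp only: mult_ac)
    then show ?thesis unfolding pars(1) by (simp only: power2_eq_square)
  qed
  have jm: "j div m < length ps" if "j < q" for j
    using that pars(1) m by (metis div_less_iff_less_mult)
  have ne: "kval red k p u \<noteq> []" if "p \<in> set ps" "valid u" for p u
  proof -
    have "kval red k p u \<in> set (concat (map (kvals red k) ps))" using that kels by (auto simp: kvals)
    then show ?thesis using counts unfolding counts_check_def list_all_iff by blast
  qed
  interpret char2_design q ty \<beta> f
  proof unfold_locales
    fix j u assume ju: "j < q" "u \<in> K"
    then have p: "ps ! (j div m) \<in> set ps" using jm by simp
    show "f j u \<in> K" using ju by (simp add: f_def dfun_K)
    obtain p' where "valid p'" "kdec p' = u" using kdec_surj[OF ju(2)] .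
    then show "f j u \<noteq> 0" using kval(1)[of "ps ! (j div m)" p'] pars(2)[OF p] ne[OF p] by (auto simp: f_def)
  next
    fix j u u' assume ju: "j < q" "u \<in> K" "u' \<in> K" "u \<noteq> u'"
    then have p: "ps ! (j div m) \<in> set ps" using jm by simp
    show "(u - u') * \<sigma> (u - u') \<noteq> (f j u - f j u') * \<sigma> (f j u - f j u')"
      unfolding f_def by (rule dfun_spread) (use ju pars(2)[OF p] in auto)
  next
    fix \<rho> assume \<rho>: "\<rho> \<in> Fq"
    obtain r where r: "length r = e" "dec r = \<rho>" using dec_image \<rho> by (metis (mono_tags) imageE mem_Collect_eq)
    define U where "U p = {u \<in> K. Aval u (dfun p u) = \<rho> * (dfun p u * \<sigma> (dfun p u))}" for p
    define c where "c p = length (filter (\<lambda>x. x = r) (map (kval red k p) (kels red)))" for p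
    have cU: "c p \<le> card (U p)" if p: "p \<in> set ps" for p
    proof -
      have "c p = length (filter (\<lambda>u. kval red k p u = r) (kels red))" by (simp add: c_def filter_map comp_def)
      also have "\<dots> = card (set (filter (\<lambda>u. kval red k p u = r) (kels red)))"
        by (intro distinct_card[symmetric] distinct_filter) (auto simp: kels_def gels_def intro!: distinct_product distinct_n_lists)
      also have "\<dots> \<le> card (U p)"
      proof (rule card_inj_on_le[of kdec])
        show "inj_on kdec (set (filter (\<lambda>u. kval red k p u = r) (kels red)))"
          using kdec_inj by (auto simp: kels intro!: inj_onI)
        show "kdec ` set (filter (\<lambda>u. kval red k p u = r) (kels red)) \<subseteq> U p"
          using kval(2)[of p] pars(2)[OF p] ne[OF p] r by (auto simp: kels U_def)
      qed (simp add: U_def)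
      finally show ?thesis .
    qed
    have "length ps * q \<le> length (filter (\<lambda>x. x = r) (concat (map (kvals red k) ps)))"
      using counts r gels unfolding counts_check_def by (simp add: list_all_iff)
    also have "\<dots> = sum_list (map c ps)" unfolding c_def by (simp add: filter_concat length_concat comp_def kvals)
    also have "\<dots> = (\<Sum>i<length ps. c (ps ! i))" by (simp add: sum_list_sum_nth atLeast0LessThan)
    also have "\<dots> \<le> (\<Sum>i<length ps. card (U (ps ! i)))" by (intro sum_mono cU) simp
    finally have "m * (length ps * q) \<le> m * (\<Sum>i<length ps. card (U (ps ! i)))" by simp
    also have "\<dots> = (\<Sum>i<length ps. \<Sum>j\<in>{i * m..<i * m + m}. card (U (ps ! (j div m))))"
    proof -
      have "j div m = i" if "j \<in> {i * m..<i * m + m}" for i j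
        using that m by (intro div_nat_eqI) (auto simp: algebra_simps)
      then have "(\<Sum>j\<in>{i * m..<i * m + m}. card (U (ps ! (j div m)))) = m * card (U (ps ! i))" for i by simp
      then show ?thesis by (simp add: sum_distrib_left)
    qed
    also have "\<dots> = (\<Sum>j<q. card (U (ps ! (j div m))))" using sum.nat_group[of _ m "length ps"] pars(1) by simp
    also have "\<dots> = card (SIGMA j:{..<q}. U (ps ! (j div m)))" by (subst card_SigmaI) (auto simp: U_def)
    also have "(SIGMA j:{..<q}. U (ps ! (j div m))) = {(j, u). j < q \<and> u \<in> K \<and>
      (u\<^sup>2 + u + \<beta>\<^sup>2 + \<beta>) * \<sigma> (u\<^sup>2 + u + \<beta>\<^sup>2 + \<beta>) + (f j u * \<sigma> (f j u))\<^sup>2 + (f j u * \<sigma> (f j u)) * (u + \<sigma> u)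
        = \<rho> * (f j u * \<sigma> (f j u))}"
      by (auto simp: U_def Aval_def f_def)
    finally show "q\<^sup>2 \<le> card {(j, u). j < q \<and> u \<in> K \<and>
      (u\<^sup>2 + u + \<beta>\<^sup>2 + \<beta>) * \<sigma> (u\<^sup>2 + u + \<beta>\<^sup>2 + \<beta>) + (f j u * \<sigma> (f j u))\<^sup>2 + (f j u * \<sigma> (f j u)) * (u + \<sigma> u)
        = \<rho> * (f j u * \<sigma> (f j u))}"
      unfolding mm .
  qed (use two \<sigma>_\<beta> in auto)
  show ?thesis by (rule plane_design_exists)
qed

end

section \<open>Designs for fields with four, eight and sixteen elements\<close>
text \<open>
  The fields are defined by \<open>a\<^sup>2 = 1 + a\<close>, \<open>a\<^sup>3 = 1 + a\<close> and \<open>a\<^sup>4 = 1 + a\<close>, and the parameters \<open>k\<close> have trace one. The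
  triples have been found by search. For \<open>q = 4\<close> a constant function suffices, for \<open>q = 8\<close> a constant
  and a nonconstant one, and for \<open>q = 16\<close> a single nonconstant one.
\<close>
definition "red4 = [True, True]"
definition "red8 = [True, True, False]"
definition "red16 = [True, True, False, False]"
definition "k4 = [False, True]"
definition "k8 = [True, False, False]"
definition "k16 = [False, False, False, True]"
definition pars4 :: "(kel \<times> kel \<times> kel) list" where
  "pars4 = [((gzero red4, gzero red4), (gzero red4, gzero red4), (gone red4, gzero red4))]"
definition pars8 :: "(kel \<times> kel \<times> kel) list" where
  "pars8 = [((gzero red8, gzero red8), (gzero red8, gzero red8), ([False, True, False], gzero red8)),
    (([False, False, True], gone red8), (gone red8, [False, True, True]), ([True, True, True], gzero red8))]"
definition pars16 :: "(kel \<times> kel \<times> kel) list" where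
  "pars16 = [((gone red16, gzero red16), (gone red16, gzero red16), ([False, True, False, False], gone red16))]"

definition design_check :: "bool list \<Rightarrow> bool list \<Rightarrow> (kel \<times> kel \<times> kel) list \<Rightarrow> nat \<Rightarrow> bool" where
  "design_check red k ps m \<longleftrightarrow> list_all (spread_check red k) ps \<and>
     counts_check (gels red) (concat (map (kvals red k) ps)) m"

lemma check4: "field_check red4 k4" "design_check red4 k4 pars4 4" by code_simp+
lemma check8: "field_check red8 k8" "design_check red8 k8 pars8 16" by code_simp+
lemma check16: "field_check red16 k16" "design_check red16 k16 pars16 16" by code_simp+

context frobenius_field
begin

text \<open>
  The elements \<open>a\<close>, \<open>\<omega>\<close> and \<open>\<beta>\<close> are roots of polynomials, hence they exist in an algebraically closed field.
\<close>
lemma code_design_exists: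
  assumes two: "(1::'b) + 1 = 0" and qe: "q = 2 ^ length red" and len: "length k = length red"
    and fc: "field_check red k" and ps: "length ps * m = q" and dc: "design_check red k ps (length ps * q)"
    and val: "\<forall>(c, b, v)\<in>set ps. length (fst c) = length red \<and> length (snd c) = length red \<and> length (fst b) = length red
      \<and> length (snd b) = length red \<and> length (fst v) = length red \<and> length (snd v) = length red"
  shows "\<exists>\<Gamma> \<tau> S. plane_design (\<Gamma> :: ('b set \<times> nat) set) \<tau> S"
proof -
  define dc where "dc a xs = foldr (\<lambda>x s. of_bool x + a * s) xs 0" for a :: 'b and xs
  define pl :: "bool list \<Rightarrow> 'b poly" where "pl xs = foldr (\<lambda>x s. pCons (of_bool x) s) xs 0" for xs
  have poly_pl: "poly (pl xs) a = dc a xs" for a xs by (induction xs) (simp_all add: pl_def dc_def)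
  have deg_pl: "xs = [] \<or> degree (pl xs) < length xs" for xs
  proof (induction xs)
    case (Cons x xs)
    have "degree (pl (x # xs)) \<le> Suc (degree (pl xs))" by (simp add: pl_def degree_pCons_le)
    with Cons show ?case by (cases xs) (auto simp: pl_def)
  qed simp
  have len0: "length red > 0" using qe q3 by (cases red) auto
  obtain a where a: "a ^ length red = dc a red"
  proof -
    have "degree (monom 1 (length red) - pl red) = length red"
      using deg_pl[of red] len0 degree_add_eq_left[of "- pl red" "monom 1 (length red)"] by (auto simp: degree_monom_eq)
    then obtain a where "poly (monom 1 (length red) - pl red) a = 0" using alg_closed_imp_poly_has_root[of "monom 1 (length red) - pl red"] len0 by auto
    then show thesis using that by (simp add: poly_monom poly_pl)
  qed
  have as: "\<exists>x. x\<^sup>2 + x = y" for y :: 'b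
  proof -
    obtain x where "poly [:- y, 1, 1:] x = 0" using alg_closed_imp_poly_has_root[of "[:- y, 1, 1:]"] by auto
    then have "x\<^sup>2 + x = y" by (simp add: power2_eq_square algebra_simps)
    then show ?thesis ..
  qed
  obtain \<omega> where \<omega>: "\<omega>\<^sup>2 + \<omega> = dc a k" using as by blast
  obtain \<beta> where \<beta>: "\<beta>\<^sup>2 + \<beta> = dc a k * \<omega>" using as by blast
  interpret binary_code q ty red k a \<omega> \<beta>
    by unfold_locales (use two qe len a \<omega> \<beta> fc in \<open>simp_all add: dc_def\<close>)
  show ?thesis
  proof (rule code_design[OF ps])
    fix p assume p: "p \<in> set ps"
    then show "valid3 p \<and> spread_check red k p" using val dc
      by (auto simp: valid3_def valid_def design_check_def list_all_iff split: prod.splits)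
  qed (use dc in \<open>simp add: design_check_def\<close>)
qed

lemma design_even:
  assumes "q \<in> {4, 8, 16}" and two: "(1::'b) + 1 = 0"
  shows "\<exists>\<Gamma> \<tau> S. plane_design (\<Gamma> :: ('b set \<times> nat) set) \<tau> S"
proof -
  consider "q = 4" | "q = 8" | "q = 16" using assms by auto
  then show ?thesis
  proof cases
    case 1 then show ?thesis
      by (intro code_design_exists[OF two _ _ check4(1), of pars4 4])
        (use check4 in \<open>auto simp: red4_def k4_def pars4_def gzero_def gone_def\<close>)
  next
    case 2 then show ?thesis
      by (intro code_design_exists[OF two _ _ check8(1), of pars8 4])
        (use check8 in \<open>auto simp: red8_def k8_def pars8_def gzero_def gone_def\<close>)
  next
    case 3 then show ?thesis
      by (intro code_design_exists[OF two _ _ check16(1), of pars16 16])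
        (use check16 in \<open>auto simp: red16_def k16_def pars16_def gzero_def gone_def\<close>)
  qed
qed

end

section \<open>A design for the field with three elements\<close>
lemma upt12: "[0..<12] = [0, 1, 2, 3, 4, 5, 6, 7, 8, 9, 10, 11]" by code_simp
lemma upt40: "[0..<40] = [0, 1, 2, 3, 4, 5, 6, 7, 8, 9, 10, 11, 12, 13, 14, 15, 16, 17, 18, 19, 20, 21, 22, 23, 24, 25, 26, 27, 28, 29, 30, 31, 32, 33, 34, 35, 36, 37, 38, 39]" by code_simp

text \<open>
  With a primitive element \<open>g\<close> of \<open>GF(81)\<close> satisfying \<open>g\<^sup>4 = 1 - g\<close>, the points of \<open>PG(3, 3)\<close> are the powers of \<open>g\<close>
  up to sign, that is, the exponents modulo 40; the ten \<open>K\<close>-lines are the residue classes modulo 10. The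
  group generated by \<open>g\<^sup>4\<close> has order ten on the points, and the 120 oblique lines fall into twelve orbits. A
  representative of each is listed by exponents of its four points: the first two, their sum and their
  difference.
\<close>
definition orbit_reps :: "nat list list" where "orbit_reps =
  [[0, 7, 25, 63], [0, 5, 74, 26], [1, 6, 75, 27], [0, 1, 53, 4], [2, 3, 55, 6], [0, 2, 24, 57],
   [0, 6, 72, 11], [1, 3, 25, 58], [1, 2, 54, 5], [0, 21, 75, 29], [0, 3, 79, 12], [0, 15, 62, 78]]"

text \<open>
  Four sets of nine oblique lines; \<open>(r, h)\<close> is the representative number \<open>r\<close> multiplied by \<open>g\<^bsup>4 h\<^esup>\<close>. The nine lines
  with index \<open>j\<close> are disjoint and miss the \<open>K\<close>-line of \<open>g\<^bsup>j div 2\<^esup>\<close>. The orbits are represented three times each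
  among the 36 lines. The sets have been found by search.
\<close>
definition base_spreads :: "(nat \<times> nat) list list" where "base_spreads =
  [[(0, 4), (1, 2), (2, 2), (0, 1), (3, 8), (1, 3), (2, 5), (4, 4), (3, 6)],
   [(5, 6), (4, 9), (2, 2), (6, 3), (7, 1), (8, 8), (9, 8), (10, 4), (9, 9)],
   [(11, 5), (11, 7), (9, 1), (7, 1), (1, 3), (6, 2), (5, 8), (7, 3), (10, 6)],
   [(8, 7), (11, 7), (5, 5), (8, 1), (4, 8), (6, 2), (3, 3), (0, 8), (10, 6)]]"

definition logs :: "nat \<times> nat \<Rightarrow> nat list" where
  "logs p = map (\<lambda>i. (i + 4 * snd p) mod 40) (orbit_reps ! fst p)"

lemma base_spreads_disjoint:
  "j < 4 \<Longrightarrow> distinct (concat (map logs (base_spreads ! j))) \<and>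
    list_all (\<lambda>i. i mod 10 \<noteq> j div 2) (concat (map logs (base_spreads ! j)))"
proof -
  assume "j < 4"
  then consider "j = 0" | "j = 1" | "j = 2" | "j = 3" by linarith
  then show ?thesis by cases (simp_all add: base_spreads_def orbit_reps_def logs_def)
qed

lemma base_spreads_range: "j < 4 \<Longrightarrow> list_all (\<lambda>(r, h). r < 12 \<and> h < 10) (base_spreads ! j)"
proof -
  assume "j < 4"
  then consider "j = 0" | "j = 1" | "j = 2" | "j = 3" by linarith
  then show ?thesis by cases (simp_all add: base_spreads_def)
qed

definition occurrences :: "nat \<Rightarrow> (nat \<times> nat) list" where
  "occurrences r = concat (map (\<lambda>j. map (\<lambda>p. (j, snd p)) (filter (\<lambda>p. fst p = r) (base_spreads ! j))) [0, 1, 2, 3])"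

lemma occurrences: "r < 12 \<Longrightarrow> distinct (occurrences r) \<and> length (occurrences r) = 3"
proof -
  assume "r < 12"
  then have "r \<in> set [0..<12]" by simp
  moreover have "list_all (\<lambda>r. distinct (occurrences r) \<and> length (occurrences r) = 3) [0..<12]"
    by (simp add: upt12 occurrences_def base_spreads_def)
  ultimately show ?thesis unfolding list_all_iff by blast
qed

lemma occurrences_mem: "(j, h) \<in> set (occurrences r) \<Longrightarrow> j < 4 \<and> (r, h) \<in> set (base_spreads ! j)"
  by (auto simp: occurrences_def)

text \<open>
  Multiplication by \<open>g\<^sup>4\<close> preserves the residue of the first exponent modulo 4 and the difference of the
  exponents of two points. That all keys occur shows that the line through two points of different
  \<open>K\<close>-lines is a translate of a representative.
\<close>
definition "pair_keys = concat (map (\<lambda>l. concat (map (\<lambda>y. map (\<lambda>z. (y mod 4, (z + 80 - y) mod 40)) l) l)) orbit_reps)"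

lemmas pair_keys_eval = pair_keys_def[unfolded orbit_reps_def, simplified]

lemma pair_keys: "x < 4 \<Longrightarrow> d < 40 \<Longrightarrow> d mod 10 \<noteq> 0 \<Longrightarrow> (x, d) \<in> set pair_keys"
proof -
  assume *: "x < 4" "d < 40" "d mod 10 \<noteq> 0"
  have "list_all (\<lambda>d. d mod 10 = 0 \<or> list_all (\<lambda>x. (x, d) \<in> set pair_keys) [0, 1, 2, 3]) [0..<40]"
    by (simp add: upt40 pair_keys_eval)
  moreover have "d \<in> set [0..<40]" using * by simp
  ultimately have "d mod 10 = 0 \<or> list_all (\<lambda>x. (x, d) \<in> set pair_keys) [0, 1, 2, 3]"
    unfolding list_all_iff by (rule bspec)
  with *(3) have "list_all (\<lambda>x. (x, d) \<in> set pair_keys) [0, 1, 2, 3]" by simp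
  moreover have "x \<in> set [0, 1, 2, 3]" using * by auto
  ultimately show ?thesis unfolding list_all_iff by (rule bspec)
qed

text \<open>
  Multiplication by \<open>g\<close> on coefficients with respect to \<open>1, g, g\<^sup>2, g\<^sup>3\<close>. The table \<open>ptab\<close> of the powers of \<open>g\<close> serves to
  verify the additive relations in the representatives.
\<close>
fun nxt :: "int \<times> int \<times> int \<times> int \<Rightarrow> int \<times> int \<times> int \<times> int" where
  "nxt (a, b, c, d) = (d mod 3, (a - d) mod 3, b, c)"
fun powers3 :: "nat \<Rightarrow> int \<times> int \<times> int \<times> int \<Rightarrow> (int \<times> int \<times> int \<times> int) list" where
  "powers3 0 v = []" | "powers3 (Suc n) v = v # powers3 n (nxt v)"
lemma powers3_numeral [simp]: "powers3 (numeral k) v = v # powers3 (pred_numeral k) (nxt v)"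
  by (simp add: numeral_eq_Suc)

definition "ptab = powers3 80 (1, 0, 0, 0)"
lemmas ptab_eval = ptab_def[simplified]

fun same3 :: "int \<times> int \<times> int \<times> int \<Rightarrow> int \<times> int \<times> int \<times> int \<Rightarrow> int \<times> int \<times> int \<times> int \<Rightarrow> int \<Rightarrow> bool" where
  "same3 (a, b, c, d) (a', b', c', d') (x, y, z, w) s \<longleftrightarrow> (a + s * a' - x) mod 3 = 0 \<and> (b + s * b' - y) mod 3 = 0 \<and>
     (c + s * c' - z) mod 3 = 0 \<and> (d + s * d' - w) mod 3 = 0"

lemma reps_are_lines:
  "list_all (\<lambda>l. same3 (ptab ! (l ! 0)) (ptab ! (l ! 1)) (ptab ! (l ! 2)) 1 \<and>
     same3 (ptab ! (l ! 0)) (ptab ! (l ! 1)) (ptab ! (l ! 3)) (-1)) orbit_reps"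
  by (simp add: orbit_reps_def ptab_eval)

lemma ptab40: "same3 (ptab ! 40) (1, 0, 0, 0) (0, 0, 0, 0) 1" by (simp add: ptab_eval)

lemma base_spreads_inj: "j < 4 \<Longrightarrow> inj_on logs (set (base_spreads ! j))"
proof -
  assume "j < 4"
  then consider "j = 0" | "j = 1" | "j = 2" | "j = 3" by linarith
  then have "distinct (map logs (base_spreads ! j))" by cases (simp_all add: base_spreads_def orbit_reps_def logs_def)
  then show ?thesis by (simp add: distinct_map)
qed

lemma orbit_reps_bounds: "length orbit_reps = 12" "list_all (\<lambda>l. length l = 4 \<and> list_all (\<lambda>i. i < 80) l) orbit_reps"
  by (simp_all add: orbit_reps_def)

lemma mod_add_cancel: "(a + x) mod n = (a + y) mod n \<Longrightarrow> x mod n = y mod (n::nat)"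
proof -
  assume "(a + x) mod n = (a + y) mod n"
  then have "int (a + x) mod int n = int (a + y) mod int n" by (simp only: of_nat_mod[symmetric])
  then have "int n dvd int (a + x) - int (a + y)" by (simp only: mod_eq_dvd_iff)
  then have "int n dvd int x - int y" by simp
  then have "int x mod int n = int y mod int n" by (simp only: mod_eq_dvd_iff)
  then show ?thesis by (simp only: of_nat_mod[symmetric] of_nat_eq_iff)
qed

text \<open>
  Used to see that \<open>g\<close> has order 80, from its powers with exponents 40 and 16.
\<close>
lemma proper_divisors_80: "d dvd 80 \<Longrightarrow> d < 80 \<Longrightarrow> d dvd 40 \<or> d dvd (16::nat)"
proof -
  assume d: "d dvd 80" "d < 80"
  then have "d \<in> set [0..<80]" by simp
  moreover have "list_all (\<lambda>d. d dvd 80 \<longrightarrow> d dvd 40 \<or> d dvd (16::nat)) [0..<80]" by code_simp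
  ultimately show ?thesis using d(1) unfolding list_all_iff by blast
qed

text \<open>
  The translates, by \<open>g\<^bsup>4 h\<^esup>\<close>, of the set with index \<open>j\<close> whose \<open>K\<close>-line is the residue class \<open>r\<close>.
\<close>
definition positions :: "nat \<Rightarrow> (nat \<times> nat) list" where
  "positions r = filter (\<lambda>(h, j). (4 * h + j div 2) mod 10 = r) (List.product [0, 1, 2, 3, 4, 5, 6, 7, 8, 9] [0, 1, 2, 3])"

lemma positions: "r < 10 \<Longrightarrow> length (positions r) \<le> 4"
proof -
  assume "r < 10"
  then have "r \<in> set [0, 1, 2, 3, 4, 5, 6, 7, 8, 9]" by auto
  moreover have "list_all (\<lambda>r. length (positions r) \<le> 4) [0, 1, 2, 3, 4, 5, 6, 7, 8, 9]"
    by (simp add: positions_def)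
  ultimately show ?thesis unfolding list_all_iff by blast
qed

context frobenius_field
begin

text \<open>
  The ten translates of the four base sets, each taken three times. A \<open>K\<close>-line is distinguished by at most four translates,
  which makes \<open>3 * 4 = 12 = q (q + 1)\<close> repetitions, and an oblique line lies in three translates, which makes
  \<open>3 * 3 = q\<^sup>2\<close>.
\<close>
lemma design_three:
  assumes q: "q = 3"
  shows "\<exists>\<Gamma> \<tau> S. plane_design (\<Gamma> :: ((nat \<times> nat) \<times> nat) set) \<tau> S"
proof -
  have three: "(3::'b) = 0" using q0 q by simp
  obtain g :: 'b where g: "g ^ 4 = 1 - g"
  proof -
    obtain g where "poly [:- 1, 1, 0, 0, 1:] g = (0::'b)" using alg_closed_imp_poly_has_root[of "[:- 1, 1, 0, 0, 1:] :: 'b poly"] by auto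
    then have "g ^ 4 = 1 - g" by (simp add: algebra_simps power4_eq_xxxx)
    then show thesis by (rule that)
  qed
  have g0: "g \<noteq> 0" using g by auto
  define ev :: "int \<times> int \<times> int \<times> int \<Rightarrow> 'b" where
    "ev v = (case v of (a, b, c, d) \<Rightarrow> of_int a + of_int b * g + of_int c * g\<^sup>2 + of_int d * g ^ 3)" for v
  have of_int_0: "of_int x = (0::'b)" if "x mod 3 = 0" for x
  proof -
    have "x = 3 * (x div 3)" using that by presburger
    then have "of_int x = (of_int (3 * (x div 3)) :: 'b)" by simp
    then show ?thesis using three by simp
  qed
  have of_int_mod: "of_int (x mod 3) = (of_int x :: 'b)" for x
  proof -
    have "(x mod 3 - x) mod 3 = 0" by presburger
    then show ?thesis using of_int_0[of "x mod 3 - x"] by simp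
  qed
  have ev_nxt: "ev (nxt v) = g * ev v" for v
  proof (cases v)
    case (fields a b c d)
    have "g * ev v = of_int a * g + of_int b * g\<^sup>2 + of_int c * g ^ 3 + of_int d * g ^ 4"
      by (simp add: fields ev_def algebra_simps power2_eq_square power3_eq_cube power4_eq_xxxx)
    then show ?thesis unfolding g by (simp add: fields ev_def of_int_mod algebra_simps)
  qed
  have pw: "i < n \<Longrightarrow> ev (powers3 n v ! i) = g ^ i * ev v" for i n v
  proof (induction n arbitrary: i v)
    case (Suc n)
    then show ?case by (cases i) (auto simp: ev_nxt mult_ac)
  qed simp
  have ptab: "ev (ptab ! i) = g ^ i" if "i < 80" for i
    using pw[of i 80 "(1, 0, 0, 0)"] that by (simp only: ptab_def) (simp add: ev_def)
  have same3: "ev u + of_int s * ev v = ev w" if "same3 u v w s" for u v w s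
  proof (cases u; cases v; cases w)
    fix a b c d a' b' c' d' x y z t assume *: "u = (a, b, c, d)" "v = (a', b', c', d')" "w = (x, y, z, t)"
    then have "of_int (a + s * a' - x) = (0::'b)" "of_int (b + s * b' - y) = (0::'b)" "of_int (c + s * c' - z) = (0::'b)"
      "of_int (d + s * d' - t) = (0::'b)" using that by (auto intro: of_int_0 simp del: of_int_add of_int_diff of_int_mult)
    then have "of_int x = (of_int a + of_int s * of_int a' :: 'b)" "of_int y = (of_int b + of_int s * of_int b' :: 'b)"
      "of_int z = (of_int c + of_int s * of_int c' :: 'b)" "of_int t = (of_int d + of_int s * of_int d' :: 'b)"
      by (simp_all add: algebra_simps)
    then show "ev u + of_int s * ev v = ev w" by (simp add: * ev_def algebra_simps)
  qed
  have reps: "length l = 4" "\<And>i. i \<in> set l \<Longrightarrow> i < 80" "g ^ (l ! 0) + g ^ (l ! 1) = g ^ (l ! 2)" "g ^ (l ! 0) - g ^ (l ! 1) = g ^ (l ! 3)"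
    if l: "l \<in> set orbit_reps" for l
  proof -
    show len: "length l = 4" and b: "\<And>i. i \<in> set l \<Longrightarrow> i < 80" using orbit_reps_bounds(2) l by (auto simp: list_all_iff)
    have b': "l ! 0 < 80" "l ! 1 < 80" "l ! 2 < 80" "l ! 3 < 80" using b len by auto
    have "same3 (ptab ! (l ! 0)) (ptab ! (l ! 1)) (ptab ! (l ! 2)) 1" "same3 (ptab ! (l ! 0)) (ptab ! (l ! 1)) (ptab ! (l ! 3)) (-1)"
      using reps_are_lines l unfolding list_all_iff by blast+
    from same3[OF this(1)] same3[OF this(2)] b'
    show "g ^ (l ! 0) + g ^ (l ! 1) = g ^ (l ! 2)" "g ^ (l ! 0) - g ^ (l ! 1) = g ^ (l ! 3)" by (simp_all add: ptab)
  qed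
  have ev1: "ev (1, 0, 0, 0) = 1" "ev (0, 0, 0, 0) = 0" "ev (2, 1, 0, 2) = 2 + g + 2 * g ^ 3" by (simp_all add: ev_def)
  have g40: "g ^ 40 = - 1" using same3[OF ptab40] by (simp add: ptab ev1 eq_neg_iff_add_eq_0)
  have two: "(2::'b) = - 1" using three by (simp add: eq_neg_iff_add_eq_0)
  have two0: "(2::'b) \<noteq> 0" unfolding two by simp
  have g80: "g ^ 80 = 1"
  proof -
    have "g ^ 80 = (g ^ 40) ^ 2" by (simp flip: power_mult)
    then show ?thesis by (simp add: g40)
  qed
  (* The table turns \<open>g ^ 16 = 1\<close> into a cubic relation for \<open>g\<close>, which together with
     \<open>g ^ 4 = 1 - g\<close> reduces to \<open>2 * g = 0\<close>. *)
  have g16: "g ^ 16 \<noteq> 1"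
  proof
    assume "g ^ 16 = 1"
    have "same3 (ptab ! 16) (0, 0, 0, 0) (2, 1, 0, 2) 1" by (simp add: ptab_eval)
    from same3[OF this] have "g ^ 16 = 2 + g + 2 * g ^ 3" by (simp add: ptab ev1)
    with \<open>g ^ 16 = 1\<close> have "2 * g ^ 3 + g + 1 = 0" by (metis add.commute add.left_commute add_cancel_left_left one_add_one)
    moreover have "g ^ 3 = 3 * g ^ 3 + (g + 1) - (2 * g ^ 3 + g + 1)" by (simp add: algebra_simps)
    ultimately have g3: "g ^ 3 = g + 1" by (simp only: three) simp
    have "g ^ 4 = g * g ^ 3" by (simp flip: power_Suc)
    then have g4: "g * (g + 1) = 1 - g" unfolding g g3 by (rule sym)
    then have "g * g = 1 + g - 3 * g" by (simp add: algebra_simps)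
    then have g2': "g * g = 1 + g" by (simp only: three) simp
    have "g ^ 3 = g * (1 + g)" by (simp add: power3_eq_cube mult.assoc g2')
    also have "\<dots> = 1 - g" using g4 by (simp add: add.commute)
    finally have "g + 1 = 1 - g" using g3 by simp
    then have "2 * g = 0" by (simp add: algebra_simps)
    then show False using g0 two0 by simp
  qed
  have no_period: "g ^ n \<noteq> 1" if pos: "0 < n" "n < 80" for n
  proof
    assume n: "g ^ n = 1"
    obtain x y where xy: "n * x = 80 * y + gcd n 80" using bezout_nat[of n 80] pos by blast
    have "g ^ (n * x) = 1" "g ^ (80 * y) = 1" using n g80 by (simp_all add: power_mult)
    then have d: "g ^ gcd n 80 = 1" unfolding xy power_add by simp
    have "gcd n 80 dvd 80" by simp
    moreover have "gcd n 80 < 80" using pos gcd_le1_nat[of n 80] by linarith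
    ultimately have "gcd n 80 dvd 40 \<or> gcd n 80 dvd 16" by (rule proper_divisors_80)
    then have "g ^ 40 = 1 \<or> g ^ 16 = 1" using d by (metis dvdE power_mult power_one)
    then have "1 = (- 1 :: 'b)" using g40 g16 by simp
    then show False using two0 by (simp add: eq_neg_iff_add_eq_0)
  qed
  have gmod: "g ^ n = g ^ (n mod 80)" for n
  proof -
    have "g ^ n = g ^ (80 * (n div 80) + n mod 80)" by simp
    then show ?thesis unfolding power_add power_mult g80 by simp
  qed
  have inj80: "inj_on (\<lambda>n. g ^ n) {..<80}"
  proof (rule linorder_inj_onI)
    fix i j :: nat assume ij: "i < j" "i \<in> {..<80}" "j \<in> {..<80}"
    have "g ^ j = g ^ i * g ^ (j - i)" using ij by (simp flip: power_add)
    then show "g ^ i \<noteq> g ^ j" using no_period[of "j - i"] ij g0 by auto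
  qed auto
  have ord: "m mod 80 = n mod 80" if "g ^ m = g ^ n" for m n
    using inj_onD[OF inj80, of "m mod 80" "n mod 80"] that gmod[of m] gmod[of n] by simp
  have ord40: "m mod 40 = n mod 40" if "g ^ m = g ^ n \<or> g ^ m = - (g ^ n)" for m n
  proof -
    have "(g ^ m)\<^sup>2 = (g ^ n)\<^sup>2" using that by auto
    then have "g ^ (2 * m) = g ^ (2 * n)" by (simp add: power_mult mult.commute[of 2])
    then have "2 * m mod 80 = 2 * n mod 80" by (rule ord)
    then show ?thesis using mult_mod_right[of 2 m 40] mult_mod_right[of 2 n 40] by simp
  qed
  have \<sigma>3: "\<sigma> x = x ^ 3" for x unfolding \<sigma>_def by (simp only: q)
  have qp: "q ^ 4 = 81" "q\<^sup>2 = 9" "(q + 1) * q = 12" using q by simp_all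
  note cF = trans[OF card_F qp(1)] and cFq = trans[OF card_Fq q]
  have K9: "z \<in> K \<longleftrightarrow> z ^ 9 = z" for z by (simp add: K_def \<sigma>3 flip: power_mult)
  have F81: "z \<in> F \<longleftrightarrow> z ^ 81 = z" for z by (simp add: F_def \<sigma>3 flip: power_mult)
  have gF: "g ^ n \<in> F" for n
  proof -
    have "(g ^ n) ^ 81 = (g ^ 80) ^ n * g ^ n" by (simp add: algebra_simps flip: power_mult power_add)
    then show ?thesis by (simp add: F81 g80)
  qed
  have Fg: "\<exists>n<80. z = g ^ n" if "z \<in> F" "z \<noteq> 0" for z
  proof -
    have "(\<lambda>n. g ^ n) ` {..<80} = F - {0}"
      by (rule card_subset_eq) (use gF g0 cF in \<open>auto simp: card_image[OF inj80]\<close>)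
    then have "z \<in> (\<lambda>n. g ^ n) ` {..<80}" using that by simp
    then show ?thesis by auto
  qed
  have Fq3: "Fq = {0, 1, - 1}"
  proof (rule card_subset_eq[symmetric])
    have "(1::'b) \<noteq> - 1" using two0 by (simp add: eq_neg_iff_add_eq_0)
    then show "card {0, 1, - 1 :: 'b} = card Fq" by (simp add: cFq)
  qed auto
  have Kl: "m mod 10 = n mod 10" if "g ^ m \<in> sf.Kline (g ^ n)" for m n
  proof -
    obtain z where z: "z \<in> K" "g ^ m = z * g ^ n" using \<open>g ^ m \<in> sf.Kline (g ^ n)\<close> by (auto simp: sf.Kline_def)
    have "z \<noteq> 0" using z g0 by auto
    have "z ^ 8 * z = 1 * z" using z(1) unfolding K9 by (simp flip: power_Suc2)
    then have "z ^ 8 = 1" using \<open>z \<noteq> 0\<close> by (metis mult_right_cancel)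
    then have "(g ^ m) ^ 8 = (g ^ n) ^ 8" unfolding z(2) by (simp add: power_mult_distrib)
    then have "g ^ (8 * m) = g ^ (8 * n)" by (simp add: power_mult mult.commute[of 8])
    then have "8 * m mod 80 = 8 * n mod 80" by (rule ord)
    then show ?thesis using mult_mod_right[of 8 m 10] mult_mod_right[of 8 n 10] by simp
  qed
  (* The translate by \<open>g ^ (4 * s)\<close> of the line that \<open>l\<close> represents. *)
  define LS where "LS l s = (\<lambda>(r, t). g ^ (4 * s) * (r * g ^ (l ! 0) + t * g ^ (l ! 1))) ` (Fq \<times> Fq)" for l :: "nat list" and s
  have LSI: "g ^ (4 * s) * (r * g ^ (l ! 0) + t * g ^ (l ! 1)) \<in> LS l s" if "r \<in> Fq" "t \<in> Fq" for r t l s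
    unfolding LS_def using that by (intro image_eqI[of _ _ "(r, t)"]) auto
  have LS_comb: "r * x + t * y \<in> LS l s" if rt: "r \<in> Fq" "t \<in> Fq" and xy: "x \<in> LS l s" "y \<in> LS l s" for r t x y l s
  proof -
    obtain a b where a: "a \<in> Fq" "b \<in> Fq" "x = g ^ (4 * s) * (a * g ^ (l ! 0) + b * g ^ (l ! 1))" using xy(1) by (auto simp: LS_def)
    obtain c d where c: "c \<in> Fq" "d \<in> Fq" "y = g ^ (4 * s) * (c * g ^ (l ! 0) + d * g ^ (l ! 1))" using xy(2) by (auto simp: LS_def)
    have "r * x + t * y = g ^ (4 * s) * ((r * a + t * c) * g ^ (l ! 0) + (r * b + t * d) * g ^ (l ! 1))"
      by (simp add: a c algebra_simps)
    then show ?thesis using LSI[of "r * a + t * c" "r * b + t * d" s l] rt a c by simp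
  qed
  have LS_mem: "g ^ (4 * s + i) \<in> LS l s" if l: "l \<in> set orbit_reps" "i \<in> set l" for i l s
  proof -
    have "\<exists>k<4. i = l ! k" using that reps(1)[OF l(1)] by (metis in_set_conv_nth)
    then have "i = l ! 0 \<or> i = l ! 1 \<or> i = l ! 2 \<or> i = l ! 3" by (auto simp: numeral_eq_Suc less_Suc_eq)
    then have "\<exists>r\<in>Fq. \<exists>t\<in>Fq. g ^ i = r * g ^ (l ! 0) + t * g ^ (l ! 1)"
      using reps(3,4)[OF l(1)] by (elim disjE) (auto simp: Fq3)
    then obtain r t where rt: "r \<in> Fq" "t \<in> Fq" "g ^ i = r * g ^ (l ! 0) + t * g ^ (l ! 1)" by blast
    show ?thesis using LSI[OF rt(1,2), of s l] by (simp add: power_add rt(3))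
  qed
  have LS_pt: "\<exists>i\<in>set l. z = g ^ (4 * s + i) \<or> z = - (g ^ (4 * s + i))" if l: "l \<in> set orbit_reps" and z: "z \<in> LS l s" "z \<noteq> 0" for l s z
  proof -
    obtain r t where rt: "r \<in> Fq" "t \<in> Fq" "z = g ^ (4 * s) * (r * g ^ (l ! 0) + t * g ^ (l ! 1))" using z by (auto simp: LS_def)
    have mem: "l ! 0 \<in> set l" "l ! 1 \<in> set l" "l ! 2 \<in> set l" "l ! 3 \<in> set l" using reps(1)[OF l] by auto
    have "\<exists>i\<in>set l. r * g ^ (l ! 0) + t * g ^ (l ! 1) = g ^ i \<or> r * g ^ (l ! 0) + t * g ^ (l ! 1) = - (g ^ i)"
      using rt(1,2) z(2) mem rt(3) unfolding Fq3
      by (auto intro: bexI[OF _ mem(1)] bexI[OF _ mem(2)] bexI[OF _ mem(3)] bexI[OF _ mem(4)] simp: reps(3,4)[OF l, symmetric])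
    then show ?thesis unfolding rt(3) by (auto simp: power_add)
  qed
  have LS_10: "LS l (s + 10) = LS l s" for l s
  proof -
    have *: "g ^ (4 * (s + 10)) = - (g ^ (4 * s))" using g40 by (simp add: power_add algebra_simps)
    have "LS l (s + 10) \<subseteq> LS l s"
      unfolding LS_def * by (auto intro!: image_eqI[of _ _ "(- _, - _)"] simp: algebra_simps)
    moreover have "LS l s \<subseteq> LS l (s + 10)"
      unfolding LS_def * by (auto intro!: image_eqI[of _ _ "(- _, - _)"] simp: algebra_simps)
    ultimately show ?thesis by blast
  qed
  have LS_mod: "LS l s = LS l (s mod 10)" for l s
  proof (induction s rule: less_induct)
    case (less s)
    show ?case
    proof (cases "s < 10")
      case False
      then have "LS l s = LS l (s - 10)" using LS_10[of l "s - 10"] by simp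
      also have "\<dots> = LS l ((s - 10) mod 10)" using less[of "s - 10"] False by simp
      finally show ?thesis using False by (simp add: le_mod_geq)
    qed simp
  qed
  have LS_card: "finite (LS l s)" "card (LS l s) \<le> 9" for l s
  proof -
    show "finite (LS l s)" by (simp add: LS_def)
    show "card (LS l s) \<le> 9" unfolding LS_def
      using card_image_le[of "Fq \<times> Fq"] by (simp add: card_cartesian_product cFq)
  qed
  define \<Gamma> where "\<Gamma> = ({..<10::nat} \<times> {..<4::nat}) \<times> {..<3::nat}"
  define \<tau> where "\<tau> p = (case p of ((h, j), c) \<Rightarrow> sf.Kline (g ^ (4 * h + j div 2)))" for p :: "(nat \<times> nat) \<times> nat"
  define S where "S p = (case p of ((h, j), c) \<Rightarrow> {LS (orbit_reps ! r) (k + h) | r k. (r, k) \<in> set (base_spreads ! j)})" for p :: "(nat \<times> nat) \<times> nat"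
  have base: "r < 12" "k < 10" "orbit_reps ! r \<in> set orbit_reps" if "j < 4" "(r, k) \<in> set (base_spreads ! j)" for r k j
    using base_spreads_range[OF that(1)] that(2) orbit_reps_bounds(1) by (auto simp: list_all_iff)
  have "plane_design \<Gamma> \<tau> S" unfolding plane_design_def
  proof (intro conjI ballI allI impI)
    show "finite \<Gamma>" by (simp add: \<Gamma>_def)
  next
    fix p assume "p \<in> \<Gamma>"
    then show "\<tau> p \<in> sf.Klines F" using gF g0 by (auto simp: \<tau>_def sf.Klines_def split: prod.split)
  next
    fix t
    show "card {p \<in> \<Gamma>. \<tau> p = t} \<le> (q + 1) * q"
    proof (cases "\<exists>p\<in>\<Gamma>. \<tau> p = t")
      case True
      then obtain h0 j0 where t: "t = sf.Kline (g ^ (4 * h0 + j0 div 2))" by (auto simp: \<tau>_def \<Gamma>_def)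
      define r where "r = (4 * h0 + j0 div 2) mod 10"
      have "{p \<in> \<Gamma>. \<tau> p = t} \<subseteq> set (positions r) \<times> {..<3}"
      proof
        fix p assume "p \<in> {p \<in> \<Gamma>. \<tau> p = t}"
        then obtain h j c where p: "p = ((h, j), c)" "h < 10" "j < 4" "c < 3" "sf.Kline (g ^ (4 * h + j div 2)) = t"
          by (auto simp: \<tau>_def \<Gamma>_def)
        have "g ^ (4 * h + j div 2) \<in> sf.Kline (g ^ (4 * h0 + j0 div 2))"
          using sf.Kline_self[of "g ^ (4 * h + j div 2)"] p t by simp
        then have "(4 * h + j div 2) mod 10 = r" unfolding r_def by (rule Kl)
        moreover have "h \<in> set [0, 1, 2, 3, 4, 5, 6, 7, 8, 9]" "j \<in> set [0, 1, 2, 3]" using p by auto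
        ultimately have "(h, j) \<in> set (positions r)"
          unfolding positions_def set_filter set_product mem_Collect_eq case_prod_conv mem_Sigma_iff by (intro conjI)
        then show "p \<in> set (positions r) \<times> {..<3}" using p by simp
      qed
      then have "card {p \<in> \<Gamma>. \<tau> p = t} \<le> card (set (positions r) \<times> {..<3::nat})" by (intro card_mono) auto
      also have "\<dots> \<le> length (positions r) * 3" by (simp add: card_cartesian_product card_length)
      also have "\<dots> \<le> 4 * 3" using positions[of r] by (simp add: r_def)
      finally show ?thesis unfolding qp by simp
    next
      case False
      then have "{p \<in> \<Gamma>. \<tau> p = t} = {}" by auto
      then show ?thesis by (simp only: card.empty)
    qed
  next
    fix p m assume p: "p \<in> \<Gamma>" "m \<in> S p"
    obtain h j c where hj: "p = ((h, j), c)" "j < 4" using p by (auto simp: \<Gamma>_def)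
    obtain r k where rk: "(r, k) \<in> set (base_spreads ! j)" "m = LS (orbit_reps ! r) (k + h)" using p hj by (auto simp: S_def)
    show "\<not> sf.meets m (\<tau> p)"
    proof
      assume "sf.meets m (\<tau> p)"
      then obtain x where x: "x \<in> m" "x \<in> sf.Kline (g ^ (4 * h + j div 2))" "x \<noteq> 0" by (auto simp: sf.meets_def \<tau>_def hj)
      obtain i where i: "i \<in> set (orbit_reps ! r)" "x = g ^ (4 * (k + h) + i) \<or> x = - (g ^ (4 * (k + h) + i))"
        using LS_pt[OF base(3)[OF hj(2) rk(1)], of x "k + h"] x rk by auto
      have "g ^ (4 * (k + h) + i) = x \<or> g ^ (4 * (k + h) + i) = - x" using i(2) by auto
      moreover have "- x \<in> sf.Kline (g ^ (4 * h + j div 2))" using x(2)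
        by (auto simp: sf.Kline_def image_iff intro!: bexI[of _ "- _"])
      ultimately have "g ^ (4 * (k + h) + i) \<in> sf.Kline (g ^ (4 * h + j div 2))" using x(2) by auto
      then have "(4 * (k + h) + i) mod 10 = (4 * h + j div 2) mod 10" by (rule Kl)
      then have "(4 * h + (i + 4 * k)) mod 10 = (4 * h + j div 2) mod 10" by (simp add: algebra_simps)
      then have "(i + 4 * k) mod 10 = (j div 2) mod 10" by (rule mod_add_cancel)
      then have "(i + 4 * k) mod 10 = j div 2" using hj(2) by simp
      moreover have "(i + 4 * k) mod 40 \<in> set (logs (r, k))" using i(1) by (simp add: logs_def)
      then have "(i + 4 * k) mod 40 mod 10 \<noteq> j div 2"
        using base_spreads_disjoint[OF hj(2)] rk(1) unfolding list_all_iff by auto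
      then have "(i + 4 * k) mod 10 \<noteq> j div 2" by (simp add: mod_mod_cancel)
      ultimately show False by simp
    qed
  next
    fix p m m' assume p: "p \<in> \<Gamma>" "m \<in> S p" "m' \<in> S p" "sf.meets m m'"
    obtain h j c where hj: "p = ((h, j), c)" "j < 4" using p by (auto simp: \<Gamma>_def)
    obtain r k where rk: "(r, k) \<in> set (base_spreads ! j)" "m = LS (orbit_reps ! r) (k + h)" using p hj by (auto simp: S_def)
    obtain r' k' where rk': "(r', k') \<in> set (base_spreads ! j)" "m' = LS (orbit_reps ! r') (k' + h)" using p hj by (auto simp: S_def)
    obtain x where x: "x \<in> m" "x \<in> m'" "x \<noteq> 0" using p(4) by (auto simp: sf.meets_def)
    obtain i where i: "i \<in> set (orbit_reps ! r)" "x = g ^ (4 * (k + h) + i) \<or> x = - (g ^ (4 * (k + h) + i))"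
      using LS_pt[OF base(3)[OF hj(2) rk(1)], of x "k + h"] x rk by auto
    obtain i' where i': "i' \<in> set (orbit_reps ! r')" "x = g ^ (4 * (k' + h) + i') \<or> x = - (g ^ (4 * (k' + h) + i'))"
      using LS_pt[OF base(3)[OF hj(2) rk'(1)], of x "k' + h"] x rk' by auto
    have "(4 * (k + h) + i) mod 40 = (4 * (k' + h) + i') mod 40" by (rule ord40) (use i(2) i'(2) in \<open>metis minus_minus\<close>)
    then have "(4 * h + (i + 4 * k)) mod 40 = (4 * h + (i' + 4 * k')) mod 40" by (simp add: algebra_simps)
    then have "(i + 4 * k) mod 40 = (i' + 4 * k') mod 40" by (rule mod_add_cancel)
    moreover have "(i + 4 * k) mod 40 \<in> set (logs (r, k))" "(i' + 4 * k') mod 40 \<in> set (logs (r', k'))"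
      using i(1) i'(1) by (simp_all add: logs_def)
    ultimately have "set (logs (r, k)) \<inter> set (logs (r', k')) \<noteq> {}" by auto
    moreover have "logs (r, k) \<in> set (map logs (base_spreads ! j))" "logs (r', k') \<in> set (map logs (base_spreads ! j))"
      using rk rk' by auto
    ultimately have "logs (r, k) = logs (r', k')"
      using base_spreads_disjoint[OF hj(2)] unfolding distinct_concat_iff by blast
    then have "(r, k) = (r', k')" using inj_onD[OF base_spreads_inj[OF hj(2)]] rk(1) rk'(1) by blast
    then show "m = m'" using rk rk' by simp
  next
    fix m assume m: "m \<in> sf.oblique F"
    obtain \<psi> where \<psi>: "sf.embedding \<psi>" "m = \<psi> ` K" and mF: "m \<subseteq> F" and lm: "sf.line m"
      using m by (auto simp: sf.oblique_def sf.line_def)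
    obtain \<omega> where w: "\<omega> \<in> K" "\<omega> \<notin> Fq" by (rule obtain_\<omega>)
    have w0: "\<omega> \<noteq> 0" using w by auto
    have ab: "\<psi> 1 \<in> F" "\<psi> \<omega> \<in> F" using mF w by (auto simp: \<psi>)
    have n0: "\<psi> 1 \<noteq> 0" "\<psi> \<omega> \<noteq> 0" using sf.embedding_0_iff[OF \<psi>(1)] w w0 by auto
    obtain x y where x: "x < 80" "\<psi> 1 = g ^ x" and y: "y < 80" "\<psi> \<omega> = g ^ y" using Fg ab n0 by metis
    have xy10: "\<not> 10 dvd y + 80 - x"
    proof
      assume "10 dvd y + 80 - x"
      then obtain n where n: "y + 80 - x = 10 * n" by (rule dvdE)
      have "(g ^ (10 * n)) ^ 9 = (g ^ 80) ^ n * g ^ (10 * n)" by (simp flip: power_mult power_add)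
      then have "g ^ (10 * n) \<in> K" by (simp add: K9 g80)
      moreover have "g ^ y = g ^ (10 * n) * g ^ x"
      proof -
        have "10 * n + x = y + 80" using n x(1) by linarith
        then have "g ^ (10 * n) * g ^ x = g ^ (y + 80)" by (simp only: power_add[symmetric])
        then show ?thesis by (simp add: power_add g80)
      qed
      ultimately have "\<psi> \<omega> \<in> sf.Kline (\<psi> 1)" unfolding x y sf.Kline_def by auto
      then show False using sf.oblique_indep[OF \<psi>(1) _ w] m \<psi>(2) by blast
    qed
    (* Find a representative \<open>l\<close> with points in the same relative position as \<open>\<psi> 1\<close> and \<open>\<psi> \<omega>\<close>, and
       the translation \<open>s\<close>; adding 80 keeps the differences of exponents nonnegative. *)
    define d where "d = (y + 80 - x) mod 40"
    have "d mod 10 \<noteq> 0" using xy10 unfolding d_def by (simp add: mod_mod_cancel dvd_eq_mod_eq_0)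
    then have "(x mod 4, d) \<in> set pair_keys" by (intro pair_keys) (auto simp: d_def)
    then obtain l y1 z1 where l: "l \<in> set orbit_reps" "y1 \<in> set l" "z1 \<in> set l" "x mod 4 = y1 mod 4" "d = (z1 + 80 - y1) mod 40"
      by (auto simp: pair_keys_def)
    obtain r where r: "r < 12" "l = orbit_reps ! r" using l(1) orbit_reps_bounds(1) by (auto simp: in_set_conv_nth)
    have y180: "y1 < 80" using reps(2)[OF l(1,2)] .
    define s where "s = (x + 80 - y1) div 4"
    have mod80: "(a + 80) mod 40 = a mod (40::nat)" for a using mod_mult_self1[of a 2 40] by simp
    have "4 dvd x + 80 - y1"
    proof -
      have "(x + 80) mod 4 = y1 mod 4" using l(4) mod_mult_self1[of x 20 4] by simp
      then show ?thesis using y180 mod_eq_dvd_iff_nat[of y1 "x + 80" 4] by simp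
    qed
    then have "4 * s = x + 80 - y1" unfolding s_def by (rule dvd_mult_div_cancel)
    then have 4: "4 * s + y1 = x + 80" using y180 by linarith
    then have s1: "(4 * s + y1) mod 40 = x mod 40" by (simp only: mod80)
    have "4 * s + z1 = (z1 + 80 - y1) + x" using 4 y180 by linarith
    also have "\<dots> mod 40 = ((y + 80 - x) + x) mod 40" using l(5) unfolding d_def by (intro mod_add_cong) simp_all
    also have "(y + 80 - x) + x = y + 80" using x(1) by simp
    finally have s2: "(4 * s + z1) mod 40 = y mod 40" by (simp only: mod80)
    have sgn: "g ^ a = g ^ b \<or> g ^ a = - (g ^ b)" if "a mod 40 = b mod 40" for a b
    proof -
      have *: "g ^ a = g ^ (a mod 40) \<or> g ^ a = - (g ^ (a mod 40))" for a
      proof -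
        have "g ^ a = g ^ (40 * (a div 40) + a mod 40)" by simp
        then show ?thesis unfolding power_add power_mult g40 by (cases "even (a div 40)") auto
      qed
      show ?thesis using *[of a] *[of b] that by auto
    qed
    have in_LS: "g ^ a \<in> LS l s" if "a mod 40 = (4 * s + i) mod 40" "i \<in> set l" for a i
      using sgn[OF that(1)] LS_mem[OF l(1) that(2), of s] LS_comb[of "- 1" 0 "g ^ (4 * s + i)" l s "g ^ (4 * s + i)"] by auto
    have "m \<subseteq> LS l s"
    proof
      fix z assume "z \<in> m"
      then obtain u where u: "u \<in> K" "z = \<psi> u" using \<psi> by auto
      obtain a b where ab: "a \<in> Fq" "b \<in> Fq" "u = a + b * \<omega>" using K_basis[OF w u(1)] by auto
      have "z = a * g ^ x + b * g ^ y"
        using ab u w sf.embedding_add[OF \<psi>(1), of a "b * \<omega>"] sf.embedding_scale[OF \<psi>(1), of a 1]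
          sf.embedding_scale[OF \<psi>(1), of b \<omega>] x(2) y(2) by simp
      moreover have "g ^ x \<in> LS l s" "g ^ y \<in> LS l s" using in_LS[of x y1] in_LS[of y z1] s1 s2 l by simp_all
      ultimately show "z \<in> LS l s" using LS_comb ab by simp
    qed
    moreover have "card m = 9" using trans[OF sf.line_card[OF lm] qp(2)] .
    ultimately have mLS: "m = LS l s" using LS_card by (intro card_seteq) auto
    define A where "A = set (occurrences r) \<times> {..<3::nat}"
    have cA: "card A = 9" using occurrences[OF r(1)] by (simp add: A_def card_cartesian_product distinct_card)
    (* An occurrence of the orbit in the set \<open>j\<close> with offset \<open>k\<close> reaches \<open>m\<close> by the translation \<open>s - k\<close>. *)
    define \<theta> where "\<theta> a = (((s + 10 - snd (fst a)) mod 10, fst (fst a)), snd a)" for a :: "(nat \<times> nat) \<times> nat"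
    have occ: "j < 4 \<and> (r, k) \<in> set (base_spreads ! j) \<and> k < 10" if "(j, k) \<in> set (occurrences r)" for j k
      using occurrences_mem[OF that] base(2) by blast
    have "inj_on \<theta> A"
    proof (rule inj_onI)
      fix a b assume "a \<in> A" "b \<in> A" "\<theta> a = \<theta> b"
      moreover obtain j k c j' k' c' where "a = ((j, k), c)" "b = ((j', k'), c')" by (metis surj_pair)
      ultimately have "j = j'" "c = c'" "k < 10" "k' < 10" "(s + 10 - k) mod 10 = (s + 10 - k') mod 10"
        using occ by (auto simp: A_def \<theta>_def)
      moreover have "k = k'"
      proof -
        have "((s + 10 - k') + k) mod 10 = ((s + 10 - k) + k) mod 10"
          using \<open>(s + 10 - k) mod 10 = (s + 10 - k') mod 10\<close> by (intro mod_add_cong) simp_all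
        also have "(s + 10 - k) + k = (s + 10 - k') + k'" using \<open>k < 10\<close> \<open>k' < 10\<close> by simp
        finally have "k mod 10 = k' mod 10" by (rule mod_add_cancel)
        then show ?thesis using \<open>k < 10\<close> \<open>k' < 10\<close> by simp
      qed
      ultimately show "a = b" using \<open>a = _\<close> \<open>b = _\<close> by simp
    qed
    moreover have "\<theta> ` A \<subseteq> {p \<in> \<Gamma>. m \<in> S p}"
    proof
      fix p assume "p \<in> \<theta> ` A"
      then obtain j k c where a: "(j, k) \<in> set (occurrences r)" "c < 3" "p = \<theta> ((j, k), c)" by (auto simp: A_def)
      have jk: "j < 4" "(r, k) \<in> set (base_spreads ! j)" "k < 10" using occ[OF a(1)] by auto
      define h where "h = (s + 10 - k) mod 10"
      have "(k + h) mod 10 = (k + (s + 10 - k)) mod 10" unfolding h_def by (rule mod_add_right_eq)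
      then have "(k + h) mod 10 = s mod 10" using jk(3) by simp
      then have "m = LS (orbit_reps ! r) (k + h)" using LS_mod[of l s] LS_mod[of l "k + h"] mLS r by simp
      moreover have p: "p = ((h, j), c)" using a by (simp add: \<theta>_def h_def)
      ultimately have "m \<in> S p" using jk(2) by (auto simp: S_def)
      moreover have "p \<in> \<Gamma>" using p a jk by (simp add: \<Gamma>_def h_def)
      ultimately show "p \<in> {p \<in> \<Gamma>. m \<in> S p}" by simp
    qed
    ultimately have "card A \<le> card {p \<in> \<Gamma>. m \<in> S p}" by (intro card_inj_on_le) (auto simp: \<Gamma>_def)
    then show "q\<^sup>2 \<le> card {p \<in> \<Gamma>. m \<in> S p}" unfolding cA qp .
  qed
  then show ?thesis by blast
qed

end

section \<open>The chromatic index\<close>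
context kmodule
begin

lemma card_Klines_le:
  assumes Q: "Ksubspace Q" and fin: "finite Q"
  shows "card (Klines Q) * (q\<^sup>2 - 1) \<le> card Q - 1"
proof -
  have "card (\<Union>t\<in>Klines Q. t - {0}) = (\<Sum>t\<in>Klines Q. card (t - {0}))"
  proof (rule card_UN_disjoint)
    show "finite (Klines Q)" using fin by (simp add: Klines_def)
    show "\<forall>t\<in>Klines Q. finite (t - {0})" by (auto simp: Klines_def Kline_def)
    show "\<forall>t\<in>Klines Q. \<forall>t'\<in>Klines Q. t \<noteq> t' \<longrightarrow> (t - {0}) \<inter> (t' - {0}) = {}"
    proof (intro ballI impI)
      fix t t' assume t: "t \<in> Klines Q" "t' \<in> Klines Q" "t \<noteq> t'"
      then show "(t - {0}) \<inter> (t' - {0}) = {}" using Klines_eq[OF t(1)] Klines_eq[OF t(2)] by blast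
    qed
  qed
  also have "\<dots> = (\<Sum>t\<in>Klines Q. q\<^sup>2 - 1)"
  proof (rule sum.cong[OF refl])
    fix t assume "t \<in> Klines Q"
    then obtain x where x: "x \<noteq> 0" "t = Kline x" by (auto simp: Klines_def)
    have "0 \<in> t" unfolding x Kline_def by (rule image_eqI[of _ _ 0]) auto
    then show "card (t - {0}) = q\<^sup>2 - 1" using line_card[OF line_Kline[OF x(1)]] x by (simp add: card_Diff_singleton)
  qed
  finally have "card (\<Union>t\<in>Klines Q. t - {0}) = card (Klines Q) * (q\<^sup>2 - 1)" by simp
  moreover have "(\<Union>t\<in>Klines Q. t - {0}) \<subseteq> Q - {0}"
    using Ksubspace_closed(3)[OF Q] by (auto simp: Klines_def Kline_def)
  then have "card (\<Union>t\<in>Klines Q. t - {0}) \<le> card (Q - {0})" using fin by (intro card_mono) auto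
  ultimately show ?thesis using Ksubspace_closed(1)[OF Q] by (simp add: card_Diff_singleton)
qed

end

context split_kmodule
begin

lemma card_colours:
  assumes fin: "finite Q" and card_Q: "card Q = q ^ (n - 1)" and n: "n \<ge> 1"
  shows "finite colours" and "card colours * (q - 1) \<le> q ^ n - 1"
proof -
  have finK: "finite (Klines Q)" using fin by (simp add: Klines_def)
  then show "finite colours" by (simp add: colours_def)
  have "card colours = 1 + card (Klines Q) * ((q + 1) * q)"
    using finK by (simp add: colours_def card_image card_cartesian_product card_I)
  then have "card colours * (q - 1) = (q - 1) + q * (card (Klines Q) * ((q + 1) * (q - 1)))"
    by (simp add: algebra_simps)
  also have "(q + 1) * (q - 1) = q\<^sup>2 - 1" using q3 by (simp add: power2_eq_square algebra_simps)
  also have "(q - 1) + q * (card (Klines Q) * (q\<^sup>2 - 1)) \<le> (q - 1) + q * (q ^ (n - 1) - 1)"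
    using card_Klines_le[OF Q fin] card_Q by simp
  also have "\<dots> = q ^ n - 1"
  proof -
    have "q ^ n = q * q ^ (n - 1)" using n by (simp add: power_eq_if)
    moreover have "q ^ (n - 1) \<ge> 1" using q3 by simp
    ultimately show ?thesis using q3 by (simp add: right_diff_distrib')
  qed
  finally show "card colours * (q - 1) \<le> q ^ n - 1" .
qed

end

lemma finite_field_power:
  fixes x :: "'a::{field,finite}"
  shows "x ^ CARD('a) = x"
proof (cases "x = 0")
  case False
  have "bij_betw (\<lambda>y. x * y) (UNIV - {0}) (UNIV - {0})"
    by (rule bij_betw_byWitness[of _ "\<lambda>y. y / x"]) (use False in auto)
  then have "(\<Prod>y\<in>UNIV - {0}. x * y) = \<Prod>(UNIV - {0})"
    by (rule prod.reindex_bij_betw)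
  then have "x ^ (CARD('a) - 1) * \<Prod>(UNIV - {0::'a}) = \<Prod>(UNIV - {0})"
    by (simp add: prod.distrib card_Diff_singleton)
  then have "x ^ (CARD('a) - 1) = 1" by simp
  moreover have "x ^ CARD('a) = x * x ^ (CARD('a) - 1)" by (simp add: power_eq_if)
  ultimately show ?thesis by simp
qed simp

text \<open>
  The sum of all elements of the field does not change when 1 is added to each of them, hence \<open>q = 0\<close> in the
  field. So the characteristic is three or two, and \<open>x \<mapsto> x\<^sup>q\<close> is the cube map or an iterate of squaring.
\<close>
lemma frobenius_alg_closure:
  assumes q: "q \<in> {3, 4, 8, 16}" and card: "CARD('a::{field,finite}) = q"
  shows "frobenius_field TYPE('a alg_closure) q" and "q \<noteq> 3 \<Longrightarrow> (1::'a alg_closure) + 1 = 0"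
proof -
  have "(\<Sum>x\<in>UNIV. x + 1) = (\<Sum>x\<in>UNIV. x::'a)"
    by (rule sum.reindex_bij_betw) (rule bij_betw_byWitness[of _ "\<lambda>y. y - 1"]; auto)
  then have "of_nat CARD('a) = (0::'a)" by (simp add: sum.distrib)
  then have "to_ac (of_nat q :: 'a) = 0" using card by simp
  then have q0: "of_nat q = (0::'a alg_closure)" by simp
  have two: "(1::'a alg_closure) + 1 = 0" if "q \<noteq> 3"
  proof -
    have "\<exists>k. q = 2 ^ k"
      using q that by (auto intro: exI[of _ 2] exI[of _ 3] exI[of _ 4])
    then obtain k where k: "q = 2 ^ k" ..
    have "(2::'a alg_closure) ^ k = 0" using q0 unfolding k by simp
    then have "(2::'a alg_closure) = 0" by simp
    then show ?thesis by simp
  qed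
  then show "q \<noteq> 3 \<Longrightarrow> (1::'a alg_closure) + 1 = 0" .
  have add: "(x + y) ^ q = x ^ q + y ^ q" for x y :: "'a alg_closure"
  proof (cases "q = 3")
    case True
    have "(x + y) ^ 3 = x ^ 3 + y ^ 3 + 3 * (x * x * y + x * y * y)" by (simp add: power3_eq_cube algebra_simps)
    moreover have "(3::'a alg_closure) = 0" using q0 True by simp
    ultimately show ?thesis using True by simp
  next
    case False
    have "(2::'a alg_closure) = 0" using two[OF False] by simp
    moreover have "(u + v)\<^sup>2 = u\<^sup>2 + v\<^sup>2 + 2 * (u * v)" for u v :: "'a alg_closure" by (simp add: power2_sum)
    ultimately have sq: "(u + v)\<^sup>2 = u\<^sup>2 + v\<^sup>2" for u v :: "'a alg_closure" by simp
    have "(x + y) ^ (2 ^ k) = x ^ (2 ^ k) + y ^ (2 ^ k)" for k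
      by (induction k) (simp_all add: power_mult sq mult.commute[of 2])
    from this[of 2] this[of 3] this[of 4] show ?thesis using q False by auto
  qed
  show "frobenius_field TYPE('a alg_closure) q"
    by unfold_locales (use q q0 add in auto)
qed

text \<open>
  The even number of coordinates is split into pairs; \<open>ev\<close> marks one member of each pair.
\<close>
lemma obtain_pairing:
  assumes "CARD('n::finite) = n + 1" and "odd n"
  obtains pr :: "'n::finite \<Rightarrow> 'n" and ev :: "'n \<Rightarrow> bool" and i0
  where "\<And>i. pr (pr i) = i" "\<And>i. ev (pr i) \<longleftrightarrow> \<not> ev i" "ev i0"
proof -
  obtain h :: "'n \<Rightarrow> nat" where h: "bij_betw h UNIV {..<n + 1}"
    using ex_bij_betw_finite_nat[of "UNIV :: 'n set"] assms(1) by (auto simp: atLeast0LessThan)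
  define sw :: "nat \<Rightarrow> nat" where "sw k = (if even k then k + 1 else k - 1)" for k
  have sw: "sw k < n + 1" if "k < n + 1" for k using that assms(2) unfolding sw_def by presburger
  have sw2: "sw (sw k) = k" "even (sw k) \<longleftrightarrow> odd k" for k unfolding sw_def by presburger+
  define hi where "hi = inv_into UNIV h"
  have hi: "h (hi k) = k" if "k < n + 1" for k
    using that h unfolding hi_def by (intro f_inv_into_f) (auto simp: bij_betw_def)
  have ih: "hi (h i) = i" for i using h unfolding hi_def by (intro inv_into_f_f) (auto simp: bij_betw_def)
  have hlt: "h i < n + 1" for i using h by (auto simp: bij_betw_def)
  show thesis
  proof (rule that)
    show "hi (sw (h (hi (sw (h i))))) = i" for i using hi[OF sw[OF hlt]] by (simp add: sw2 ih)
    show "even (h (hi (sw (h i)))) \<longleftrightarrow> \<not> even (h i)" for i using hi[OF sw[OF hlt]] by (simp add: sw2)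
    show "even (h (hi 0))" using hi[of 0] by simp
  qed
qed

lemma obtain_basis2:
  assumes "L \<in> (pg_lines :: ('a::field ^ 'n) set set)"
  obtains a b where "L = {r *s a + s *s b | r s. True}" "\<And>r s. r *s a + s *s b = 0 \<Longrightarrow> r = 0 \<and> s = 0"
proof -
  have L: "vec.subspace L" "vec.dim L = 2" using assms by (auto simp: pg_lines_def)
  obtain B where B: "B \<subseteq> L" "vec.independent B" "L \<subseteq> vec.span B" "card B = 2"
    using vec.basis_exists[of L] L(2) by auto
  obtain a b where ab: "B = {a, b}" "a \<noteq> b" using B(4) by (auto simp: card_2_iff)
  have sp: "vec.span B = L" using B L(1) by (metis vec.span_eq_iff vec.span_mono subset_antisym)
  have sp2: "vec.span {a, b} = {r *s a + s *s b | r s. True}"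
  proof (intro subset_antisym subsetI)
    fix v assume "v \<in> vec.span {a, b}"
    then obtain r where "v - r *s a \<in> vec.span {b}" using vec.span_breakdown_eq[of v a "{b}"] by auto
    then obtain s where "v - r *s a = s *s b" by (auto simp: vec.span_singleton)
    then have "v = r *s a + s *s b" by (simp add: diff_eq_eq add.commute)
    then show "v \<in> {r *s a + s *s b | r s. True}" by blast
  next
    fix v assume "v \<in> {r *s a + s *s b | r s. True}"
    then obtain r s where "v = r *s a + s *s b" by blast
    then show "v \<in> vec.span {a, b}" by (simp add: vec.span_add vec.span_scale vec.span_base)
  qed
  have ind: "r = 0 \<and> s = 0" if "r *s a + s *s b = 0" for r s
  proof -
    have "(\<Sum>v\<in>B. (if v = a then r else s) *s v) = 0" using that ab by simp
    then have "\<forall>v\<in>B. (if v = a then r else s) = 0"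
      using B(2) ab vec.independentD[of B B "\<lambda>v. if v = a then r else s"] by auto
    then show ?thesis using ab by auto
  qed
  show thesis
  proof (rule that)
    show "L = {r *s a + s *s b | r s. True}" using sp sp2 ab(1) by simp
    show "r = 0 \<and> s = 0" if "r *s a + s *s b = 0" for r s by (rule ind[OF that])
  qed
qed

text \<open>
  The scalar action of \<open>K\<close> on the coordinate space: \<open>\<omega>\<close> acts on each pair of coordinates by the companion
  matrix of its minimal polynomial over the base field. The vector space \<open>Q\<close> is given by the vanishing of
  one pair of coordinates.
\<close>
lemma parallelism:
  fixes n q :: nat
  assumes n: "odd n" and q: "q \<in> {3, 4, 8, 16}"
    and card_a: "CARD('a::{field,finite}) = q" and card_n: "CARD('n::finite) = n + 1"
  shows "\<exists>(cls :: (('a ^ 'n) set \<times> 'a alg_closure \<times> 'a alg_closure) option \<Rightarrow> ('a ^ 'n) set set) C.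
     finite C \<and> card C * (q - 1) \<le> q ^ n - 1 \<and>
     (\<forall>L\<in>pg_lines. \<exists>c\<in>C. L \<in> cls c) \<and>
     (\<forall>c\<in>C. \<forall>L\<in>cls c. \<forall>M\<in>cls c. pg_intersect L M \<longrightarrow> L = M)"
    and "\<forall>L\<in>(pg_lines :: ('a ^ 'n) set set). card L = q\<^sup>2"
proof -
  interpret ff: frobenius_field q "TYPE('a alg_closure)" by (rule frobenius_alg_closure(1)[OF q card_a])
  have Fq_range: "ff.Fq = range to_ac"
  proof (rule card_subset_eq[symmetric])
    show "range (to_ac :: 'a \<Rightarrow> _) \<subseteq> ff.Fq"
      using finite_field_power[where 'a = 'a] card_a by (auto simp: ff.Fq_def ff.\<sigma>_def simp flip: to_ac_power)
    show "card (range (to_ac :: 'a \<Rightarrow> _)) = card ff.Fq"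
      using card_image[OF inj_to_ac[where 'a = 'a]] card_a ff.card_Fq by simp
  qed simp
  obtain \<omega> where w: "\<omega> \<in> ff.K" "\<omega> \<notin> ff.Fq" by (rule ff.obtain_\<omega>)
  have "\<omega> + ff.\<sigma> \<omega> \<in> ff.Fq" "\<omega> * ff.\<sigma> \<omega> \<in> ff.Fq" using w(1) by (auto simp: ff.Fq_def ff.sig_K add.commute)
  then obtain tr nm :: 'a where tn: "\<omega> + ff.\<sigma> \<omega> = to_ac tr" "\<omega> * ff.\<sigma> \<omega> = to_ac nm" unfolding Fq_range by auto
  have w2: "\<omega> * \<omega> = to_ac tr * \<omega> - to_ac nm" unfolding tn[symmetric] by (simp add: algebra_simps)
  have coords: "\<exists>r s. \<kappa> = to_ac r + to_ac s * \<omega>" if "\<kappa> \<in> ff.K" for \<kappa>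
    using ff.K_basis[OF w that] unfolding Fq_range by auto
  have unique: "r = r' \<and> s = s'" if eq: "to_ac r + to_ac s * \<omega> = to_ac r' + to_ac s' * \<omega>" for r s r' s' :: 'a
  proof -
    have "to_ac (s - s') * \<omega> = to_ac (r' - r)" using eq by (simp add: algebra_simps)
    moreover have "to_ac (r' - r) / to_ac (s - s') \<in> ff.Fq" unfolding Fq_range to_ac_divide[symmetric] by (rule rangeI)
    ultimately have "s - s' = 0" using w(2) by (metis nonzero_mult_div_cancel_left to_ac_eq_0_iff)
    then show ?thesis using eq by simp
  qed
  (* Coordinates of elements of \<open>K\<close> with respect to \<open>1, \<omega>\<close>, with values in the base field. *)
  define re where "re \<kappa> = (THE r :: 'a. \<exists>s. \<kappa> = to_ac r + to_ac s * \<omega>)" for \<kappa>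
  define im where "im \<kappa> = (THE s :: 'a. \<exists>r. \<kappa> = to_ac r + to_ac s * \<omega>)" for \<kappa>
  have re: "re (to_ac r + to_ac s * \<omega>) = r" for r s unfolding re_def by (rule the_equality) (use unique in blast)+
  have im: "im (to_ac r + to_ac s * \<omega>) = s" for r s unfolding im_def by (rule the_equality) (use unique in blast)+
  have decomp: "\<kappa> = to_ac (re \<kappa>) + to_ac (im \<kappa>) * \<omega>" if "\<kappa> \<in> ff.K" for \<kappa>
    using coords[OF that] re im by metis
  have inK: "to_ac r + to_ac s * \<omega> \<in> ff.K" for r s :: 'a
  proof -
    have "to_ac r \<in> ff.Fq" "to_ac s \<in> ff.Fq" by (auto simp: Fq_range)
    then show ?thesis using w(1) by simp
  qed
  obtain pr :: "'n \<Rightarrow> 'n" and ev :: "'n \<Rightarrow> bool" and i0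
    where pr: "\<And>i. pr (pr i) = i" "\<And>i. ev (pr i) \<longleftrightarrow> \<not> ev i" "ev i0"
    by (rule obtain_pairing[OF card_n n]) blast
  define J :: "'a ^ 'n \<Rightarrow> 'a ^ 'n" where
    "J v = (\<chi> i. if ev i then - nm * v $ pr i else v $ pr i + tr * v $ i)" for v
  have J2: "J (J v) = tr *s J v - nm *s v" for v
    by (simp add: J_def vec_eq_iff pr algebra_simps)
  have J_add: "J (x + y) = J x + J y" for x y by (simp add: J_def vec_eq_iff algebra_simps)
  have J_scale: "J (r *s x) = r *s J x" for r x by (simp add: J_def vec_eq_iff algebra_simps)
  define sc :: "'a alg_closure \<Rightarrow> 'a ^ 'n \<Rightarrow> 'a ^ 'n" where "sc \<kappa> v = re \<kappa> *s v + im \<kappa> *s J v" for \<kappa> v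
  have sc: "sc (to_ac r + to_ac s * \<omega>) v = r *s v + s *s J v" for r s v by (simp add: sc_def re im)
  have sc_Fq: "sc (to_ac r) v = r *s v" for r v using sc[of r 0 v] by simp
  interpret km: kmodule q "TYPE('a alg_closure)" sc
  proof unfold_locales
    fix a x y show "sc a (x + y) = sc a x + sc a y" by (simp add: sc_def J_add vector_add_ldistrib algebra_simps)
  next
    fix a b x assume "a \<in> ff.K" "b \<in> ff.K"
    then obtain r s r' s' where ab: "a = to_ac r + to_ac s * \<omega>" "b = to_ac r' + to_ac s' * \<omega>" using coords by metis
    have "a + b = to_ac (r + r') + to_ac (s + s') * \<omega>" by (simp add: ab algebra_simps)
    then show "sc (a + b) x = sc a x + sc b x" by (simp only: ab sc) (simp add: vector_sadd_rdistrib algebra_simps)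
  next
    fix a b x assume "a \<in> ff.K" "b \<in> ff.K"
    then obtain r s r' s' where ab: "a = to_ac r + to_ac s * \<omega>" "b = to_ac r' + to_ac s' * \<omega>" using coords by metis
    have "a * b = to_ac r * to_ac r' + (to_ac r * to_ac s' + to_ac s * to_ac r') * \<omega> + to_ac s * to_ac s' * (\<omega> * \<omega>)"
      by (simp add: ab algebra_simps)
    also have "\<dots> = to_ac (r * r' - s * s' * nm) + to_ac (r * s' + s * r' + s * s' * tr) * \<omega>"
      unfolding w2 by (simp add: algebra_simps)
    finally have m1: "sc (a * b) x = (r * r' - s * s' * nm) *s x + (r * s' + s * r' + s * s' * tr) *s J x" by (simp only: sc)
    have m2: "sc a (sc b x) = (r * r') *s x + (r * s' + s * r') *s J x + (s * s') *s J (J x)"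
      by (simp only: ab sc) (simp add: J_add J_scale vec_eq_iff algebra_simps)
    show "sc a (sc b x) = sc (a * b) x" unfolding m1 m2 J2 by (simp add: vec_eq_iff algebra_simps)
  next
    show "sc 1 x = x" for x using sc_Fq[of 1 x] by simp
  qed
  define i1 where "i1 = pr i0"
  have i01: "i0 \<noteq> i1" "pr i1 = i0" "pr i0 = i1" "ev i0" "\<not> ev i1"
    using pr(1)[of i0] pr(2)[of i0] pr(3) unfolding i1_def by auto
  define Q :: "('a ^ 'n) set" where "Q = {v. v $ i0 = 0 \<and> v $ i1 = 0}"
  define w0 :: "'a ^ 'n" where "w0 = axis i0 1"
  have sc_w0: "sc (to_ac r + to_ac s * \<omega>) w0 = (\<chi> i. if i = i0 then r else if i = i1 then s else 0)" for r s
  proof -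
    have "pr i = i0 \<longleftrightarrow> i = i1" for i using pr(1) i01 by metis
    then show ?thesis unfolding sc using i01 by (auto simp: vec_eq_iff J_def w0_def axis_def)
  qed
  have QK: "km.Ksubspace Q" unfolding km.Ksubspace_def
  proof (intro conjI ballI)
    fix a x assume "a \<in> ff.K" "x \<in> Q"
    then show "sc a x \<in> Q" using i01 by (simp add: Q_def sc_def J_def)
  qed (auto simp: Q_def)
  have "\<exists>\<kappa>. km.scheme Q \<kappa>"
  proof (cases "q = 3")
    case True
    obtain \<Gamma> :: "((nat \<times> nat) \<times> nat) set" and \<tau> S where "ff.plane_design \<Gamma> \<tau> S" using ff.design_three[OF True] by blast
    then show ?thesis by (rule km.scheme_exists[OF _ QK])
  next
    case False
    then have "q \<in> {4, 8, 16}" using q by auto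
    then obtain \<Gamma> :: "('a alg_closure set \<times> nat) set" and \<tau> S where "ff.plane_design \<Gamma> \<tau> S"
      using ff.design_even[OF _ frobenius_alg_closure(2)[OF q card_a False]] by blast
    then show ?thesis by (rule km.scheme_exists[OF _ QK])
  qed
  then obtain \<kappa> where \<kappa>: "km.scheme Q \<kappa>" ..
  interpret sp: split_kmodule q "TYPE('a alg_closure)" sc Q w0 \<kappa>
  proof unfold_locales
    show "km.Ksubspace Q" by (rule QK)
    show "w0 \<noteq> 0" by (auto simp: w0_def vec_eq_iff axis_def)
    show "km.scheme Q \<kappa>" by (rule \<kappa>)
  next
    fix v :: "'a ^ 'n"
    define y where "y = to_ac (v $ i0) + to_ac (v $ i1) * \<omega>"
    have "v - sc y w0 \<in> Q" unfolding y_def sc_w0 Q_def using i01 by auto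
    moreover have "y \<in> ff.K" unfolding y_def by (rule inK)
    ultimately show "\<exists>x\<in>Q. \<exists>y\<in>ff.K. v = x + sc y w0" by (intro bexI[of _ "v - sc y w0"] bexI[of _ y]) auto
  next
    fix y assume y: "y \<in> ff.K" "sc y w0 \<in> Q"
    obtain r s where rs: "y = to_ac r + to_ac s * \<omega>" using coords[OF y(1)] by auto
    show "y = 0" using y(2) i01 unfolding rs sc_w0 Q_def by auto
  qed
  have lines: "km.line L" if L: "L \<in> pg_lines" for L
  proof -
    obtain a b where ab: "L = {r *s a + s *s b | r s. True}" "\<And>r s. r *s a + s *s b = 0 \<Longrightarrow> r = 0 \<and> s = 0"
      using obtain_basis2[OF L] by blast
    define \<psi> where "\<psi> \<kappa> = re \<kappa> *s a + im \<kappa> *s b" for \<kappa>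
    have \<psi>: "\<psi> (to_ac r + to_ac s * \<omega>) = r *s a + s *s b" for r s by (simp add: \<psi>_def re im)
    have "km.embedding \<psi>" unfolding km.embedding_def
    proof (intro conjI ballI impI)
      fix x y assume "x \<in> ff.K" "y \<in> ff.K"
      then obtain r s r' s' where xy: "x = to_ac r + to_ac s * \<omega>" "y = to_ac r' + to_ac s' * \<omega>" using coords by metis
      have "x + y = to_ac (r + r') + to_ac (s + s') * \<omega>" by (simp add: xy algebra_simps)
      then show "\<psi> (x + y) = \<psi> x + \<psi> y" by (simp only: xy \<psi>) (simp add: vector_sadd_rdistrib algebra_simps)
    next
      fix c x assume "c \<in> ff.Fq" "x \<in> ff.K"
      then obtain t r s where cx: "c = to_ac t" "x = to_ac r + to_ac s * \<omega>" using coords unfolding Fq_range by blast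
      have "c * x = to_ac (t * r) + to_ac (t * s) * \<omega>" by (simp add: cx algebra_simps)
      then show "\<psi> (c * x) = sc c (\<psi> x)" by (simp only: cx \<psi> sc_Fq) (simp add: vec_eq_iff algebra_simps)
    next
      fix x assume x: "x \<in> ff.K" "\<psi> x = 0"
      then have "re x = 0 \<and> im x = 0" using ab(2) unfolding \<psi>_def by blast
      then show "x = 0" using decomp[OF x(1)] by simp
    qed
    moreover have "L = \<psi> ` ff.K"
    proof (intro subset_antisym subsetI)
      fix v assume "v \<in> L"
      then obtain r s where "v = r *s a + s *s b" using ab(1) by blast
      then show "v \<in> \<psi> ` ff.K" using inK[of r s] \<psi>[of r s] by (intro image_eqI[of _ _ "to_ac r + to_ac s * \<omega>"]) auto
    qed (auto simp: ab(1) \<psi>_def)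
    ultimately show ?thesis unfolding km.line_def by blast
  qed
  then show "\<forall>L\<in>(pg_lines :: ('a ^ 'n) set set). card L = q\<^sup>2" using km.line_card by blast
  have meets: "km.meets L M" if LM: "pg_intersect L M" for L M :: "('a ^ 'n) set"
  proof -
    obtain P :: "('a ^ 'n) set" where P: "vec.subspace P" "vec.dim P = 1" "P \<subseteq> L" "P \<subseteq> M"
      using LM by (auto simp: pg_intersect_def pg_points_def)
    have "\<not> P \<subseteq> {0}" using P(2) vec.dim_subset[of P "{0}"] by auto
    then show ?thesis using P by (auto simp: km.meets_def)
  qed
  have card_Q: "card Q = q ^ (n - 1)"
  proof -
    have "bij_betw (\<lambda>(x, y). x + sc y w0) (Q \<times> ff.K) UNIV"
      unfolding bij_betw_def
    proof
      show "inj_on (\<lambda>(x, y). x + sc y w0) (Q \<times> ff.K)" using sp.split_eq by (auto intro!: inj_onI)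
      show "(\<lambda>(x, y). x + sc y w0) ` (Q \<times> ff.K) = UNIV"
      proof (intro subset_antisym subset_UNIV subsetI)
        fix v
        obtain x y where "x \<in> Q" "y \<in> ff.K" "v = x + sc y w0" using sp.split_ex[of v] by blast
        then show "v \<in> (\<lambda>(x, y). x + sc y w0) ` (Q \<times> ff.K)" by (intro image_eqI[of _ _ "(x, y)"]) auto
      qed
    qed
    then have "card (Q \<times> ff.K) = CARD('a ^ 'n)" by (rule bij_betw_same_card)
    then have "card Q * q\<^sup>2 = q ^ (n + 1)" by (simp add: card_cartesian_product ff.card_K card_a card_n)
    moreover have "q ^ (n + 1) = q ^ (n - 1) * q\<^sup>2" using n by (cases n) (auto simp: power2_eq_square)
    ultimately show ?thesis using ff.q3 by auto
  qed
  have "n \<ge> 1" using n by (cases n) auto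
  note cols = sp.card_colours[OF _ card_Q this]
  show "\<exists>(cls :: (('a ^ 'n) set \<times> 'a alg_closure \<times> 'a alg_closure) option \<Rightarrow> ('a ^ 'n) set set) C.
     finite C \<and> card C * (q - 1) \<le> q ^ n - 1 \<and>
     (\<forall>L\<in>pg_lines. \<exists>c\<in>C. L \<in> cls c) \<and>
     (\<forall>c\<in>C. \<forall>L\<in>cls c. \<forall>M\<in>cls c. pg_intersect L M \<longrightarrow> L = M)"
  proof (intro exI[of _ sp.line_class] exI[of _ sp.colours] conjI ballI impI)
    show "finite sp.colours" "card sp.colours * (q - 1) \<le> q ^ n - 1" using cols by auto
  next
    fix L :: "('a ^ 'n) set" assume "L \<in> pg_lines"
    then show "\<exists>c\<in>sp.colours. L \<in> sp.line_class c" using sp.class_cover[OF lines] by blast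
  next
    fix c L M assume "c \<in> sp.colours" "L \<in> sp.line_class c" "M \<in> sp.line_class c" "pg_intersect L M"
    then show "L = M" using sp.class_disjoint meets by blast
  qed
qed

text \<open>
  The lines through a fixed point \<open>P\<close> have different colours. Each of them has at most \<open>q\<^sup>2 - q\<close> vectors outside
  \<open>P\<close>, and together they cover the \<open>q\<^sup>n\<^sup>+\<^sup>1 - q\<close> vectors outside \<open>P\<close>.
\<close>
lemma colours_lower_bound:
  fixes c :: "('a::{field,finite} ^ 'n::finite) set \<Rightarrow> nat"
  assumes col: "line_coloring {..<k} c" and card_lines: "\<forall>L\<in>(pg_lines :: ('a ^ 'n) set set). card L \<le> (CARD('a))\<^sup>2"
    and card_n: "CARD('n) = n + 1"
  shows "CARD('a) ^ n - 1 \<le> k * (CARD('a) - 1)"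
proof -
  define q where "q = CARD('a)"
  have q2: "q \<ge> 2" unfolding q_def using card_mono[of "UNIV :: 'a set" "{0, 1}"] by simp
  define x0 :: "'a ^ 'n" where "x0 = axis undefined 1"
  have x0: "x0 \<noteq> 0" by (auto simp: x0_def vec_eq_iff axis_def)
  define P where "P = vec.span {x0}"
  have cP: "card P = q"
  proof -
    have "P = range (\<lambda>r. r *s x0)" by (simp add: P_def vec.span_singleton full_SetCompr_eq)
    moreover have "inj (\<lambda>r. r *s x0)" using x0 by (auto intro!: injI)
    ultimately show ?thesis by (simp add: card_image q_def)
  qed
  have P: "P \<in> pg_points" using x0 unfolding pg_points_def P_def by (simp add: vec.dim_span vec.dim_singleton)
  define LL where "LL = {L \<in> pg_lines. P \<subseteq> L}"
  have "inj_on c LL"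
  proof (rule inj_onI, rule ccontr)
    fix L M assume LM: "L \<in> LL" "M \<in> LL" "c L = c M" "L \<noteq> M"
    then have "pg_intersect L M" using P by (auto simp: LL_def pg_intersect_def)
    with LM col show False by (auto simp: LL_def line_coloring_def)
  qed
  moreover have "c ` LL \<subseteq> {..<k}" using col by (auto simp: LL_def line_coloring_def)
  ultimately have cLL: "card LL \<le> k" using card_inj_on_le[of c LL "{..<k}"] by simp
  have "UNIV - P \<subseteq> (\<Union>L\<in>LL. L - P)"
  proof
    fix v assume v: "v \<in> UNIV - P"
    have indep: "vec.independent {v, x0}" using v x0 by (auto simp: P_def vec.independent_insert)
    moreover have "v \<noteq> x0" using v by (auto simp: P_def vec.span_base)
    ultimately have "vec.dim (vec.span {v, x0}) = 2" using vec.dim_eq_card_independent[OF indep] by (simp add: vec.dim_span)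
    then have "vec.span {v, x0} \<in> LL" unfolding LL_def pg_lines_def P_def by (auto intro: vec.span_mono[THEN subsetD])
    moreover have "v \<in> vec.span {v, x0}" by (simp add: vec.span_base)
    ultimately show "v \<in> (\<Union>L\<in>LL. L - P)" using v by blast
  qed
  then have "card (UNIV - P) \<le> card (\<Union>L\<in>LL. L - P)" by (intro card_mono) auto
  also have "\<dots> \<le> (\<Sum>L\<in>LL. card (L - P))" by (rule card_UN_le) simp
  also have "\<dots> \<le> (\<Sum>L\<in>LL. q\<^sup>2 - q)"
  proof (rule sum_mono)
    fix L assume "L \<in> LL"
    then have "P \<subseteq> L" "card L \<le> q\<^sup>2" using card_lines by (auto simp: LL_def q_def)
    then show "card (L - P) \<le> q\<^sup>2 - q" using cP by (simp add: card_Diff_subset)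
  qed
  also have "\<dots> \<le> k * (q\<^sup>2 - q)" using cLL by simp
  finally have "card (UNIV - P) \<le> k * (q\<^sup>2 - q)" .
  moreover have "card (UNIV - P) = q ^ (n + 1) - q" using cP by (simp add: card_Diff_subset card_n q_def)
  ultimately have "q * (q ^ n - 1) \<le> q * (k * (q - 1))"
    by (simp add: power2_eq_square right_diff_distrib' mult_ac)
  then show ?thesis using q2 by (simp add: q_def)
qed

theorem theorem1p3:
  fixes n q :: nat
  assumes "odd n" and "n \<ge> 3"
    and "q \<in> {3, 4, 8, 16}"
    and "CARD('a::{field,finite}) = q"
    and "CARD('n::finite) = n + 1"
  shows "real (pg_chromatic_index TYPE('a ^ 'n)) = (real q ^ n - 1) / (real q - 1)"
proof -
  obtain cls :: "(('a ^ 'n) set \<times> 'a alg_closure \<times> 'a alg_closure) option \<Rightarrow> ('a ^ 'n) set set" and C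
    where C: "finite C" "card C * (q - 1) \<le> q ^ n - 1" and cover: "\<And>L. L \<in> pg_lines \<Longrightarrow> \<exists>c\<in>C. L \<in> cls c"
      and disj: "\<And>c L M. c \<in> C \<Longrightarrow> L \<in> cls c \<Longrightarrow> M \<in> cls c \<Longrightarrow> pg_intersect L M \<Longrightarrow> L = M"
    using parallelism(1)[where 'a = 'a and 'n = 'n, OF assms(1,3,4,5)] by metis
  obtain num where num: "bij_betw num C {0..<card C}" using ex_bij_betw_finite_nat[OF C(1)] by blast
  define pick where "pick L = (SOME c. c \<in> C \<and> L \<in> cls c)" for L
  have pick: "pick L \<in> C" "L \<in> cls (pick L)" if "L \<in> pg_lines" for L
    using someI_ex[of "\<lambda>c. c \<in> C \<and> L \<in> cls c"] cover[OF that] unfolding pick_def by auto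
  have good: "line_coloring {..<card C} (\<lambda>L :: ('a ^ 'n) set. num (pick L))" unfolding line_coloring_def
  proof (intro conjI ballI impI funcsetI)
    fix L :: "('a ^ 'n) set" assume "L \<in> pg_lines"
    then show "num (pick L) \<in> {..<card C}" using num pick(1) by (auto simp: bij_betw_def)
  next
    fix L M :: "('a ^ 'n) set" assume LM: "L \<in> pg_lines" "M \<in> pg_lines" "L \<noteq> M \<and> pg_intersect L M"
    show "num (pick L) \<noteq> num (pick M)"
    proof
      assume "num (pick L) = num (pick M)"
      then have "pick L = pick M" using num pick(1) LM by (auto simp: bij_betw_def dest: inj_onD)
      then show False using disj[OF pick(1)[OF LM(1)]] pick(2) LM by metis
    qed
  qed
  define N where "N = pg_chromatic_index TYPE('a ^ 'n)"
  have "N \<le> card C" unfolding N_def pg_chromatic_index_def by (rule Least_le) (use good in blast)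
  then have "N * (q - 1) \<le> card C * (q - 1)" by simp
  then have upper: "N * (q - 1) \<le> q ^ n - 1" using C(2) by (rule le_trans)
  have "\<exists>c :: ('a ^ 'n) set \<Rightarrow> nat. line_coloring {..<N} c"
    unfolding N_def pg_chromatic_index_def by (rule LeastI[of _ "card C"]) (use good in blast)
  then obtain c :: "('a ^ 'n) set \<Rightarrow> nat" where c: "line_coloring {..<N} c" ..
  have "\<forall>L\<in>(pg_lines :: ('a ^ 'n) set set). card L \<le> (CARD('a))\<^sup>2"
    using parallelism(2)[where 'a = 'a and 'n = 'n, OF assms(1,3,4,5)] assms(4) by simp
  from colours_lower_bound[OF c this assms(5)] have "q ^ n - 1 \<le> N * (q - 1)" using assms(4) by simp
  with upper have "N * (q - 1) = q ^ n - 1" by simp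
  then have "real (N * (q - 1)) = real (q ^ n - 1)" by simp
  moreover have "q \<ge> 1" "q ^ n \<ge> 1" using assms(3) by auto
  ultimately have "real N * (real q - 1) = real q ^ n - 1" by (simp add: of_nat_diff)
  moreover have "real q - 1 \<noteq> 0" using assms(3) by auto
  ultimately show ?thesis unfolding N_def by (simp add: field_simps)
qed

end
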